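(* Assume the spectral gap, removable singularity, quadratic degeneracy, $a$-regularity, $b$-regularity and unitary transfer conditions stated in the context. Then for every interval $[a,b]\subset(-\infty,\infty)$, $$\mathrm{dist}_{[a,b]}\Big(\overline{\bigcup_{\theta\in\Theta}\mathrm{Sp}\,\mathcal L_{\varepsilon,\theta}}\,,\ \overline{\bigcup_{\xi\in\mathbb R^n}\mathrm{Sp}\,\mathbb L_\xi}\Big)\le C_b\,\varepsilon\qquad\forall\,0<\varepsilon<1,$$ with a constant $C_b$ independent of $\varepsilon$ and $a$, satisfying $C_b\le C(1+b^2)$ with $C$ independent of $b$. In particular, $\overline{\bigcup_{\theta\in\Theta}\mathrm{Sp}\,\mathcal L_{\varepsilon,\theta}}$ converges to $\overline{\bigcup_{\xi\in\mathbb R^n}\mathrm{Sp}\,\mathbb L_\xi}$ in the Fell topology as $\varepsilon\to0$.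
   Context: $\mathrm{Sp}$ denotes the spectrum. $\mathrm{dist}_{[a,b]}(X,Y):=\max\big(\mathrm{dist}([a,b]\cap X,Y),\mathrm{dist}([a,b]\cap Y,X)\big)$, where $\mathrm{dist}(X,Y):=\sup_{x\in X}\mathrm{dist}(x,Y)$ is the non-symmetric distance, with the convention $\mathrm{dist}(\emptyset,A)=\mathrm{dist}(A,\emptyset)=0$ for any set $A$. $H$ is a separable complex Hilbert space, $n\ge 1$, $\Theta\subset\mathbb R^n$ is compact and connected with $0$ an interior point, and for each $\theta\in\Theta$, $a_\theta$ and $b_\theta$ are non-negative sesquilinear forms on $H\times H$. For a sesquilinear form $\mathfrak b$ write $\mathfrak b[u]:=\mathfrak b(u,u)$. Standing assumptions: for each $\theta$, $(u,\tilde u)_\theta:=a_\theta(u,\tilde u)+b_\theta(u,\tilde u)$ is an inner product on $H$ equivalent to the original one, with norm $\|\cdot\|_\theta$; there is $K>0$ with $\|u\|_{\theta_1}\le K\|u\|_{\theta_2}$ for all $u\in H$, $\theta_1,\theta_2\in\Theta$; there is $L_a>0$ with $|a_{\theta_1}(u,\tilde u)-a_{\theta_2}(u,\tilde u)|\le L_a|\theta_1-\theta_2|\,\|u\|_{\theta_1}\|\tilde u\|_{\theta_1}$ for all $u,\tilde u\in H$, $\theta_1,\theta_2\in\Theta$. $V_\theta:=\{v\in H: a_\theta[v]=0\}$ (a closed subspace), $W_\theta:=\{w\in H:(w,v)_\theta=0\ \forall v\in V_\theta\}$. Spectral gap condition: for every $\theta\in\Theta$ there is $\nu_\theta>0$ with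 $a_\theta[w]\ge\nu_\theta\|w\|_\theta^2$ for all $w\in W_\theta$. Removable singularity condition: there are a closed subspace $V_\star\subset H$ and $L_\star\ge0$ such that, with $V^\star_\theta:=V_\theta$ for $\theta\ne0$ and $V^\star_0:=V_\star$, one has $\inf_{v_2\in V^\star_{\theta_2}}\|v_1-v_2\|_{\theta_2}\le L_\star|\theta_1-\theta_2|\,\|v_1\|_{\theta_1}$ for all $v_1\in V^\star_{\theta_1}$, $\theta_1,\theta_2\in\Theta$. (Then $V_\star\subset V_0$.) $Z$ is a fixed closed subspace of $V_0$ with $V_0=V_\star\dot+Z$ (direct sum) and, for some $0\le K_Z<1$, $|(v_\star,z)_0|\le K_Z\|v_\star\|_0\|z\|_0$ for all $v_\star\in V_\star$, $z\in Z$. Quadratic degeneracy: there is $\gamma>0$ with $a_\theta[w]\ge\gamma|\theta|^2\|w\|_\theta^2$ for all $w\in W_\theta$, $\theta\in\Theta$. $a$-regularity: there exist sesquilinear maps $a_0':V_0\times H\to\mathbb C^n$, $a_0'':V_0\times V_0\to\mathbb C^{n\times n}$ and constants $K_{a'},K_{a''}\ge0$ with $|a_\theta(v,u)-a_0'(v,u)\cdot\theta|\le K_{a'}|\theta|^2\|v\|_0\|u\|_0$ for all $v\in V_0,u\in H,\theta\in\Theta$, and $|a_\theta(v,\tilde v)-a_0''(v,\tilde v)\theta\cdot\theta|\le K_{a''}|\theta|^3\|v\|_0\|\tilde v\|_0$ for all $v,\tilde v\in V_0$, $\theta\in\Theta$. $b$-regularity: there is $L_b\ge0$ with $|b_\theta(v,\tilde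 v)-b_0(v,\tilde v)|\le L_b|\theta|\,\|v\|_0\|\tilde v\|_\theta$ for all $v,\tilde v\in V_0$, $\theta\in\Theta$. Homogenised form: for $\theta\in\mathbb R^n$, $N_\theta:V_0\to W_0$ is the linear map such that $N_\theta v$ is the unique solution in $W_0$ of $a_0(N_\theta v,\tilde w_0)=-a_0'(v,\tilde w_0)\cdot\theta$ for all $\tilde w_0\in W_0$; and $a^{\rm h}_\theta(v,\tilde v):=a_0''(v,\tilde v)\theta\cdot\theta-a_0(N_\theta v,N_\theta\tilde v)$ for $v,\tilde v\in V_0$, $\theta\in\mathbb R^n$. Ambient space: $\mathcal H$ is a complex separable Hilbert space with a family of equivalent inner products $d_\theta$, $\theta\in\Theta$, such that $d_{\theta_1}[u]\le K_d\,d_{\theta_2}[u]$ for some $K_d>0$ and all $u,\theta_1,\theta_2$; $H$ is a compactly embedded dense subset of $\mathcal H$; and $d_\theta[u]\le b_\theta[u]$ for all $u\in H$, $\theta\in\Theta$. $\mathcal L_{\varepsilon,\theta}$ is the self-adjoint operator in $(\mathcal H,d_\theta)$ generated by the closed form $\varepsilon^{-2}a_\theta+b_\theta$ with form domain $H$. $\mathcal H_0$ is the closure of $V_\star\dot+Z$ in $\mathcal H$, equipped with $d_0$. For $\xi\in\mathbb R^n$, $\mathbb L_\xi$ is the self-adjoint operator in $\mathcal H_0$ generated by the form $\mathbb S_\xi(v+z,\tilde v+\tilde z):=a^{\rm h}_\xi(z,\tilde z)+b_0(v+z,\tilde v+\tilde z)$ with form domain $V_\star\dot+Z$. Unitary transfer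 condition: there are linear bijections $\mathcal E_\theta:V_\star\to V_\theta^\star$, $\theta\in\Theta$, with $b_\theta(\mathcal E_\theta v,\mathcal E_\theta\tilde v)=b_0(v,\tilde v)$ for all $v,\tilde v\in V_\star$ and $|b_\theta(\mathcal E_\theta v,z)-b_0(v,z)|\le K_b|\theta|\|v\|_0\|z\|_0$ for all $v\in V_\star,z\in Z$ ($K_b\ge0$ independent of $\theta$), which extend to bijections of $\mathcal H$ (again denoted $\mathcal E_\theta$) satisfying $d_\theta(\mathcal E_\theta u,\mathcal E_\theta\tilde u)=d_0(u,\tilde u)$ for all $u,\tilde u\in\mathcal H$, $\mathcal E_0=I$, and $\|\mathcal E_{\theta_1}-\mathcal E_{\theta_2}\|_{(\mathcal H,d_0)\to(\mathcal H,d_{\theta_1})}\le K_e|\theta_1-\theta_2|$ for all $\theta_1,\theta_2\in\Theta$ and some $K_e\ge0$. *)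

theory Defs
  imports "HOL-Analysis.Analysis"
begin

section \<open>Complex Hilbert spaces with explicit carrier and inner product\<close>

text \<open>
  The library has no class of complex Hilbert spaces, and here one vector space carries many inner
  products on several nested subspaces. All spaces are therefore subsets of one complex vector
  space with scalar multiplication \<open>s\<close>, and each inner product is a function whose values matter only
  on its carrier. Forms are linear in the first argument and conjugate-linear in the second.
\<close>

definition sesquilinear_on ::
  "(complex \<Rightarrow> 'h \<Rightarrow> 'h) \<Rightarrow> 'h::ab_group_add set \<Rightarrow> 'h set \<Rightarrow> ('h \<Rightarrow> 'h \<Rightarrow> complex) \<Rightarrow> bool" where
  "sesquilinear_on s U V q \<longleftrightarrow>
     (\<forall>x\<in>U. \<forall>y\<in>U. \<forall>v\<in>V. q (x + y) v = q x v + q y v) \<and>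
     (\<forall>c. \<forall>x\<in>U. \<forall>v\<in>V. q (s c x) v = c * q x v) \<and>
     (\<forall>x\<in>U. \<forall>v\<in>V. \<forall>w\<in>V. q x (v + w) = q x v + q x w) \<and>
     (\<forall>c. \<forall>x\<in>U. \<forall>v\<in>V. q x (s c v) = cnj c * q x v)"

definition nonneg_form_on ::
  "(complex \<Rightarrow> 'h \<Rightarrow> 'h) \<Rightarrow> 'h::ab_group_add set \<Rightarrow> ('h \<Rightarrow> 'h \<Rightarrow> complex) \<Rightarrow> bool" where
  "nonneg_form_on s X q \<longleftrightarrow> sesquilinear_on s X X q \<and> (\<forall>u\<in>X. q u u \<in> \<real>\<^sub>\<ge>\<^sub>0)"

definition inner_product_on ::
  "(complex \<Rightarrow> 'h \<Rightarrow> 'h) \<Rightarrow> 'h::ab_group_add set \<Rightarrow> ('h \<Rightarrow> 'h \<Rightarrow> complex) \<Rightarrow> bool" where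
  "inner_product_on s X q \<longleftrightarrow> nonneg_form_on s X q \<and> (\<forall>u\<in>X. q u u = 0 \<longrightarrow> u = 0)"

definition form_norm :: "('h \<Rightarrow> 'h \<Rightarrow> complex) \<Rightarrow> 'h \<Rightarrow> real" where
  "form_norm q u = sqrt (Re (q u u))"

text \<open>The distance is cut off outside \<open>X\<close> because the locale \<open>Metric_space\<close> demands symmetry and
  non-negativity on the whole type.\<close>

definition form_dist :: "'h::ab_group_add set \<Rightarrow> ('h \<Rightarrow> 'h \<Rightarrow> complex) \<Rightarrow> 'h \<Rightarrow> 'h \<Rightarrow> real" where
  "form_dist X q u v = (if u \<in> X \<and> v \<in> X then form_norm q (u - v) else 0)"

definition form_topology :: "'h::ab_group_add set \<Rightarrow> ('h \<Rightarrow> 'h \<Rightarrow> complex) \<Rightarrow> 'h topology" where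
  "form_topology X q = Metric_space.mtopology X (form_dist X q)"

lemma form_norm_triangle:
  assumes s: "vector_space s" and X: "module.subspace s X" and q: "nonneg_form_on s X q"
    and x: "x \<in> X" and y: "y \<in> X"
  shows "form_norm q (x + y) \<le> form_norm q x + form_norm q y"
proof -
  interpret vector_space s by (fact s)
  define A B C where "A = Re (q x x)" and "B = Re (q x y + q y x) / 2" and "C = Re (q y y)"
  have pos: "0 \<le> Re (q u u)" if "u \<in> X" for u
    using q that unfolding nonneg_form_on_def by (auto simp: nonneg_Reals_def)
  have quad: "0 \<le> A + 2 * t * B + t\<^sup>2 * C"
    and one: "Re (q (x + y) (x + y)) = A + 2 * B + C" for t :: real
  proof -
    have expand: "Re (q (x + s (of_real t) y) (x + s (of_real t) y)) = A + 2 * t * B + t\<^sup>2 * C"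
      for t :: real
      using q x y subspace_scale[OF X y] subspace_add[OF X]
      unfolding nonneg_form_on_def sesquilinear_on_def A_def B_def C_def
      by (simp add: algebra_simps power2_eq_square)
    show "0 \<le> A + 2 * t * B + t\<^sup>2 * C"
      using pos[of "x + s (of_real t) y"] expand[of t] x subspace_scale[OF X y] subspace_add[OF X]
      by simp
    show "Re (q (x + y) (x + y)) = A + 2 * B + C"
      using expand[of 1] by simp
  qed
  have AC: "0 \<le> A" "0 \<le> C"
    using pos x y by (auto simp: A_def C_def)
  have "B \<le> sqrt A * sqrt C"
  proof (cases "C = 0")
    case True
    have "B \<le> 0"
    proof (rule ccontr)
      assume "\<not> B \<le> 0"
      then show False
        using quad[of "- (A + 1) / (2 * B)"] True by (simp add: field_simps)
    qed
    then show ?thesis using True by simp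
  next
    case False
    then have "C > 0" using AC by simp
    then have "B\<^sup>2 \<le> A * C"
      using quad[of "- B / C"] by (simp add: field_simps power2_eq_square)
    then show ?thesis
      by (metis real_sqrt_mult real_le_rsqrt)
  qed
  then have "A + 2 * B + C \<le> (sqrt A + sqrt C)\<^sup>2"
    using AC by (simp add: power2_sum)
  then show ?thesis
    using AC one by (simp add: form_norm_def A_def C_def real_le_lsqrt)
qed

lemma Metric_space_form_dist:
  assumes s: "vector_space s" and X: "module.subspace s X" and q: "inner_product_on s X q"
  shows "Metric_space X (form_dist X q)"
proof
  interpret vector_space s by (fact s)
  have qn: "nonneg_form_on s X q" and def: "\<And>u. u \<in> X \<Longrightarrow> q u u = 0 \<Longrightarrow> u = 0"
    using q unfolding inner_product_on_def by auto
  have pos: "q u u \<in> \<real>\<^sub>\<ge>\<^sub>0" if "u \<in> X" for u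
    using qn that unfolding nonneg_form_on_def by auto
  have scale: "q (s c u) (s c u) = c * cnj c * q u u" if "u \<in> X" for c u
    using qn that subspace_scale[OF X that]
    unfolding nonneg_form_on_def sesquilinear_on_def by simp
  have minus: "q (- u) (- u) = q u u" if "u \<in> X" for u
    using scale[OF that, of "-1"] by simp
  have zero: "q 0 0 = 0"
    using scale[OF subspace_0[OF X], of 0] by simp
  show "0 \<le> form_dist X q x y" for x y
    using pos[of "x - y"] subspace_diff[OF X]
    by (auto simp: form_dist_def form_norm_def nonneg_Reals_def)
  show "form_dist X q x y = form_dist X q y x" for x y
    using minus[of "x - y"] subspace_diff[OF X]
    by (auto simp: form_dist_def form_norm_def)
  show "form_dist X q x y = 0 \<longleftrightarrow> x = y" if "x \<in> X" "y \<in> X" for x y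
    using pos[of "x - y"] subspace_diff[OF X] that def[of "x - y"] zero
    by (auto simp: form_dist_def form_norm_def nonneg_Reals_def)
  show "form_dist X q x z \<le> form_dist X q x y + form_dist X q y z"
    if "x \<in> X" "y \<in> X" "z \<in> X" for x y z
    using form_norm_triangle[OF s X qn, of "x - y" "y - z"] subspace_diff[OF X] that
    by (simp add: form_dist_def)
qed

definition hilbert_space_on ::
  "(complex \<Rightarrow> 'h \<Rightarrow> 'h) \<Rightarrow> 'h::ab_group_add set \<Rightarrow> ('h \<Rightarrow> 'h \<Rightarrow> complex) \<Rightarrow> bool" where
  "hilbert_space_on s X q \<longleftrightarrow>
     vector_space s \<and> module.subspace s X \<and> inner_product_on s X q \<and>
     Metric_space.mcomplete X (form_dist X q)"

definition closed_subspace ::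
  "(complex \<Rightarrow> 'h \<Rightarrow> 'h) \<Rightarrow> 'h::ab_group_add set \<Rightarrow> ('h \<Rightarrow> 'h \<Rightarrow> complex) \<Rightarrow> 'h set \<Rightarrow> bool" where
  "closed_subspace s X q V \<longleftrightarrow> module.subspace s V \<and> closedin (form_topology X q) V"

definition equivalent_norms_on ::
  "'h set \<Rightarrow> ('h \<Rightarrow> 'h \<Rightarrow> complex) \<Rightarrow> ('h \<Rightarrow> 'h \<Rightarrow> complex) \<Rightarrow> bool" where
  "equivalent_norms_on X p q \<longleftrightarrow>
     (\<exists>c>0. \<exists>C>0. \<forall>u\<in>X. c * form_norm q u \<le> form_norm p u \<and> form_norm p u \<le> C * form_norm q u)"

definition direct_sum :: "'h::ab_group_add set \<Rightarrow> 'h set \<Rightarrow> 'h set \<Rightarrow> bool" where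
  "direct_sum U V W \<longleftrightarrow> U = {v + w | v w. v \<in> V \<and> w \<in> W} \<and> V \<inter> W = {0}"


section \<open>Operators generated by forms and their spectra\<close>

text \<open>
  An unbounded operator is given by its graph. The operator generated by the form \<open>q\<close> with form
  domain \<open>D\<close> in the Hilbert space \<open>(X, d)\<close> maps \<open>u\<close> to the \<open>f\<close> that represents \<open>q u\<close> on \<open>D\<close>, and its domain
  consists of those \<open>u\<close> for which such an \<open>f\<close> exists.
\<close>

definition form_operator ::
  "'h set \<Rightarrow> ('h \<Rightarrow> 'h \<Rightarrow> complex) \<Rightarrow> 'h set \<Rightarrow> ('h \<Rightarrow> 'h \<Rightarrow> complex) \<Rightarrow> ('h \<times> 'h) set" where
  "form_operator X d D q = {(u, f). u \<in> D \<and> f \<in> X \<and> (\<forall>v\<in>D. q u v = d f v)}"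

text \<open>\<open>\<mu>\<close> is in the resolvent set if \<open>A - \<mu>\<close> maps the domain of \<open>A\<close> bijectively onto \<open>X\<close>, with
  bounded inverse.\<close>

definition resolvent_set ::
  "(complex \<Rightarrow> 'h \<Rightarrow> 'h) \<Rightarrow> 'h::ab_group_add set \<Rightarrow> ('h \<Rightarrow> 'h \<Rightarrow> complex) \<Rightarrow> ('h \<times> 'h) set \<Rightarrow> complex set"
  where
  "resolvent_set s X d A =
     {\<mu>. (\<forall>f\<in>X. \<exists>!u. (u, f + s \<mu> u) \<in> A) \<and>
         (\<exists>C. \<forall>(u, g)\<in>A. form_norm d u \<le> C * form_norm d (g - s \<mu> u))}"

definition spectrum ::
  "(complex \<Rightarrow> 'h \<Rightarrow> 'h) \<Rightarrow> 'h::ab_group_add set \<Rightarrow> ('h \<Rightarrow> 'h \<Rightarrow> complex) \<Rightarrow> ('h \<times> 'h) set \<Rightarrow> complex set"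
  where
  "spectrum s X d A = - resolvent_set s X d A"


section \<open>Distances between spectra and the Fell topology\<close>

text \<open>Extended reals, as the supremum may be infinite for unbounded sets.\<close>

definition semidist :: "'a::metric_space set \<Rightarrow> 'a set \<Rightarrow> ereal" where
  "semidist X Y = (if X = {} \<or> Y = {} then 0 else (SUP x\<in>X. ereal (infdist x Y)))"

definition dist_interval :: "real \<Rightarrow> real \<Rightarrow> complex set \<Rightarrow> complex set \<Rightarrow> ereal" where
  "dist_interval \<alpha> \<beta> X Y =
     max (semidist (complex_of_real ` {\<alpha>..\<beta>} \<inter> X) Y) (semidist (complex_of_real ` {\<alpha>..\<beta>} \<inter> Y) X)"

text \<open>The topology on the set of all closed subsets with the sets of closed \<open>F\<close> missing a given
  compact set, or hitting a given open set, as subbase.\<close>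

definition fell_topology :: "'a::topological_space set topology" where
  "fell_topology = topology_generated_by
     ({{F. closed F \<and> F \<inter> K = {}} | K. compact K} \<union> {{F. closed F \<and> F \<inter> U \<noteq> {}} | U. open U})"


section \<open>The family of forms\<close>

definition norm_form ::
  "('t \<Rightarrow> 'h \<Rightarrow> 'h \<Rightarrow> complex) \<Rightarrow> ('t \<Rightarrow> 'h \<Rightarrow> 'h \<Rightarrow> complex) \<Rightarrow> 't \<Rightarrow> 'h \<Rightarrow> 'h \<Rightarrow> complex" where
  "norm_form a b \<theta> u v = a \<theta> u v + b \<theta> u v"

definition form_family ::
  "(complex \<Rightarrow> 'h \<Rightarrow> 'h) \<Rightarrow> 'h::ab_group_add set \<Rightarrow> ('h \<Rightarrow> 'h \<Rightarrow> complex) \<Rightarrow> (real^'n) set \<Rightarrow>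
   (real^'n \<Rightarrow> 'h \<Rightarrow> 'h \<Rightarrow> complex) \<Rightarrow> (real^'n \<Rightarrow> 'h \<Rightarrow> 'h \<Rightarrow> complex) \<Rightarrow> bool" where
  "form_family s H ip \<Theta> a b \<longleftrightarrow>
     hilbert_space_on s H ip \<and> separable_space (form_topology H ip) \<and>
     compact \<Theta> \<and> connected \<Theta> \<and> 0 \<in> interior \<Theta> \<and>
     (\<forall>\<theta>\<in>\<Theta>. nonneg_form_on s H (a \<theta>) \<and> nonneg_form_on s H (b \<theta>) \<and>
        inner_product_on s H (norm_form a b \<theta>) \<and>
        equivalent_norms_on H (norm_form a b \<theta>) ip) \<and>
     (\<exists>K>0. \<forall>u\<in>H. \<forall>\<theta>\<^sub>1\<in>\<Theta>. \<forall>\<theta>\<^sub>2\<in>\<Theta>.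
        form_norm (norm_form a b \<theta>\<^sub>1) u \<le> K * form_norm (norm_form a b \<theta>\<^sub>2) u) \<and>
     (\<exists>L>0. \<forall>u\<in>H. \<forall>v\<in>H. \<forall>\<theta>\<^sub>1\<in>\<Theta>. \<forall>\<theta>\<^sub>2\<in>\<Theta>.
        cmod (a \<theta>\<^sub>1 u v - a \<theta>\<^sub>2 u v)
          \<le> L * norm (\<theta>\<^sub>1 - \<theta>\<^sub>2) * form_norm (norm_form a b \<theta>\<^sub>1) u * form_norm (norm_form a b \<theta>\<^sub>1) v)"

definition null_space :: "'h set \<Rightarrow> ('t \<Rightarrow> 'h \<Rightarrow> 'h \<Rightarrow> complex) \<Rightarrow> 't \<Rightarrow> 'h set" where
  "null_space H a \<theta> = {v \<in> H. a \<theta> v v = 0}"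

definition null_complement ::
  "'h set \<Rightarrow> ('t \<Rightarrow> 'h \<Rightarrow> 'h \<Rightarrow> complex) \<Rightarrow> ('t \<Rightarrow> 'h \<Rightarrow> 'h \<Rightarrow> complex) \<Rightarrow> 't \<Rightarrow> 'h set" where
  "null_complement H a b \<theta> = {w \<in> H. \<forall>v\<in>null_space H a \<theta>. norm_form a b \<theta> w v = 0}"

definition spectral_gap ::
  "'h set \<Rightarrow> (real^'n) set \<Rightarrow> (real^'n \<Rightarrow> 'h \<Rightarrow> 'h \<Rightarrow> complex) \<Rightarrow>
   (real^'n \<Rightarrow> 'h \<Rightarrow> 'h \<Rightarrow> complex) \<Rightarrow> bool" where
  "spectral_gap H \<Theta> a b \<longleftrightarrow>
     (\<forall>\<theta>\<in>\<Theta>. \<exists>\<nu>>0. \<forall>w\<in>null_complement H a b \<theta>.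
        Re (a \<theta> w w) \<ge> \<nu> * (form_norm (norm_form a b \<theta>) w)\<^sup>2)"

text \<open>\<open>Vs\<close> is the closed subspace that replaces the null space at the singular point \<open>\<theta> = 0\<close>.\<close>

definition V_star ::
  "'h set \<Rightarrow> ('t::zero \<Rightarrow> 'h \<Rightarrow> 'h \<Rightarrow> complex) \<Rightarrow> 'h set \<Rightarrow> 't \<Rightarrow> 'h set" where
  "V_star H a Vs \<theta> = (if \<theta> = 0 then Vs else null_space H a \<theta>)"

definition removable_singularity ::
  "(complex \<Rightarrow> 'h \<Rightarrow> 'h) \<Rightarrow> 'h::ab_group_add set \<Rightarrow> ('h \<Rightarrow> 'h \<Rightarrow> complex) \<Rightarrow> (real^'n) set \<Rightarrow>
   (real^'n \<Rightarrow> 'h \<Rightarrow> 'h \<Rightarrow> complex) \<Rightarrow> (real^'n \<Rightarrow> 'h \<Rightarrow> 'h \<Rightarrow> complex) \<Rightarrow> 'h set \<Rightarrow> bool" where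
  "removable_singularity s H ip \<Theta> a b Vs \<longleftrightarrow>
     closed_subspace s H ip Vs \<and>
     (\<exists>L\<ge>0. \<forall>\<theta>\<^sub>1\<in>\<Theta>. \<forall>\<theta>\<^sub>2\<in>\<Theta>. \<forall>v\<^sub>1\<in>V_star H a Vs \<theta>\<^sub>1.
        (INF v\<^sub>2\<in>V_star H a Vs \<theta>\<^sub>2. form_norm (norm_form a b \<theta>\<^sub>2) (v\<^sub>1 - v\<^sub>2))
          \<le> L * norm (\<theta>\<^sub>1 - \<theta>\<^sub>2) * form_norm (norm_form a b \<theta>\<^sub>1) v\<^sub>1)"

definition complement_of_V_star ::
  "(complex \<Rightarrow> 'h \<Rightarrow> 'h) \<Rightarrow> 'h::ab_group_add set \<Rightarrow> ('h \<Rightarrow> 'h \<Rightarrow> complex) \<Rightarrow>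
   (real^'n \<Rightarrow> 'h \<Rightarrow> 'h \<Rightarrow> complex) \<Rightarrow> (real^'n \<Rightarrow> 'h \<Rightarrow> 'h \<Rightarrow> complex) \<Rightarrow>
   'h set \<Rightarrow> 'h set \<Rightarrow> bool" where
  "complement_of_V_star s H ip a b Vs Z \<longleftrightarrow>
     closed_subspace s H ip Z \<and> direct_sum (null_space H a 0) Vs Z \<and>
     (\<exists>K. 0 \<le> K \<and> K < 1 \<and>
        (\<forall>v\<in>Vs. \<forall>z\<in>Z. cmod (norm_form a b 0 v z)
           \<le> K * form_norm (norm_form a b 0) v * form_norm (norm_form a b 0) z))"

definition quadratic_degeneracy ::
  "'h set \<Rightarrow> (real^'n) set \<Rightarrow> (real^'n \<Rightarrow> 'h \<Rightarrow> 'h \<Rightarrow> complex) \<Rightarrow>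
   (real^'n \<Rightarrow> 'h \<Rightarrow> 'h \<Rightarrow> complex) \<Rightarrow> bool" where
  "quadratic_degeneracy H \<Theta> a b \<longleftrightarrow>
     (\<exists>\<gamma>>0. \<forall>\<theta>\<in>\<Theta>. \<forall>w\<in>null_complement H a b \<theta>.
        Re (a \<theta> w w) \<ge> \<gamma> * (norm \<theta>)\<^sup>2 * (form_norm (norm_form a b \<theta>) w)\<^sup>2)"

text \<open>The dot product with a real vector is bilinear: no conjugation is involved.\<close>

definition cvec :: "real^'n \<Rightarrow> complex^'n" where
  "cvec \<theta> = (\<chi> i. complex_of_real (\<theta> $ i))"

definition cdot :: "complex^'n \<Rightarrow> real^'n \<Rightarrow> complex" where
  "cdot x \<theta> = (\<Sum>i\<in>UNIV. x $ i * complex_of_real (\<theta> $ i))"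

definition a_regularity ::
  "(complex \<Rightarrow> 'h \<Rightarrow> 'h) \<Rightarrow> 'h::ab_group_add set \<Rightarrow> (real^'n) set \<Rightarrow>
   (real^'n \<Rightarrow> 'h \<Rightarrow> 'h \<Rightarrow> complex) \<Rightarrow> (real^'n \<Rightarrow> 'h \<Rightarrow> 'h \<Rightarrow> complex) \<Rightarrow>
   ('h \<Rightarrow> 'h \<Rightarrow> complex^'n) \<Rightarrow> ('h \<Rightarrow> 'h \<Rightarrow> complex^'n^'n) \<Rightarrow> bool" where
  "a_regularity s H \<Theta> a b a' a'' \<longleftrightarrow>
     (\<forall>i. sesquilinear_on s (null_space H a 0) H (\<lambda>v u. a' v u $ i)) \<and>
     (\<forall>i j. sesquilinear_on s (null_space H a 0) (null_space H a 0) (\<lambda>v u. a'' v u $ i $ j)) \<and>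
     (\<exists>K\<ge>0. \<forall>v\<in>null_space H a 0. \<forall>u\<in>H. \<forall>\<theta>\<in>\<Theta>.
        cmod (a \<theta> v u - cdot (a' v u) \<theta>)
          \<le> K * (norm \<theta>)\<^sup>2 * form_norm (norm_form a b 0) v * form_norm (norm_form a b 0) u) \<and>
     (\<exists>K\<ge>0. \<forall>v\<in>null_space H a 0. \<forall>u\<in>null_space H a 0. \<forall>\<theta>\<in>\<Theta>.
        cmod (a \<theta> v u - cdot (a'' v u *v cvec \<theta>) \<theta>)
          \<le> K * norm \<theta> ^ 3 * form_norm (norm_form a b 0) v * form_norm (norm_form a b 0) u)"

definition b_regularity ::
  "'h set \<Rightarrow> (real^'n) set \<Rightarrow> (real^'n \<Rightarrow> 'h \<Rightarrow> 'h \<Rightarrow> complex) \<Rightarrow>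
   (real^'n \<Rightarrow> 'h \<Rightarrow> 'h \<Rightarrow> complex) \<Rightarrow> bool" where
  "b_regularity H \<Theta> a b \<longleftrightarrow>
     (\<exists>L\<ge>0. \<forall>v\<in>null_space H a 0. \<forall>u\<in>null_space H a 0. \<forall>\<theta>\<in>\<Theta>.
        cmod (b \<theta> v u - b 0 v u)
          \<le> L * norm \<theta> * form_norm (norm_form a b 0) v * form_norm (norm_form a b \<theta>) u)"


section \<open>Ambient space and unitary transfer\<close>

text \<open>The ambient space is the whole type, with original inner product \<open>ipA\<close>.\<close>

definition ambient_space ::
  "(complex \<Rightarrow> 'h \<Rightarrow> 'h) \<Rightarrow> 'h::ab_group_add set \<Rightarrow> ('h \<Rightarrow> 'h \<Rightarrow> complex) \<Rightarrow>
   ('h \<Rightarrow> 'h \<Rightarrow> complex) \<Rightarrow> (real^'n) set \<Rightarrow> (real^'n \<Rightarrow> 'h \<Rightarrow> 'h \<Rightarrow> complex) \<Rightarrow>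
   (real^'n \<Rightarrow> 'h \<Rightarrow> 'h \<Rightarrow> complex) \<Rightarrow> bool" where
  "ambient_space s H ip ipA \<Theta> b d \<longleftrightarrow>
     hilbert_space_on s UNIV ipA \<and> separable_space (form_topology UNIV ipA) \<and>
     (\<forall>\<theta>\<in>\<Theta>. inner_product_on s UNIV (d \<theta>) \<and> equivalent_norms_on UNIV (d \<theta>) ipA) \<and>
     (\<exists>K>0. \<forall>u. \<forall>\<theta>\<^sub>1\<in>\<Theta>. \<forall>\<theta>\<^sub>2\<in>\<Theta>. Re (d \<theta>\<^sub>1 u u) \<le> K * Re (d \<theta>\<^sub>2 u u)) \<and>
     form_topology UNIV ipA closure_of H = UNIV \<and>
     (\<forall>r. compactin (form_topology UNIV ipA)
            (form_topology UNIV ipA closure_of {u \<in> H. form_norm ip u \<le> r})) \<and>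
     (\<forall>u\<in>H. \<forall>\<theta>\<in>\<Theta>. Re (d \<theta> u u) \<le> Re (b \<theta> u u))"

text \<open>The extensions of the transfer maps to the ambient space are not assumed to be linear: this
  follows from surjectivity and the preservation of inner products.\<close>

definition unitary_transfer ::
  "(complex \<Rightarrow> 'h \<Rightarrow> 'h) \<Rightarrow> 'h::ab_group_add set \<Rightarrow> (real^'n) set \<Rightarrow>
   (real^'n \<Rightarrow> 'h \<Rightarrow> 'h \<Rightarrow> complex) \<Rightarrow> (real^'n \<Rightarrow> 'h \<Rightarrow> 'h \<Rightarrow> complex) \<Rightarrow>
   (real^'n \<Rightarrow> 'h \<Rightarrow> 'h \<Rightarrow> complex) \<Rightarrow> 'h set \<Rightarrow> 'h set \<Rightarrow> (real^'n \<Rightarrow> 'h \<Rightarrow> 'h) \<Rightarrow> bool" where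
  "unitary_transfer s H \<Theta> a b d Vs Z E \<longleftrightarrow>
     (\<forall>\<theta>\<in>\<Theta>.
        bij_betw (E \<theta>) Vs (V_star H a Vs \<theta>) \<and>
        (\<forall>v\<in>Vs. \<forall>w\<in>Vs. E \<theta> (v + w) = E \<theta> v + E \<theta> w) \<and>
        (\<forall>c. \<forall>v\<in>Vs. E \<theta> (s c v) = s c (E \<theta> v)) \<and>
        (\<forall>v\<in>Vs. \<forall>w\<in>Vs. b \<theta> (E \<theta> v) (E \<theta> w) = b 0 v w) \<and>
        bij (E \<theta>) \<and>
        (\<forall>u w. d \<theta> (E \<theta> u) (E \<theta> w) = d 0 u w)) \<and>
     E 0 = id \<and>
     (\<exists>K\<ge>0. \<forall>\<theta>\<in>\<Theta>. \<forall>v\<in>Vs. \<forall>z\<in>Z.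
        cmod (b \<theta> (E \<theta> v) z - b 0 v z)
          \<le> K * norm \<theta> * form_norm (norm_form a b 0) v * form_norm (norm_form a b 0) z) \<and>
     (\<exists>K\<ge>0. \<forall>\<theta>\<^sub>1\<in>\<Theta>. \<forall>\<theta>\<^sub>2\<in>\<Theta>. \<forall>u.
        form_norm (d \<theta>\<^sub>1) (E \<theta>\<^sub>1 u - E \<theta>\<^sub>2 u) \<le> K * norm (\<theta>\<^sub>1 - \<theta>\<^sub>2) * form_norm (d 0) u)"


section \<open>The original and the homogenised operators\<close>

definition L_op ::
  "'h set \<Rightarrow> (real^'n \<Rightarrow> 'h \<Rightarrow> 'h \<Rightarrow> complex) \<Rightarrow> (real^'n \<Rightarrow> 'h \<Rightarrow> 'h \<Rightarrow> complex) \<Rightarrow>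
   (real^'n \<Rightarrow> 'h \<Rightarrow> 'h \<Rightarrow> complex) \<Rightarrow> real \<Rightarrow> real^'n \<Rightarrow> ('h \<times> 'h) set" where
  "L_op H a b d \<epsilon> \<theta> =
     form_operator UNIV (d \<theta>) H (\<lambda>u v. complex_of_real (1 / \<epsilon>\<^sup>2) * a \<theta> u v + b \<theta> u v)"

definition corrector ::
  "'h set \<Rightarrow> (real^'n \<Rightarrow> 'h \<Rightarrow> 'h \<Rightarrow> complex) \<Rightarrow> (real^'n \<Rightarrow> 'h \<Rightarrow> 'h \<Rightarrow> complex) \<Rightarrow>
   ('h \<Rightarrow> 'h \<Rightarrow> complex^'n) \<Rightarrow> real^'n \<Rightarrow> 'h \<Rightarrow> 'h" where
  "corrector H a b a' \<theta> v =
     (THE w. w \<in> null_complement H a b 0 \<and>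
        (\<forall>w'\<in>null_complement H a b 0. a 0 w w' = - cdot (a' v w') \<theta>))"

definition a_hom ::
  "'h set \<Rightarrow> (real^'n \<Rightarrow> 'h \<Rightarrow> 'h \<Rightarrow> complex) \<Rightarrow> (real^'n \<Rightarrow> 'h \<Rightarrow> 'h \<Rightarrow> complex) \<Rightarrow>
   ('h \<Rightarrow> 'h \<Rightarrow> complex^'n) \<Rightarrow> ('h \<Rightarrow> 'h \<Rightarrow> complex^'n^'n) \<Rightarrow> real^'n \<Rightarrow> 'h \<Rightarrow> 'h \<Rightarrow> complex" where
  "a_hom H a b a' a'' \<theta> v u =
     cdot (a'' v u *v cvec \<theta>) \<theta> - a 0 (corrector H a b a' \<theta> v) (corrector H a b a' \<theta> u)"

text \<open>The component in \<open>Z\<close> of \<open>u = v + z\<close> with \<open>v \<in> Vs\<close> and \<open>z \<in> Z\<close>.\<close>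

definition Z_part :: "'h::ab_group_add set \<Rightarrow> 'h set \<Rightarrow> 'h \<Rightarrow> 'h" where
  "Z_part Vs Z u = (THE z. z \<in> Z \<and> u - z \<in> Vs)"

definition S_form ::
  "'h::ab_group_add set \<Rightarrow> (real^'n \<Rightarrow> 'h \<Rightarrow> 'h \<Rightarrow> complex) \<Rightarrow> (real^'n \<Rightarrow> 'h \<Rightarrow> 'h \<Rightarrow> complex) \<Rightarrow>
   ('h \<Rightarrow> 'h \<Rightarrow> complex^'n) \<Rightarrow> ('h \<Rightarrow> 'h \<Rightarrow> complex^'n^'n) \<Rightarrow> 'h set \<Rightarrow> 'h set \<Rightarrow>
   real^'n \<Rightarrow> 'h \<Rightarrow> 'h \<Rightarrow> complex" where
  "S_form H a b a' a'' Vs Z \<xi> u w =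
     a_hom H a b a' a'' \<xi> (Z_part Vs Z u) (Z_part Vs Z w) + b 0 u w"

definition H_zero :: "('h::ab_group_add \<Rightarrow> 'h \<Rightarrow> complex) \<Rightarrow> 'h set \<Rightarrow> 'h set \<Rightarrow> 'h set" where
  "H_zero ipA Vs Z = form_topology UNIV ipA closure_of {v + z | v z. v \<in> Vs \<and> z \<in> Z}"

definition L_hom_op ::
  "'h::ab_group_add set \<Rightarrow> ('h \<Rightarrow> 'h \<Rightarrow> complex) \<Rightarrow> (real^'n \<Rightarrow> 'h \<Rightarrow> 'h \<Rightarrow> complex) \<Rightarrow>
   (real^'n \<Rightarrow> 'h \<Rightarrow> 'h \<Rightarrow> complex) \<Rightarrow> (real^'n \<Rightarrow> 'h \<Rightarrow> 'h \<Rightarrow> complex) \<Rightarrow>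
   ('h \<Rightarrow> 'h \<Rightarrow> complex^'n) \<Rightarrow> ('h \<Rightarrow> 'h \<Rightarrow> complex^'n^'n) \<Rightarrow> 'h set \<Rightarrow> 'h set \<Rightarrow>
   real^'n \<Rightarrow> ('h \<times> 'h) set" where
  "L_hom_op H ipA a b d a' a'' Vs Z \<xi> =
     form_operator (H_zero ipA Vs Z) (d 0) {v + z | v z. v \<in> Vs \<and> z \<in> Z}
       (S_form H a b a' a'' Vs Z \<xi>)"

definition L_spectra ::
  "(complex \<Rightarrow> 'h \<Rightarrow> 'h) \<Rightarrow> 'h::ab_group_add set \<Rightarrow> (real^'n) set \<Rightarrow>
   (real^'n \<Rightarrow> 'h \<Rightarrow> 'h \<Rightarrow> complex) \<Rightarrow> (real^'n \<Rightarrow> 'h \<Rightarrow> 'h \<Rightarrow> complex) \<Rightarrow>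
   (real^'n \<Rightarrow> 'h \<Rightarrow> 'h \<Rightarrow> complex) \<Rightarrow> real \<Rightarrow> complex set" where
  "L_spectra s H \<Theta> a b d \<epsilon> = closure (\<Union>\<theta>\<in>\<Theta>. spectrum s UNIV (d \<theta>) (L_op H a b d \<epsilon> \<theta>))"

definition L_hom_spectra ::
  "(complex \<Rightarrow> 'h \<Rightarrow> 'h) \<Rightarrow> 'h::ab_group_add set \<Rightarrow> ('h \<Rightarrow> 'h \<Rightarrow> complex) \<Rightarrow>
   (real^'n \<Rightarrow> 'h \<Rightarrow> 'h \<Rightarrow> complex) \<Rightarrow> (real^'n \<Rightarrow> 'h \<Rightarrow> 'h \<Rightarrow> complex) \<Rightarrow>
   (real^'n \<Rightarrow> 'h \<Rightarrow> 'h \<Rightarrow> complex) \<Rightarrow> ('h \<Rightarrow> 'h \<Rightarrow> complex^'n) \<Rightarrow>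
   ('h \<Rightarrow> 'h \<Rightarrow> complex^'n^'n) \<Rightarrow> 'h set \<Rightarrow> 'h set \<Rightarrow> complex set" where
  "L_hom_spectra s H ipA a b d a' a'' Vs Z =
     closure (\<Union>\<xi>. spectrum s (H_zero ipA Vs Z) (d 0) (L_hom_op H ipA a b d a' a'' Vs Z \<xi>))"

end

theory Submission
  imports Defs
begin

text \<open>
  The resolvents at \<open>-1\<close> of \<open>L\<close> at \<open>(\<epsilon>, \<theta>)\<close> and of the homogenised operator at
  \<open>\<xi> = \<theta> / \<epsilon>\<close> are intertwined by the unitary maps \<open>E \<theta>\<close> up to an error of norm \<open>O(\<epsilon>)\<close>. A vector that solves
  the homogenised problem, \<open>v + z\<close> with \<open>v\<close> in \<open>Vs\<close> and \<open>z\<close> in \<open>Z\<close>, yields the approximate solution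
  \<open>E \<theta> v + z + N \<theta> z\<close> of the original one, and the residual is estimated in the energy norm by splitting
  the test vector into a null vector of \<open>a \<theta>\<close>, an element of \<open>Z\<close> and a remainder of size \<open>O(\<epsilon>)\<close>. If
  \<open>\<epsilon> \<xi>\<close> lies outside \<open>\<Theta>\<close>, the component \<open>z\<close> is \<open>O(\<epsilon>\<^sup>2)\<close>, and any \<open>\<theta>\<close> away from \<open>0\<close> serves as partner.

  For bounded symmetric operators an approximate eigenvector forces spectrum nearby, so norm closeness of the
  resolvents gives closeness of the spectra, and \<open>\<tau> = 1 / (1 + \<lambda>)\<close> turns an error \<open>O(\<epsilon>)\<close> in \<open>\<tau>\<close> into
  \<open>O(\<epsilon> (1 + \<lambda>\<^sup>2))\<close> in \<open>\<lambda>\<close>.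
\<close>

section \<open>Non-negative forms and the Riesz representation\<close>

text \<open>For small \<theta> \<noteq> 0 the null space of \<open>a \<theta>\<close> is close to
  \<open>Vs\<close>, while at 0 it is \<open>Vs + Z\<close>. On \<open>Z\<close> the form is of size
  |\<theta>|^2, so the gap closes there, and after division by \<epsilon>^2 this part survives as a
  quadratic form in \<xi> = \<theta> / \<epsilon>. The estimate has to be uniform in \<xi>, although
  the corrected form differs from the homogenised one by |\<theta>|^3 / \<epsilon>^2 = \<epsilon>
  |\<xi>|^3. Coercivity of the homogenised form pays for two powers, since it bounds |\<xi>|^2 |z|
  by the right-hand side; the energy of the test vector pays for the third, since it bounds |\<xi>|
  times its component in \<open>Z\<close>. Without the corrector the part of
  \<open>a \<theta> z\<close> linear in \<theta>, tested against a remainder of size \<epsilon>,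
  would leave a residual that is not small.

  Extending the homogenised resolvent by 0 lets both resolvents act on one space. It adds at most
  the value \<tau> = 0 to the spectrum, which \<lambda> = 1 / \<tau> - 1 sends to infinity.\<close>

definition norm_complete :: "'h::ab_group_add set \<Rightarrow> ('h \<Rightarrow> 'h \<Rightarrow> complex) \<Rightarrow> bool" where
  "norm_complete X q \<longleftrightarrow>
     (\<forall>\<sigma>. range \<sigma> \<subseteq> X \<longrightarrow> (\<forall>e>0. \<exists>N. \<forall>m\<ge>N. \<forall>n\<ge>N. form_norm q (\<sigma> m - \<sigma> n) < e) \<longrightarrow>
        (\<exists>l\<in>X. (\<lambda>n. form_norm q (\<sigma> n - l)) \<longlonglongrightarrow> 0))"

locale pos_form = vector_space s
  for s :: "complex \<Rightarrow> 'h::ab_group_add \<Rightarrow> 'h" +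
  fixes X :: "'h set" and q :: "'h \<Rightarrow> 'h \<Rightarrow> complex"
  assumes subspace_carrier: "subspace X" and nonneg_form: "nonneg_form_on s X q"
begin

lemma carrier_intros:
  "0 \<in> X" "x \<in> X \<Longrightarrow> y \<in> X \<Longrightarrow> x + y \<in> X" "x \<in> X \<Longrightarrow> y \<in> X \<Longrightarrow> x - y \<in> X"
  "x \<in> X \<Longrightarrow> s c x \<in> X" "x \<in> X \<Longrightarrow> - x \<in> X"
  using subspace_carrier by (simp_all add: subspace_0 subspace_add subspace_diff subspace_scale subspace_neg)

lemma form_add_left: "x \<in> X \<Longrightarrow> y \<in> X \<Longrightarrow> v \<in> X \<Longrightarrow> q (x + y) v = q x v + q y v"
  and form_add_right: "x \<in> X \<Longrightarrow> y \<in> X \<Longrightarrow> v \<in> X \<Longrightarrow> q v (x + y) = q v x + q v y"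
  and form_scale_left: "x \<in> X \<Longrightarrow> v \<in> X \<Longrightarrow> q (s c x) v = c * q x v"
  and form_scale_right: "x \<in> X \<Longrightarrow> v \<in> X \<Longrightarrow> q v (s c x) = cnj c * q v x"
  using nonneg_form unfolding nonneg_form_on_def sesquilinear_on_def by auto

lemma form_zero_left: "v \<in> X \<Longrightarrow> q 0 v = 0" and form_zero_right: "v \<in> X \<Longrightarrow> q v 0 = 0"
  using form_scale_left[of 0 v 0] form_scale_right[of 0 v 0] carrier_intros(1) by auto

lemma form_minus_left: "x \<in> X \<Longrightarrow> v \<in> X \<Longrightarrow> q (- x) v = - q x v"
  and form_minus_right: "x \<in> X \<Longrightarrow> v \<in> X \<Longrightarrow> q v (- x) = - q v x"
  using form_scale_left[of x v "- 1"] form_scale_right[of x v "- 1"] by auto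

lemma form_diff_left: "x \<in> X \<Longrightarrow> y \<in> X \<Longrightarrow> v \<in> X \<Longrightarrow> q (x - y) v = q x v - q y v"
  and form_diff_right: "x \<in> X \<Longrightarrow> y \<in> X \<Longrightarrow> v \<in> X \<Longrightarrow> q v (x - y) = q v x - q v y"
  using form_add_left[of x "- y" v] form_add_right[of x "- y" v] carrier_intros(5)
  by (auto simp: form_minus_left form_minus_right)

lemmas form_simps = form_add_left form_add_right form_diff_left form_diff_right
  form_scale_left form_scale_right form_zero_left form_zero_right
  form_minus_left form_minus_right carrier_intros

lemma form_self_real: "u \<in> X \<Longrightarrow> Im (q u u) = 0" and form_self_ge_0: "u \<in> X \<Longrightarrow> 0 \<le> Re (q u u)"
  using nonneg_form unfolding nonneg_form_on_def by (auto simp: nonneg_Reals_def)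

text \<open>Polarisation: the imaginary parts of the form at u + v and at u + i v vanish, which are
  the two real equations required.\<close>

lemma form_hermitian:
  assumes "u \<in> X" "v \<in> X"
  shows "q v u = cnj (q u v)"
proof -
  have "Im (q (u + v) (u + v)) = 0" "Im (q (u + s \<i> v) (u + s \<i> v)) = 0"
    using assms by (simp_all add: form_self_real carrier_intros)
  then show ?thesis
    using assms by (simp add: form_simps form_self_real complex_eq_iff)
qed

lemma fnorm_sq: "u \<in> X \<Longrightarrow> (form_norm q u)\<^sup>2 = Re (q u u)"
  by (simp add: form_norm_def form_self_ge_0)

lemma form_self: "u \<in> X \<Longrightarrow> q u u = of_real ((form_norm q u)\<^sup>2)"
  by (simp add: fnorm_sq complex_eq_iff form_self_real)

lemma fnorm_ge_0: "u \<in> X \<Longrightarrow> 0 \<le> form_norm q u"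
  by (simp add: form_norm_def form_self_ge_0)

lemma fnorm_zero: "form_norm q 0 = 0"
  by (simp add: form_norm_def form_simps)

lemma fnorm_scale: "u \<in> X \<Longrightarrow> form_norm q (s c u) = cmod c * form_norm q u"
proof -
  assume u: "u \<in> X"
  have "c * cnj c = of_real ((cmod c)\<^sup>2)"
    by (simp only: complex_norm_square)
  then have "q (s c u) (s c u) = of_real ((cmod c)\<^sup>2) * q u u"
    using form_scale_left[OF u, of "s c u" c] form_scale_right[OF u u, of c] u
    by (simp add: carrier_intros)
  then show ?thesis
    using u by (simp add: form_norm_def real_sqrt_mult)
qed

lemma fnorm_minus: "u \<in> X \<Longrightarrow> form_norm q (- u) = form_norm q u"
  using fnorm_scale[of u "- 1"] by simp

lemma fnorm_triangle: "u \<in> X \<Longrightarrow> v \<in> X \<Longrightarrow> form_norm q (u + v) \<le> form_norm q u + form_norm q v"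
  using form_norm_triangle[OF vector_space_axioms subspace_carrier nonneg_form] .

lemma fnorm_triangle_diff:
  "u \<in> X \<Longrightarrow> v \<in> X \<Longrightarrow> form_norm q (u - v) \<le> form_norm q u + form_norm q v"
  using fnorm_triangle[of u "- v"] fnorm_minus carrier_intros(5) by simp

lemma fnorm_minus_commute: "u \<in> X \<Longrightarrow> v \<in> X \<Longrightarrow> form_norm q (u - v) = form_norm q (v - u)"
  using fnorm_minus[of "u - v"] carrier_intros(3) by simp

text \<open>Squaring the triangle inequality bounds the real part; a unimodular factor makes
  \<open>q u v\<close> real and non-negative.\<close>

lemma cauchy_schwarz:
  assumes u: "u \<in> X" and v: "v \<in> X"
  shows "cmod (q u v) \<le> form_norm q u * form_norm q v"
proof -
  have re: "Re (q u v) \<le> form_norm q u * form_norm q v" if "u \<in> X" for u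
  proof -
    have "(form_norm q (u + v))\<^sup>2 \<le> (form_norm q u + form_norm q v)\<^sup>2"
      using that v by (intro power_mono fnorm_triangle fnorm_ge_0 carrier_intros)
    moreover have "(form_norm q (u + v))\<^sup>2 = Re (q u u) + 2 * Re (q u v) + Re (q v v)"
      using that v form_hermitian[of u v] by (simp add: fnorm_sq form_simps)
    ultimately show ?thesis
      using that v by (simp add: power2_sum fnorm_sq)
  qed
  show ?thesis
  proof (cases "q u v = 0")
    case True
    then show ?thesis using u v by (simp add: fnorm_ge_0)
  next
    case False
    define c where "c = cnj (q u v) / of_real (cmod (q u v))"
    have "cmod c = 1"
      using False by (simp add: c_def norm_divide)
    moreover have "c * q u v = of_real (cmod (q u v))"
    proof -
      have "c * q u v = (q u v * cnj (q u v)) / of_real (cmod (q u v))"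
        by (simp add: c_def)
      also have "\<dots> = of_real ((cmod (q u v))\<^sup>2) / of_real (cmod (q u v))"
        by (simp only: complex_norm_square)
      also have "\<dots> = of_real (cmod (q u v))"
        by (simp add: power2_eq_square)
      finally show ?thesis .
    qed
    ultimately have c: "cmod c = 1" "q (s c u) v = of_real (cmod (q u v))"
      using u v by (simp_all add: form_scale_left)
    show ?thesis
      using re[of "s c u"] c u by (simp add: fnorm_scale carrier_intros)
  qed
qed

lemma subform: "subspace Y \<Longrightarrow> Y \<subseteq> X \<Longrightarrow> pos_form s Y q"
  using nonneg_form
  unfolding pos_form_def pos_form_axioms_def nonneg_form_on_def sesquilinear_on_def
  by (auto simp: subset_iff vector_space_axioms)

text \<open>Direct minimisation of \<open>F\<close>, whose Euler equation is q u v = l v. The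
  functional is conjugate-linear because it stands for the second argument of a form. Completeness
  is that of a seminorm: limits may fail to be unique, but each of them solves the equation.\<close>

lemma riesz:
  assumes compl: "norm_complete X q"
    and add: "\<And>x y. x \<in> X \<Longrightarrow> y \<in> X \<Longrightarrow> l (x + y) = l x + l y"
    and sc: "\<And>c x. x \<in> X \<Longrightarrow> l (s c x) = cnj c * l x"
    and bd: "\<And>x. x \<in> X \<Longrightarrow> cmod (l x) \<le> M * form_norm q x"
  shows "\<exists>u\<in>X. \<forall>v\<in>X. q u v = l v"
proof -
  define F where "F u = Re (q u u) - 2 * Re (l u)" for u
  have lower: "- M\<^sup>2 \<le> F u" if "u \<in> X" for u
  proof -
    have "Re (l u) \<le> M * form_norm q u"
      using bd[OF that] complex_Re_le_cmod[of "l u"] by linarith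
    moreover have "0 \<le> (form_norm q u - M)\<^sup>2" by simp
    ultimately show ?thesis
      using that by (simp add: F_def fnorm_sq[symmetric] power2_eq_square algebra_simps)
  qed
  define I where "I = (INF u\<in>X. F u)"
  have bdd: "bdd_below (F ` X)" using lower by (auto simp: bdd_below_def)
  have I: "I \<le> F u" if "u \<in> X" for u
    unfolding I_def by (rule cINF_lower[OF bdd that])
  have "\<exists>u\<in>X. F u < I + e\<^sup>2" if "e > 0" for e
    using cINF_less_iff[OF _ bdd, of "I + e\<^sup>2"] carrier_intros(1) that
    unfolding I_def by fastforce
  then have "\<exists>u\<in>X. F u < I + (1 / real (Suc n))\<^sup>2" for n
    by simp
  then obtain u where u: "\<And>n. u n \<in> X" "\<And>n. F (u n) < I + (1 / real (Suc n))\<^sup>2"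
    by metis
  define e where "e n = 1 / real (Suc n)" for n
  have e: "e n > 0" "e \<longlonglongrightarrow> 0" for n
    using LIMSEQ_inverse_real_of_nat by (auto simp: e_def[abs_def] inverse_eq_divide)
  \<comment> \<open>Near-minimisers solve the Euler equation approximately.\<close>
  have re: "\<bar>Re (q (u n) v - l v)\<bar> \<le> e n * form_norm q v" if v: "v \<in> X" for v n
  proof -
    have "0 \<le> (e n)\<^sup>2 + 2 * t * Re (q (u n) v - l v) + t\<^sup>2 * (form_norm q v)\<^sup>2" for t
    proof -
      have "F (u n + s (of_real t) v) = F (u n) + 2 * t * Re (q (u n) v - l v)
          + t\<^sup>2 * (form_norm q v)\<^sup>2"
        using v u(1)[of n] form_hermitian[of "u n" v] fnorm_sq[OF v]
        by (simp add: F_def form_simps add sc power2_eq_square algebra_simps)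
      then show ?thesis
        using I[of "u n + s (of_real t) v"] u(2)[of n] v u(1)[of n]
        by (simp add: carrier_intros e_def)
    qed
    note quad = this
    define B where "B = Re (q (u n) v - l v)"
    define C where "C = (form_norm q v)\<^sup>2"
    have quad: "0 \<le> (e n)\<^sup>2 + 2 * t * B + t\<^sup>2 * C" for t
      using quad[of t] by (simp add: B_def C_def)
    \<comment> \<open>A quadratic polynomial in t that is never negative has no positive
      discriminant.\<close>
    have "B\<^sup>2 \<le> (e n)\<^sup>2 * C"
    proof (cases "C = 0")
      case True
      have "B = 0"
      proof (rule ccontr)
        assume "B \<noteq> 0"
        then show False
          using quad[of "- ((e n)\<^sup>2 + 1) / (2 * B)"] True by (simp add: field_simps)
      qed
      then show ?thesis using True by simp
    next
      case False
      then have "C > 0" by (simp add: C_def)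
      then show ?thesis
        using quad[of "- B / C"] by (simp add: field_simps power2_eq_square)
    qed
    then have "B\<^sup>2 \<le> (e n * form_norm q v)\<^sup>2"
      by (simp add: C_def power_mult_distrib)
    then show ?thesis
      using e(1)[of n] fnorm_ge_0[OF v] abs_le_square_iff[of B "e n * form_norm q v"]
      by (simp add: B_def)
  qed
  have res: "cmod (q (u n) v - l v) \<le> 2 * e n * form_norm q v" if v: "v \<in> X" for v n
  proof -
    \<comment> \<open>Replacing v by i v exchanges real and imaginary part; adding both bounds is
      the origin of the factor 2.\<close>
    have "\<bar>Im (q (u n) v - l v)\<bar> \<le> e n * form_norm q v"
      using re[of "s \<i> v" n] v u(1)[of n] by (simp add: form_simps sc fnorm_scale)
    then show ?thesis
      using re[OF v, of n] cmod_le[of "q (u n) v - l v"] by linarith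
  qed
  \<comment> \<open>Testing both approximate equations with the difference itself cancels
    \<open>l\<close>.\<close>
  have diff: "form_norm q (u m - u n) \<le> 2 * (e m + e n)" for m n
  proof -
    define w where "w = u m - u n"
    have w: "w \<in> X" using u by (simp add: w_def carrier_intros)
    have "of_real ((form_norm q w)\<^sup>2) = (q (u m) w - l w) - (q (u n) w - l w)"
      unfolding form_self[OF w, symmetric] using u w by (simp add: w_def form_simps)
    then have "cmod (of_real ((form_norm q w)\<^sup>2)) \<le> cmod (q (u m) w - l w) + cmod (q (u n) w - l w)"
      by (simp only: norm_triangle_ineq4)
    then have "(form_norm q w)\<^sup>2 \<le> cmod (q (u m) w - l w) + cmod (q (u n) w - l w)"
      by (simp only: norm_of_real abs_power2)
    also have "\<dots> \<le> 2 * (e m + e n) * form_norm q w"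
      using res[OF w, of m] res[OF w, of n] by (simp add: algebra_simps)
    finally show ?thesis
      using fnorm_ge_0[OF w] e(1)[of m] e(1)[of n]
      by (cases "form_norm q w = 0") (auto simp: w_def[symmetric] power2_eq_square)
  qed
  have "\<exists>N. \<forall>m\<ge>N. \<forall>n\<ge>N. form_norm q (u m - u n) < r" if "r > 0" for r
  proof -
    have "r / 4 > 0" using that by simp
    then obtain N where N: "\<And>n. n \<ge> N \<Longrightarrow> e n < r / 4"
      using e order_tendstoD(2)[OF e(2), of "r / 4"] by (auto simp: eventually_sequentially)
    have "form_norm q (u m - u n) < r" if "m \<ge> N" "n \<ge> N" for m n
    proof -
      have "2 * (e m + e n) < 2 * (r / 4 + r / 4)"
        using N[OF that(1)] N[OF that(2)] by (intro mult_strict_left_mono add_strict_mono) auto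
      then show ?thesis using diff[of m n] by simp
    qed
    then show ?thesis by blast
  qed
  moreover have "range u \<subseteq> X" using u by auto
  ultimately obtain x where x: "x \<in> X" "(\<lambda>n. form_norm q (u n - x)) \<longlonglongrightarrow> 0"
    using compl unfolding norm_complete_def by meson
  have "q x v = l v" if v: "v \<in> X" for v
  proof -
    have "cmod (q x v - l v) \<le> form_norm q (u n - x) * form_norm q v + 2 * e n * form_norm q v" for n
    proof -
      have "q x v - l v = (q (u n) v - l v) - q (u n - x) v"
        using x u v by (simp add: form_simps)
      then have "cmod (q x v - l v) \<le> cmod (q (u n) v - l v) + cmod (q (u n - x) v)"
        by (simp only: norm_triangle_ineq4)
      then show ?thesis
        using res[OF v, of n] cauchy_schwarz[of "u n - x" v] u x v
        by (simp add: carrier_intros)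
    qed
    moreover have "(\<lambda>n. form_norm q (u n - x) * form_norm q v + 2 * e n * form_norm q v) \<longlonglongrightarrow> 0"
      using x(2) e(2) by (auto intro!: tendsto_eq_intros)
    ultimately have "cmod (q x v - l v) \<le> 0"
      by (intro LIMSEQ_le_const) auto
    then show ?thesis by simp
  qed
  then show ?thesis using x by blast
qed

end

section \<open>Sums of forms, completeness under equivalent norms, closures of subspaces\<close>

lemma pos_formI: "vector_space s \<Longrightarrow> module.subspace s X \<Longrightarrow> nonneg_form_on s X q \<Longrightarrow> pos_form s X q"
  by (simp add: pos_form_def pos_form_axioms_def)

lemma pos_form_add:
  assumes p: "pos_form s X p" and q: "pos_form s Y q" and "X \<subseteq> Y"
  shows "pos_form s X (\<lambda>u v. p u v + q u v)"
proof -
  interpret P: pos_form s X p by (fact p)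
  interpret Q: pos_form s Y q by (fact q)
  have "nonneg_form_on s X (\<lambda>u v. p u v + q u v)"
    using P.nonneg_form Q.nonneg_form assms(3)
    unfolding nonneg_form_on_def sesquilinear_on_def
    by (auto simp: algebra_simps subset_iff complex_nonneg_Reals_iff)
  then show ?thesis by (intro pos_formI P.vector_space_axioms P.subspace_carrier)
qed

lemma norm_complete_hilbert:
  assumes "hilbert_space_on s X q"
  shows "norm_complete X q"
  unfolding norm_complete_def
proof (intro allI impI)
  fix \<sigma> :: "nat \<Rightarrow> 'a"
  assume \<sigma>: "range \<sigma> \<subseteq> X" "\<forall>e>0. \<exists>N. \<forall>m\<ge>N. \<forall>n\<ge>N. form_norm q (\<sigma> m - \<sigma> n) < e"
  interpret Metric_space X "form_dist X q"
    using assms unfolding hilbert_space_on_def by (blast intro: Metric_space_form_dist)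
  have "MCauchy \<sigma>"
    using \<sigma> unfolding MCauchy_def form_dist_def by (auto simp: image_subset_iff)
  then obtain l where "limitin mtopology \<sigma> l sequentially"
    using assms unfolding hilbert_space_on_def mcomplete_def by blast
  then have l: "l \<in> X" "\<And>e. e > 0 \<Longrightarrow> \<exists>N. \<forall>n\<ge>N. \<sigma> n \<in> X \<and> form_dist X q (\<sigma> n) l < e"
    by (auto simp: limit_metric_sequentially)
  have "form_dist X q (\<sigma> n) l = form_norm q (\<sigma> n - l)" for n
    using l(1) \<sigma>(1) by (auto simp: form_dist_def)
  then have "(\<lambda>n. form_norm q (\<sigma> n - l)) \<longlonglongrightarrow> 0"
    using l(2) nonneg[of "\<sigma> _" l] unfolding LIMSEQ_def by fastforce
  then show "\<exists>l\<in>X. (\<lambda>n. form_norm q (\<sigma> n - l)) \<longlonglongrightarrow> 0" using l(1) by blast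
qed

lemma norm_complete_equivalent:
  assumes compl: "norm_complete X p"
    and lo: "\<And>u. u \<in> X \<Longrightarrow> form_norm p u \<le> c * form_norm q u"
    and hi: "\<And>u. u \<in> X \<Longrightarrow> form_norm q u \<le> C * form_norm p u"
    and q: "pos_form s X q"
  shows "norm_complete X q"
  unfolding norm_complete_def
proof (intro allI impI)
  interpret pos_form s X q by (fact q)
  fix \<sigma> :: "nat \<Rightarrow> 'a"
  assume \<sigma>: "range \<sigma> \<subseteq> X" "\<forall>e>0. \<exists>N. \<forall>m\<ge>N. \<forall>n\<ge>N. form_norm q (\<sigma> m - \<sigma> n) < e"
  have X: "\<sigma> n \<in> X" for n using \<sigma>(1) by auto
  have "\<exists>N. \<forall>m\<ge>N. \<forall>n\<ge>N. form_norm p (\<sigma> m - \<sigma> n) < e" if e: "e > 0" for e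
  proof -
    \<comment> \<open>The sign of \<open>c\<close> is unknown, so its place as a divisor is taken by
      a positive majorant.\<close>
    have c: "\<bar>c\<bar> + 1 > 0" by simp
    then obtain N where N: "\<And>m n. m \<ge> N \<Longrightarrow> n \<ge> N \<Longrightarrow> form_norm q (\<sigma> m - \<sigma> n) < e / (\<bar>c\<bar> + 1)"
      using \<sigma>(2) e by (meson divide_pos_pos)
    have "form_norm p (\<sigma> m - \<sigma> n) < e" if "m \<ge> N" "n \<ge> N" for m n
    proof -
      have "form_norm p (\<sigma> m - \<sigma> n) \<le> (\<bar>c\<bar> + 1) * form_norm q (\<sigma> m - \<sigma> n)"
        using lo[of "\<sigma> m - \<sigma> n"] X fnorm_ge_0[of "\<sigma> m - \<sigma> n"]
        by (smt (verit, best) carrier_intros(3) mult_right_mono)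
      then show ?thesis
        using N[OF that] c by (simp add: field_simps)
    qed
    then show ?thesis by blast
  qed
  then obtain l where l: "l \<in> X" "(\<lambda>n. form_norm p (\<sigma> n - l)) \<longlonglongrightarrow> 0"
    using compl \<sigma>(1) unfolding norm_complete_def by meson
  have "(\<lambda>n. form_norm q (\<sigma> n - l)) \<longlonglongrightarrow> 0"
  proof (rule tendsto_sandwich[OF _ _ tendsto_const])
    show "\<forall>\<^sub>F n in sequentially. 0 \<le> form_norm q (\<sigma> n - l)"
      using X l(1) by (simp add: fnorm_ge_0 carrier_intros)
    show "\<forall>\<^sub>F n in sequentially. form_norm q (\<sigma> n - l) \<le> C * form_norm p (\<sigma> n - l)"
      using X l(1) hi by (simp add: carrier_intros)
    show "(\<lambda>n. C * form_norm p (\<sigma> n - l)) \<longlonglongrightarrow> 0"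
      using tendsto_mult_left[OF l(2), of C] by simp
  qed
  then show "\<exists>l\<in>X. (\<lambda>n. form_norm q (\<sigma> n - l)) \<longlonglongrightarrow> 0" using l(1) by blast
qed

lemma norm_complete_subset:
  assumes "norm_complete X q" "Y \<subseteq> X"
    and "\<And>\<sigma> l. range \<sigma> \<subseteq> Y \<Longrightarrow> l \<in> X \<Longrightarrow> (\<lambda>n. form_norm q (\<sigma> n - l)) \<longlonglongrightarrow> 0 \<Longrightarrow> l \<in> Y"
  shows "norm_complete Y q"
  using assms unfolding norm_complete_def by (meson order_trans)

text \<open>Applied to the null space at 0, this makes the space of the homogenised operator a
  linear space that contains its form domain.\<close>

lemma subspace_closure_of:
  assumes h: "hilbert_space_on s UNIV q" and V: "module.subspace s V"
  shows "module.subspace s (form_topology UNIV q closure_of V)" "V \<subseteq> form_topology UNIV q closure_of V"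
proof -
  interpret pos_form s UNIV q
    using h by (intro pos_formI) (auto simp: hilbert_space_on_def inner_product_on_def)
  interpret M: Metric_space UNIV "form_dist UNIV q"
    using h unfolding hilbert_space_on_def by (blast intro: Metric_space_form_dist)
  have cl: "x \<in> form_topology UNIV q closure_of V \<longleftrightarrow> (\<forall>e>0. \<exists>y\<in>V. form_norm q (x - y) < e)" for x
    unfolding form_topology_def M.metric_closure_of by (simp add: M.mball_def form_dist_def)
  show sub: "V \<subseteq> form_topology UNIV q closure_of V"
    by (rule closure_of_subset) (simp add: form_topology_def)
  show "subspace (form_topology UNIV q closure_of V)"
    unfolding subspace_def
  proof (intro conjI allI ballI)
    show "0 \<in> form_topology UNIV q closure_of V" using sub subspace_0[OF V] by blast
  next
    fix x y assume xy: "x \<in> form_topology UNIV q closure_of V" "y \<in> form_topology UNIV q closure_of V"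
    show "x + y \<in> form_topology UNIV q closure_of V"
      unfolding cl
    proof (intro allI impI)
      fix e :: real assume "e > 0"
      then have "e / 2 > 0" by simp
      then obtain x' y' where *: "x' \<in> V" "y' \<in> V" "form_norm q (x - x') < e / 2" "form_norm q (y - y') < e / 2"
        using xy unfolding cl by meson
      have "x + y - (x' + y') = (x - x') + (y - y')" by simp
      then have "form_norm q (x + y - (x' + y')) \<le> form_norm q (x - x') + form_norm q (y - y')"
        by (simp only: fnorm_triangle UNIV_I)
      then show "\<exists>w\<in>V. form_norm q (x + y - w) < e"
        using * subspace_add[OF V] by (intro bexI[of _ "x' + y'"]) auto
    qed
  next
    fix c x assume x: "x \<in> form_topology UNIV q closure_of V"
    show "s c x \<in> form_topology UNIV q closure_of V"
      unfolding cl
    proof (intro allI impI)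
      fix e :: real assume e: "e > 0"
      have c: "cmod c + 1 > 0" by (simp add: add_nonneg_pos)
      then obtain x' where x': "x' \<in> V" "form_norm q (x - x') < e / (cmod c + 1)"
        using x e unfolding cl by (meson divide_pos_pos)
      have "s c x - s c x' = s c (x - x')" by (simp add: scale_right_diff_distrib)
      then have "form_norm q (s c x - s c x') \<le> (cmod c + 1) * form_norm q (x - x')"
        by (simp add: fnorm_scale mult_right_mono fnorm_ge_0)
      also have "\<dots> < e" using x'(2) c by (simp add: pos_less_divide_eq mult.commute)
      finally show "\<exists>w\<in>V. form_norm q (s c x - w) < e"
        using x'(1) subspace_scale[OF V] by blast
    qed
  qed
qed

lemma norm_complete_equivalent_norms:
  assumes "hilbert_space_on s X p" "inner_product_on s X q" "equivalent_norms_on X q p"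
  shows "norm_complete X q"
proof -
  obtain c C where c: "c > 0" "\<And>u. u \<in> X \<Longrightarrow> c * form_norm p u \<le> form_norm q u"
    "\<And>u. u \<in> X \<Longrightarrow> form_norm q u \<le> C * form_norm p u"
    using assms(3) unfolding equivalent_norms_on_def by blast
  show ?thesis
  proof (rule norm_complete_equivalent[OF norm_complete_hilbert[OF assms(1)]])
    show "form_norm p u \<le> (1 / c) * form_norm q u" if "u \<in> X" for u
      using c(1) c(2)[OF that] by (simp add: field_simps)
    show "form_norm q u \<le> C * form_norm p u" if "u \<in> X" for u using c(3)[OF that] .
    show "pos_form s X q"
      using assms by (intro pos_formI) (auto simp: hilbert_space_on_def inner_product_on_def)
  qed
qed

section \<open>Symmetric operators and spectra of form operators\<close>

text \<open>Cancels one norm in an energy estimate. A norm equal to 0 does no harm, as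
  \<open>b\<close> is non-negative.\<close>

lemma mult_square_le_cancel:
  fixes a b x :: real
  assumes "a * x\<^sup>2 \<le> b * x" "0 \<le> x" "0 \<le> b"
  shows "a * x \<le> b"
proof (cases "x = 0")
  case False
  have "(a * x) * x \<le> b * x" using assms(1) by (simp add: power2_eq_square mult.assoc)
  then show ?thesis using False assms(2) by (metis mult_right_le_imp_le order_less_le)
qed (use assms in simp)

text \<open>The real part of the approximate point spectrum, which suffices for symmetric operators.
  The strict inequality already excludes vectors of norm 0.\<close>

definition approx_spectrum ::
  "(complex \<Rightarrow> 'h \<Rightarrow> 'h) \<Rightarrow> ('h::ab_group_add \<Rightarrow> 'h \<Rightarrow> complex) \<Rightarrow> ('h \<Rightarrow> 'h) \<Rightarrow> real set" where
  "approx_spectrum s d T =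
     {\<tau>. \<forall>\<delta>>0. \<exists>x. form_norm d (T x - s (of_real \<tau>) x) < \<delta> * form_norm d x}"

lemma approx_spectrumD:
  "\<tau> \<in> approx_spectrum s d T \<Longrightarrow> \<delta> > 0 \<Longrightarrow>
    \<exists>x. form_norm d (T x - s (of_real \<tau>) x) < \<delta> * form_norm d x"
  by (simp add: approx_spectrum_def)

locale sym_op = pos_form s UNIV d
  for s :: "complex \<Rightarrow> 'h::ab_group_add \<Rightarrow> 'h" and d +
  fixes T :: "'h \<Rightarrow> 'h" and B :: real
  assumes op_add: "T (x + y) = T x + T y"
    and op_scale: "T (s c x) = s c (T x)"
    and op_sym: "d (T x) y = d x (T y)"
    and op_bound: "form_norm d (T x) \<le> B * form_norm d x"
    and bound_pos: "B > 0"
begin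

lemma op_diff: "T (x - y) = T x - T y"
  using op_add[of "x - y" y] by (simp add: algebra_simps)

lemma shift: "sym_op s d (\<lambda>x. T x - s (of_real \<tau>) x) (B + \<bar>\<tau>\<bar>)"
proof (unfold_locales, goal_cases)
  case (4 x)
  show ?case
    using fnorm_triangle_diff[of "T x" "s (of_real \<tau>) x"] op_bound[of x]
    by (simp add: fnorm_scale algebra_simps)
qed (use bound_pos in \<open>auto simp: op_add op_scale op_sym form_simps algebra_simps\<close>)

lemma approx_spectrum_shift:
  "\<sigma> \<in> approx_spectrum s d (\<lambda>x. T x - s (of_real \<tau>) x) \<longleftrightarrow> \<sigma> + \<tau> \<in> approx_spectrum s d T"
  by (simp add: approx_spectrum_def scale_left_distrib algebra_simps)

lemma not_approx_spectrum:
  assumes "\<tau> \<notin> approx_spectrum s d T"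
  obtains c where "c > 0" "\<And>x. c * form_norm d x \<le> form_norm d (T x - s (of_real \<tau>) x)"
  using assms unfolding approx_spectrum_def by (auto simp: not_less)

text \<open>With \<open>m\<close> the infimum of \<open>|Tx|/|x|\<close>, the form of \<open>Q = T\<^sup>2 - m\<^sup>2 = (T - m) (T + m)\<close> is
  non-negative, so \<open>|Qx|\<^sup>2\<close> is at most a multiple of \<open>|Tx|\<^sup>2 - m\<^sup>2 |x|\<^sup>2\<close>. Were both factors bounded
  below, \<open>m\<close> would not be the infimum.\<close>

lemma approx_spectrum_near_0:
  assumes x0: "form_norm d x0 > 0" and small: "form_norm d (T x0) \<le> \<delta> * form_norm d x0"
  shows "\<exists>\<sigma>\<in>approx_spectrum s d T. \<bar>\<sigma>\<bar> \<le> \<delta>"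
proof -
  define S where "S = {form_norm d (T x) / form_norm d x | x. form_norm d x > 0}"
  define m where "m = Inf S"
  have bdd: "bdd_below S"
    by (intro bdd_belowI[of _ 0]) (auto simp: S_def fnorm_ge_0)
  have ne: "S \<noteq> {}" using x0 by (auto simp: S_def)
  have m0: "0 \<le> m"
    unfolding m_def by (rule cInf_greatest[OF ne]) (auto simp: S_def fnorm_ge_0)
  have "m \<le> form_norm d (T x0) / form_norm d x0"
    unfolding m_def by (rule cInf_lower[OF _ bdd]) (use x0 in \<open>auto simp: S_def\<close>)
  also have "\<dots> \<le> \<delta>" using x0 small by (simp add: field_simps)
  finally have m\<delta>: "m \<le> \<delta>" .
  have low: "m * form_norm d x \<le> form_norm d (T x)" for x
  proof (cases "form_norm d x > 0")
    case True
    then have "m \<le> form_norm d (T x) / form_norm d x"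
      unfolding m_def by (intro cInf_lower[OF _ bdd]) (auto simp: S_def)
    then show ?thesis using True by (simp add: field_simps)
  next
    case False
    then have "form_norm d x = 0" using fnorm_ge_0[of x] by simp
    then show ?thesis by (simp add: fnorm_ge_0)
  qed
  have "m \<in> approx_spectrum s d T \<or> - m \<in> approx_spectrum s d T"
  proof (rule ccontr)
    assume "\<not> ?thesis"
    then have n: "m \<notin> approx_spectrum s d T" "- m \<notin> approx_spectrum s d T" by auto
    obtain c1 where c1: "c1 > 0" "\<And>x. c1 * form_norm d x \<le> form_norm d (T x - s (of_real m) x)"
      using not_approx_spectrum[OF n(1)] by blast
    obtain c2 where "c2 > 0" "\<And>x. c2 * form_norm d x \<le> form_norm d (T x - s (of_real (- m)) x)"
      using not_approx_spectrum[OF n(2)] by blast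
    then have c2: "c2 > 0" "\<And>x. c2 * form_norm d x \<le> form_norm d (T x + s (of_real m) x)"
      by simp_all
    define Q where "Q x = T (T x) - s (of_real (m\<^sup>2)) x" for x
    have Q: "Q x = T (T x + s (of_real m) x) - s (of_real m) (T x + s (of_real m) x)" for x
      by (simp add: Q_def op_add op_scale scale_right_distrib power2_eq_square)
    have Qlow: "c1 * c2 * form_norm d x \<le> form_norm d (Q x)" for x
    proof -
      have "c1 * (c2 * form_norm d x) \<le> c1 * form_norm d (T x + s (of_real m) x)"
        using c1 c2 by (intro mult_left_mono) auto
      then show ?thesis
        using c1(2)[of "T x + s (of_real m) x"] unfolding Q by (simp add: mult.assoc)
    qed
    define P where "P x y = d (T x) (T y) - of_real (m\<^sup>2) * d x y" for x y
    have Pd: "P x y = d (Q x) y" for x y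
      by (simp add: P_def Q_def form_simps op_sym[of "T x"])
    have Pself: "P x x = of_real ((form_norm d (T x))\<^sup>2 - m\<^sup>2 * (form_norm d x)\<^sup>2)" for x
      by (simp add: P_def form_self)
    have Pnn: "0 \<le> (form_norm d (T x))\<^sup>2 - m\<^sup>2 * (form_norm d x)\<^sup>2" for x
      using power_mono[OF low, of x 2] m0 fnorm_ge_0[of x] by (simp add: power_mult_distrib)
    interpret P: pos_form s UNIV P
    proof (rule pos_formI)
      have "sesquilinear_on s UNIV UNIV P"
        unfolding sesquilinear_on_def P_def
        by (simp add: op_add op_scale form_simps algebra_simps)
      moreover have "P x x \<in> \<real>\<^sub>\<ge>\<^sub>0" for x
        unfolding Pself nonneg_Reals_of_real_iff by (rule Pnn)
      ultimately show "nonneg_form_on s UNIV P" by (simp add: nonneg_form_on_def)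
    qed (auto intro: vector_space_axioms subspace_carrier)
    \<comment> \<open>Cauchy-Schwarz for \<open>P\<close> at x and Q x: the left side is |Q x|^4,
      and the factor P (Q x) (Q x) is at most B^2 |Q x|^2, so |Q x|^2 cancels.\<close>
    have key: "(form_norm d (Q x))\<^sup>2 \<le> B\<^sup>2 * ((form_norm d (T x))\<^sup>2 - m\<^sup>2 * (form_norm d x)\<^sup>2)" for x
    proof (cases "form_norm d (Q x) = 0")
      case False
      have PQ: "(form_norm P y)\<^sup>2 = (form_norm d (T y))\<^sup>2 - m\<^sup>2 * (form_norm d y)\<^sup>2" for y
        using P.fnorm_sq[of y] by (simp add: Pself)
      have "cmod (P x (Q x)) = (form_norm d (Q x))\<^sup>2"
        by (simp add: Pd form_self norm_power)
      then have "((form_norm d (Q x))\<^sup>2)\<^sup>2 \<le> (form_norm P x * form_norm P (Q x))\<^sup>2"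
        using P.cauchy_schwarz[of x "Q x"] by (intro power_mono) auto
      also have "\<dots> = ((form_norm d (T x))\<^sup>2 - m\<^sup>2 * (form_norm d x)\<^sup>2) * (form_norm P (Q x))\<^sup>2"
        by (simp add: power_mult_distrib PQ)
      also have "\<dots> \<le> ((form_norm d (T x))\<^sup>2 - m\<^sup>2 * (form_norm d x)\<^sup>2) * (B * form_norm d (Q x))\<^sup>2"
      proof (rule mult_left_mono[OF _ Pnn])
        have "(form_norm d (T (Q x)))\<^sup>2 \<le> (B * form_norm d (Q x))\<^sup>2"
          by (intro power_mono op_bound fnorm_ge_0) auto
        then show "(form_norm P (Q x))\<^sup>2 \<le> (B * form_norm d (Q x))\<^sup>2"
          unfolding PQ by (smt (verit) zero_le_mult_iff zero_le_power2)
      qed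
      finally have "(form_norm d (Q x))\<^sup>2 * (form_norm d (Q x))\<^sup>2
          \<le> (B\<^sup>2 * ((form_norm d (T x))\<^sup>2 - m\<^sup>2 * (form_norm d x)\<^sup>2)) * (form_norm d (Q x))\<^sup>2"
        by (simp add: power2_eq_square mult_ac)
      then show ?thesis
        using False by (subst (asm) mult_le_cancel_right) auto
    qed (use Pnn[of x] in simp)
    \<comment> \<open>The excess over m^2: combining \<open>Qlow\<close> with \<open>key\<close>
      yields |T x|^2 \<ge> (m^2 + e) |x|^2, which contradicts the choice of \<open>m\<close> as
      infimum.\<close>
    define e where "e = (c1 * c2 / B)\<^sup>2"
    have e: "e > 0" using c1 c2 bound_pos by (simp add: e_def)
    have "sqrt (m\<^sup>2 + e) \<le> r" if r: "r \<in> S" for r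
    proof -
      obtain x where x: "form_norm d x > 0" "r = form_norm d (T x) / form_norm d x"
        using r unfolding S_def by blast
      have "(c1 * c2 * form_norm d x)\<^sup>2 \<le> (form_norm d (Q x))\<^sup>2"
        using c1 c2 x by (intro power_mono Qlow) auto
      also note key[of x]
      finally have "(m\<^sup>2 + e) * (form_norm d x)\<^sup>2 \<le> (form_norm d (T x))\<^sup>2"
        using bound_pos by (simp add: e_def power_mult_distrib power_divide field_simps)
      then have "m\<^sup>2 + e \<le> r\<^sup>2"
        using x by (simp add: power_divide pos_le_divide_eq)
      moreover have "0 \<le> r" using x fnorm_ge_0[of "T x"] by simp
      ultimately show ?thesis by (simp add: real_le_lsqrt)
    qed
    then have "sqrt (m\<^sup>2 + e) \<le> m"
      unfolding m_def[symmetric] by (subst (2) m_def) (rule cInf_greatest[OF ne])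
    moreover have "sqrt (m\<^sup>2) < sqrt (m\<^sup>2 + e)" using e by (intro real_sqrt_less_mono) simp
    ultimately show False using m0 by simp
  qed
  then show ?thesis using m0 m\<delta> by (metis abs_minus_cancel abs_of_nonneg)
qed

lemma approx_spectrum_near:
  assumes "form_norm d x > 0" "form_norm d (T x - s (of_real \<tau>) x) \<le> \<delta> * form_norm d x"
  shows "\<exists>\<sigma>\<in>approx_spectrum s d T. \<bar>\<sigma> - \<tau>\<bar> \<le> \<delta>"
proof -
  interpret A: sym_op s d "\<lambda>x. T x - s (of_real \<tau>) x" "B + \<bar>\<tau>\<bar>" by (rule shift)
  obtain \<sigma> where "\<sigma> \<in> approx_spectrum s d (\<lambda>x. T x - s (of_real \<tau>) x)" "\<bar>\<sigma>\<bar> \<le> \<delta>"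
    using A.approx_spectrum_near_0[OF assms] by blast
  then show ?thesis
    by (intro bexI[of _ "\<sigma> + \<tau>"]) (auto simp: approx_spectrum_shift)
qed

text \<open>The lower bound for A = T - \<tau> makes |A x| a complete norm, so the Riesz lemma gives
  x with A x - f orthogonal to the range of A. Then A x - f is annihilated by T - cnj \<tau>, and
  the second lower bound makes it 0.\<close>

lemma surj_shift:
  assumes compl: "norm_complete UNIV d" and def: "\<And>x. d x x = 0 \<Longrightarrow> x = 0"
    and c: "c > 0"
    and lo: "\<And>x. c * form_norm d x \<le> form_norm d (T x - s \<tau> x)"
    and lo': "\<And>x. c * form_norm d x \<le> form_norm d (T x - s (cnj \<tau>) x)"
  shows "\<exists>x. T x - s \<tau> x = f"
proof -
  define A where "A x = T x - s \<tau> x" for x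
  have A: "A (x + y) = A x + A y" "A (s k x) = s k (A x)" for x y k
    by (simp_all add: A_def op_add op_scale algebra_simps)
  have A_bound: "form_norm d (A x) \<le> (B + cmod \<tau>) * form_norm d x" for x
    using fnorm_triangle_diff[of "T x" "s \<tau> x"] op_bound[of x]
    by (simp add: A_def fnorm_scale algebra_simps)
  define P where "P x y = d (A x) (A y)" for x y
  have Pnorm: "form_norm P x = form_norm d (A x)" for x
    by (simp add: form_norm_def P_def)
  interpret P: pos_form s UNIV P
  proof (rule pos_formI)
    show "nonneg_form_on s UNIV P"
      using nonneg_form unfolding nonneg_form_on_def sesquilinear_on_def P_def
      by (simp add: A)
  qed (auto intro: vector_space_axioms subspace_carrier)
  have "norm_complete UNIV P"
  proof (rule norm_complete_equivalent[OF compl])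
    show "form_norm d u \<le> (1 / c) * form_norm P u" for u
      using lo[of u] c by (simp add: Pnorm A_def field_simps)
    show "form_norm P u \<le> (B + cmod \<tau>) * form_norm d u" for u
      by (simp add: Pnorm A_bound)
  qed (rule P.pos_form_axioms)
  moreover have "cmod (d f (A x)) \<le> form_norm d f * form_norm P x" for x
    using cauchy_schwarz[of f "A x"] by (simp add: Pnorm)
  ultimately obtain x where x: "\<And>y. P x y = d f (A y)"
    using P.riesz[of "\<lambda>y. d f (A y)" "form_norm d f"] by (auto simp: A form_simps)
  define w where "w = A x - f"
  have "d w (A y) = 0" for y
    using x[of y] by (simp add: w_def P_def form_simps)
  moreover have "d w (A y) = d (T w - s (cnj \<tau>) w) y" for y
    by (simp add: A_def form_simps op_sym)
  ultimately have "d (T w - s (cnj \<tau>) w) (T w - s (cnj \<tau>) w) = 0" by metis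
  then have "form_norm d (T w - s (cnj \<tau>) w) = 0"
    by (simp add: form_norm_def)
  then have "c * form_norm d w \<le> 0" using lo'[of w] by simp
  then have "form_norm d w = 0"
    using c fnorm_ge_0[of w] by (simp add: mult_le_0_iff)
  then have "w = 0" using def[of w] by (simp add: form_self)
  then show ?thesis by (auto simp: w_def A_def)
qed

text \<open>Symmetry makes d (T x) x real, so the imaginary part of d (T x - \<tau> x) x comes from
  \<tau> alone.\<close>

lemma nonreal_bounded_below:
  "\<bar>Im \<tau>\<bar> * form_norm d x \<le> form_norm d (T x - s \<tau> x)"
proof -
  have "Im (d (T x) x) = 0"
    using form_hermitian[of "T x" x] op_sym[of x x] by (simp add: complex_eq_iff)
  then have "\<bar>Im \<tau>\<bar> * (form_norm d x)\<^sup>2 = \<bar>Im (d (T x - s \<tau> x) x)\<bar>"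
    by (simp add: form_simps form_self abs_mult del: of_real_power)
  also have "\<dots> \<le> form_norm d (T x - s \<tau> x) * form_norm d x"
    using abs_Im_le_cmod cauchy_schwarz[of "T x - s \<tau> x" x] by (blast intro: order_trans)
  finally show ?thesis
    by (rule mult_square_le_cancel) (simp_all add: fnorm_ge_0)
qed

end

text \<open>\<open>T\<close> is the resolvent at \<open>-1\<close> of the operator generated by \<open>q\<close>, extended by \<open>0\<close> to the orthogonal
  complement of the closure of \<open>D\<close>.\<close>

locale form_resolvent = pos_form s UNIV d + D: pos_form s D q
  for s :: "complex \<Rightarrow> 'h::ab_group_add \<Rightarrow> 'h" and d D q +
  fixes T :: "'h \<Rightarrow> 'h"
  assumes definite: "d x x = 0 \<Longrightarrow> x = 0"
    and complete: "norm_complete UNIV d"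
    and T_dom: "T f \<in> D"
    and T_eq: "v \<in> D \<Longrightarrow> q (T f) v + d (T f) v = d f v"
begin

text \<open>The difference of two solutions has zero total energy. Through this lemma each identity
  for \<open>T\<close>, such as its linearity, becomes a check of the defining equation.\<close>

lemma T_unique:
  assumes "u \<in> D" "\<And>v. v \<in> D \<Longrightarrow> q u v + d u v = d f v"
  shows "u = T f"
proof -
  define w where "w = u - T f"
  have w: "w \<in> D" using assms(1) T_dom by (simp add: w_def D.carrier_intros)
  have "q w w + d w w = 0"
    using assms(2)[OF w] T_eq[OF w, of f] assms(1) T_dom[of f] w
    unfolding w_def
    by (simp add: D.form_diff_left form_diff_left D.carrier_intros algebra_simps)
  moreover have "0 \<le> Re (q w w)" "0 \<le> Re (d w w)"
    using w D.form_self_ge_0 form_self_ge_0 by auto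
  ultimately have "Re (d w w) = 0" by (simp add: complex_eq_iff)
  then have "d w w = 0" by (simp add: complex_eq_iff form_self_real)
  then show ?thesis using definite by (force simp: w_def)
qed

text \<open>Testing the equation with T f itself gives T^2 \<le> T. Contraction, positivity and
  hence the spectral bounds 0 and 1 all come from it.\<close>

lemma T_bound_sq: "(form_norm d (T f))\<^sup>2 \<le> Re (d f (T f))"
  using T_eq[OF T_dom, of f f, symmetric] D.form_self_ge_0[OF T_dom, of f]
  by (simp add: fnorm_sq)

lemma T_bound: "form_norm d (T f) \<le> form_norm d f"
proof -
  have "1 * (form_norm d (T f))\<^sup>2 \<le> form_norm d f * form_norm d (T f)"
    using T_bound_sq[of f] complex_Re_le_cmod[of "d f (T f)"] cauchy_schwarz[of f "T f"] by simp
  then have "1 * form_norm d (T f) \<le> form_norm d f"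
    by (rule mult_square_le_cancel) (simp_all add: fnorm_ge_0)
  then show ?thesis by simp
qed

sublocale sym_op s d T 1
proof (unfold_locales, goal_cases)
  case (1 x y)
  show ?case
  proof (rule T_unique[symmetric])
    fix v assume "v \<in> D"
    then show "q (T x + T y) v + d (T x + T y) v = d (x + y) v"
      using T_eq[of v x, symmetric] T_eq[of v y, symmetric] T_dom[of x] T_dom[of y]
      by (simp add: D.form_add_left form_add_left)
  qed (simp add: T_dom D.carrier_intros)
next
  case (2 c x)
  show ?case
  proof (rule T_unique[symmetric])
    fix v assume "v \<in> D"
    then show "q (s c (T x)) v + d (s c (T x)) v = d (s c x) v"
      using T_eq[of v x, symmetric] T_dom[of x]
      by (simp add: D.form_scale_left form_scale_left distrib_left)
  qed (simp add: T_dom D.carrier_intros)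
next
  case (3 x y)
  have "d x (T y) = q (T x) (T y) + d (T x) (T y)" by (rule T_eq[OF T_dom, symmetric])
  also have "\<dots> = cnj (q (T y) (T x) + d (T y) (T x))"
    using D.form_hermitian[OF T_dom T_dom, of y x] form_hermitian[of "T y" "T x"] by simp
  also have "\<dots> = cnj (d y (T x))" by (simp only: T_eq[OF T_dom])
  also have "\<dots> = d (T x) y" using form_hermitian[of y "T x"] by simp
  finally show ?case by simp
qed (simp_all add: T_bound)

text \<open>Adding d u v to both sides of the form equation turns A u = g into (A + 1) u = g + u,
  which is why \<open>T\<close> is the resolvent at -1.\<close>

lemma form_operator_iff:
  assumes "D \<subseteq> X" "subspace X"
  shows "(u, g) \<in> form_operator X d D q \<longleftrightarrow> g \<in> X \<and> u = T (g + u)"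
proof
  assume "(u, g) \<in> form_operator X d D q"
  then show "g \<in> X \<and> u = T (g + u)"
    by (auto simp: form_operator_def form_simps intro!: T_unique)
next
  assume *: "g \<in> X \<and> u = T (g + u)"
  then have "u \<in> D" using T_dom[of "g + u"] by simp
  moreover have "q u v = d g v" if "v \<in> D" for v
    using T_eq[OF that, of "g + u"] * by (simp add: form_simps)
  ultimately show "(u, g) \<in> form_operator X d D q" using * by (simp add: form_operator_def)
qed

lemma approx_spectrum_range:
  assumes "\<tau> \<in> approx_spectrum s d T"
  shows "0 \<le> \<tau>" "\<tau> \<le> 1"
proof -
  have *: "\<tau> * form_norm d x \<le> form_norm d x + form_norm d (T x - s (of_real \<tau>) x)"
    "- \<tau> * form_norm d x \<le> form_norm d (T x - s (of_real \<tau>) x)" for x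
  proof -
    define r where "r = T x - s (of_real \<tau>) x"
    have "\<bar>\<tau>\<bar> * form_norm d x = form_norm d (T x - r)"
      by (simp add: r_def fnorm_scale)
    also have "\<dots> \<le> form_norm d x + form_norm d r"
      using fnorm_triangle_diff[of "T x" r] T_bound[of x] by simp
    finally show "\<tau> * form_norm d x \<le> form_norm d x + form_norm d r"
      using fnorm_ge_0[of x] by (smt (verit) UNIV_I mult_right_mono)
    have "0 \<le> Re (d (T x) x)"
      using T_bound_sq[of x] op_sym[of x x] by (smt (verit) zero_le_power2)
    then have "- \<tau> * (form_norm d x)\<^sup>2 \<le> Re (d r x)"
      by (simp add: r_def form_simps form_self del: of_real_power)
    also have "\<dots> \<le> form_norm d r * form_norm d x"
      using complex_Re_le_cmod cauchy_schwarz[of r x] by (blast intro: order_trans)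
    finally show "- \<tau> * form_norm d x \<le> form_norm d r"
      by (rule mult_square_le_cancel) (simp_all add: fnorm_ge_0)
  qed
  show "0 \<le> \<tau>"
  proof (rule ccontr)
    assume "\<not> 0 \<le> \<tau>"
    then obtain x where "form_norm d (T x - s (of_real \<tau>) x) < - \<tau> * form_norm d x"
      using approx_spectrumD[OF assms, of "- \<tau>"] by auto
    then show False using *(2)[of x] by simp
  qed
  show "\<tau> \<le> 1"
  proof (rule ccontr)
    assume "\<not> \<tau> \<le> 1"
    then obtain x where "form_norm d (T x - s (of_real \<tau>) x) < (\<tau> - 1) * form_norm d x"
      using approx_spectrumD[OF assms, of "\<tau> - 1"] by auto
    then show False using *(1)[of x] by (simp add: algebra_simps)
  qed
qed

text \<open>Spectral mapping for the resolvent at -1. The value \<tau> = 0 is left out: it stands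
  for infinity, and the extension of \<open>T\<close> by 0 can produce it.\<close>

lemma spectrum_form_operator:
  assumes X: "D \<subseteq> X" "subspace X"
  shows "spectrum s X d (form_operator X d D q)
    = (\<lambda>\<tau>. of_real (1 / \<tau> - 1)) ` {\<tau> \<in> approx_spectrum s d T. \<tau> > 0}"
proof (intro set_eqI iffI)
  note A = form_operator_iff[OF X]
  fix \<mu> assume *: "\<mu> \<in> spectrum s X d (form_operator X d D q)"
  show "\<mu> \<in> (\<lambda>\<tau>. of_real (1 / \<tau> - 1)) ` {\<tau> \<in> approx_spectrum s d T. \<tau> > 0}"
  proof (rule ccontr)
    assume no: "\<mu> \<notin> (\<lambda>\<tau>. of_real (1 / \<tau> - 1)) ` {\<tau> \<in> approx_spectrum s d T. \<tau> > 0}"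
    \<comment> \<open>The equation (A - \<mu>) u = f reads u = T (f + k u). For k \<noteq> 0 and x =
      f + k u it becomes T x - x / k = - f / k, so invertibility of T - 1 / k decides.\<close>
    define k where "k = 1 + \<mu>"
    have iff: "(u, f + s \<mu> u) \<in> form_operator X d D q \<longleftrightarrow> f \<in> X \<and> u = T (f + s k u)" for u f
    proof -
      have "T (f + s \<mu> u + u) = T (f + s k u)" by (simp add: k_def scale_left_distrib add_ac)
      moreover have "f + s \<mu> u \<in> X \<longleftrightarrow> f \<in> X" if "u = T (f + s k u)"
      proof -
        have "u \<in> X" using that T_dom[of "f + s k u"] X(1) by auto
        then show ?thesis
          using subspace_add[OF X(2), of f "s \<mu> u"] subspace_diff[OF X(2), of "f + s \<mu> u" "s \<mu> u"]
            subspace_scale[OF X(2)] by auto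
      qed
      ultimately show ?thesis unfolding A by metis
    qed
    have "\<exists>c>0. (\<forall>u f. u = T (f + s k u) \<longrightarrow> c * form_norm d u \<le> form_norm d f) \<and>
       (\<forall>f. \<exists>u. u = T (f + s k u))"
    proof (cases "k = 0")
      case True
      then show ?thesis using T_bound by (intro exI[of _ 1]) auto
    next
      case False
      define \<tau> where "\<tau> = 1 / k"
      have kt: "k * \<tau> = 1" using False by (simp add: \<tau>_def)
      obtain c where c: "c > 0"
        "\<And>x. c * form_norm d x \<le> form_norm d (T x - s \<tau> x)"
        "\<And>x. c * form_norm d x \<le> form_norm d (T x - s (cnj \<tau>) x)"
      \<comment> \<open>For real \<tau> the lower bound expresses that \<tau> is not in the
        approximate spectrum, and conjugation changes nothing; for the others symmetry supplies both
        bounds.\<close>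
      proof (cases "Im \<tau> = 0")
        case True
        then have re: "\<tau> = of_real (Re \<tau>)" by (simp add: complex_eq_iff)
        have "Re \<tau> \<notin> approx_spectrum s d T"
        proof
          assume t: "Re \<tau> \<in> approx_spectrum s d T"
          have "Re \<tau> \<noteq> 0" using re kt by auto
          then have "Re \<tau> > 0" using approx_spectrum_range[OF t] by simp
          moreover have "\<mu> = of_real (1 / Re \<tau> - 1)"
          proof -
            have "k = 1 / of_real (Re \<tau>)" using kt re by (metis False \<tau>_def div_by_1 divide_divide_eq_right mult_1)
            then show ?thesis by (simp add: k_def algebra_simps)
          qed
          ultimately show False using no t by blast
        qed
        then obtain c where "c > 0" "\<And>x. c * form_norm d x \<le> form_norm d (T x - s (of_real (Re \<tau>)) x)"
          using not_approx_spectrum by blast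
        then show thesis using that re by (metis complex_cnj_complex_of_real)
      next
        case False
        then show thesis
          using that[of "\<bar>Im \<tau>\<bar>"] nonreal_bounded_below[of \<tau>] nonreal_bounded_below[of "cnj \<tau>"] by simp
      qed
      have bound: "cmod k * c * form_norm d u \<le> form_norm d f" if "u = T (f + s k u)" for u f
      proof -
        define x where "x = f + s k u"
        have u: "u = T x" using that by (simp add: x_def)
        have "f = x - s k u" by (simp add: x_def)
        also have "\<dots> = s (- k) (T x - s \<tau> x)"
          unfolding u using kt by (simp add: scale_right_diff_distrib)
        finally have "form_norm d f = cmod k * form_norm d (T x - s \<tau> x)"
          by (simp only: fnorm_scale[OF UNIV_I] norm_minus_cancel)
        moreover have "c * form_norm d u \<le> form_norm d (T x - s \<tau> x)"
          using c(1) T_bound[of x] c(2)[of x] u by (smt (verit) mult_left_mono)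
        ultimately show ?thesis by (simp add: mult_left_mono mult.assoc)
      qed
      have surj: "\<exists>u. u = T (f + s k u)" for f
      proof -
        obtain x where x: "T x - s \<tau> x = s (- \<tau>) f"
          using surj_shift[OF complete definite c] by blast
        have "f + s k (T x) = x"
        proof -
          have "s k (T x - s \<tau> x) = s k (s (- \<tau>) f)" using x by simp
          then have "s k (T x) - x = - f" using kt by (simp add: scale_right_diff_distrib)
          then show ?thesis by (simp add: algebra_simps)
        qed
        then show ?thesis by metis
      qed
      show ?thesis
        using bound surj False c(1) by (intro exI[of _ "cmod k * c"]) auto
    qed
    then obtain c where c: "c > 0"
      and lo: "\<And>u f. u = T (f + s k u) \<Longrightarrow> c * form_norm d u \<le> form_norm d f"
      and ex: "\<And>f. \<exists>u. u = T (f + s k u)" by blast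
    have uniq: "u = w" if "u = T (f + s k u)" "w = T (f + s k w)" for u w f
    proof -
      have "u - w = T (f + s k u) - T (f + s k w)"
        using that by metis
      also have "\<dots> = T (0 + s k (u - w))"
        by (simp add: op_diff[symmetric] scale_right_diff_distrib)
      finally have "c * form_norm d (u - w) \<le> form_norm d 0" by (rule lo)
      then have "form_norm d (u - w) = 0"
        using c fnorm_ge_0[of "u - w"] by (simp add: fnorm_zero mult_le_0_iff)
      then show "u = w" using definite[of "u - w"] by (simp add: form_self)
    qed
    have "\<mu> \<in> resolvent_set s X d (form_operator X d D q)"
      unfolding resolvent_set_def
    proof (intro CollectI conjI ballI exI[of _ "1 / c"])
      fix f assume "f \<in> X"
      then show "\<exists>!u. (u, f + s \<mu> u) \<in> form_operator X d D q"
        using ex[of f] uniq[of _ f] unfolding iff by blast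
    next
      fix ug assume ug: "ug \<in> form_operator X d D q"
      obtain u g where [simp]: "ug = (u, g)" by force
      have "(u, (g - s \<mu> u) + s \<mu> u) \<in> form_operator X d D q" using ug by simp
      then have "c * form_norm d u \<le> form_norm d (g - s \<mu> u)" unfolding iff by (blast intro: lo)
      then show "case ug of (u, g) \<Rightarrow> form_norm d u \<le> 1 / c * form_norm d (g - s \<mu> u)"
        using c by (simp add: field_simps)
    qed
    then show False using * by (simp add: spectrum_def)
  qed
next
  fix \<mu> :: complex assume "\<mu> \<in> (\<lambda>\<tau>. of_real (1 / \<tau> - 1)) ` {\<tau> \<in> approx_spectrum s d T. \<tau> > 0}"
  then obtain \<tau> where \<tau>: "\<tau> \<in> approx_spectrum s d T" "\<tau> > 0" "\<mu> = of_real (1 / \<tau> - 1)" by auto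
  show "\<mu> \<in> spectrum s X d (form_operator X d D q)"
  proof (rule ccontr)
    assume "\<mu> \<notin> spectrum s X d (form_operator X d D q)"
    then obtain C where C0: "\<forall>(u, g)\<in>form_operator X d D q.
        form_norm d u \<le> C * form_norm d (g - s \<mu> u)"
      unfolding spectrum_def resolvent_set_def by blast
    have C: "form_norm d u \<le> C * form_norm d (g - s \<mu> u)"
      if "(u, g) \<in> form_operator X d D q" for u g
      using bspec[OF C0 that] by simp
    \<comment> \<open>\<open>W\<close> dominates every coefficient that |r| will receive, and
      \<delta> is chosen so that the final bound reads \<tau>^2 |x| \<le> \<tau>^2 |x| / 2.\<close>
    define W where "W = (\<tau> + 1) * (1 + \<bar>C\<bar> / \<tau>)"
    have W: "W > 0"
      using \<tau>(2) by (simp add: W_def add_pos_nonneg)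
    define \<delta> where "\<delta> = \<tau>\<^sup>2 / (2 * W)"
    have \<delta>: "\<delta> > 0" using \<tau>(2) W by (simp add: \<delta>_def)
    obtain x where x: "form_norm d (T x - s (of_real \<tau>) x) < \<delta> * form_norm d x"
      using \<tau>(1) \<delta> unfolding approx_spectrum_def by blast
    define r where "r = T x - s (of_real \<tau>) x"
    define u where "u = T (T x)"
    have Tr: "form_norm d (T r) \<le> form_norm d r" by (rule T_bound)
    \<comment> \<open>\<open>Tx\<close> lies in \<open>X\<close>, unlike \<open>x\<close>, and is an approximate eigenvector as well.\<close>
    have "(u, T x - u) \<in> form_operator X d D q"
      unfolding form_operator_iff[OF X] u_def
      using T_dom X subspace_diff by fastforce
    then have "form_norm d u \<le> C * form_norm d ((T x - u) - s \<mu> u)" by (rule C)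
    moreover have "(T x - u) - s \<mu> u = s (- of_real (1 / \<tau>)) (T r)"
      using \<tau>(2) unfolding \<tau>(3) u_def r_def
      by (simp add: op_diff op_scale algebra_simps)
    then have "form_norm d ((T x - u) - s \<mu> u) = 1 / \<tau> * form_norm d (T r)"
      using \<tau>(2) by (simp only: fnorm_scale[OF UNIV_I]) (simp add: norm_divide)
    ultimately have "form_norm d u \<le> C * (1 / \<tau> * form_norm d (T r))"
      by simp
    also have "\<dots> \<le> \<bar>C\<bar> * (1 / \<tau> * form_norm d (T r))"
      using \<tau>(2) by (intro mult_right_mono) (simp_all add: fnorm_ge_0)
    finally have "form_norm d u \<le> \<bar>C\<bar> / \<tau> * form_norm d (T r)"
      by simp
    moreover have "\<tau>\<^sup>2 * form_norm d x \<le> form_norm d u + (\<tau> + 1) * form_norm d r"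
    proof -
      \<comment> \<open>Iterating T x = \<tau> x + r once expresses x by \<open>u\<close> = T (T x)
        and \<open>r\<close>, both of which are small.\<close>
      have "s (of_real (\<tau>\<^sup>2)) x = u - (T r + s (of_real \<tau>) r)"
        by (simp add: u_def r_def op_diff op_scale power2_eq_square algebra_simps)
      then have "\<tau>\<^sup>2 * form_norm d x = form_norm d (u - (T r + s (of_real \<tau>) r))"
        using fnorm_scale[of x "of_real (\<tau>\<^sup>2)"] by (simp del: of_real_power)
      also have "\<dots> \<le> form_norm d u + form_norm d (T r + s (of_real \<tau>) r)"
        by (rule fnorm_triangle_diff) auto
      also have "form_norm d (T r + s (of_real \<tau>) r) \<le> form_norm d r + \<tau> * form_norm d r"
        using fnorm_triangle[of "T r" "s (of_real \<tau>) r"] Tr \<tau>(2) by (simp add: fnorm_scale)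
      finally show ?thesis by (simp add: algebra_simps)
    qed
    ultimately have "\<tau>\<^sup>2 * form_norm d x \<le> (\<bar>C\<bar> / \<tau> + \<tau> + 1) * form_norm d r"
      using Tr mult_left_mono[OF Tr, of "\<bar>C\<bar> / \<tau>"] \<tau>(2) by (simp add: algebra_simps)
    also have "\<dots> \<le> W * form_norm d r"
      using \<tau>(2) by (intro mult_right_mono) (auto simp: W_def field_simps fnorm_ge_0)
    also have "\<dots> \<le> W * (\<delta> * form_norm d x)"
      using x W by (intro mult_left_mono) (auto simp: r_def)
    also have "\<dots> = \<tau>\<^sup>2 / 2 * form_norm d x"
      using W by (simp add: \<delta>_def)
    finally have "form_norm d x \<le> 0" using \<tau>(2) fnorm_ge_0[of x] by simp
    then show False using x fnorm_ge_0[of "T x - s (of_real \<tau>) x"] fnorm_ge_0[of x] \<delta>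
      by (smt (verit) UNIV_I mult_nonneg_nonpos)
  qed
qed

end

section \<open>Existence of resolvents, and comparison of spectra under isometries\<close>

lemma form_resolvent_exists:
  assumes d: "pos_form s UNIV d" and def: "\<And>x. d x x = 0 \<Longrightarrow> x = 0" and compl: "norm_complete UNIV d"
    and q: "pos_form s D q" and complq: "norm_complete D (\<lambda>u v. q u v + d u v)"
  shows "\<exists>T. form_resolvent s d D q T"
proof -
  interpret pos_form s UNIV d by (fact d)
  interpret D: pos_form s D q by (fact q)
  interpret Q: pos_form s D "\<lambda>u v. q u v + d u v"
  using pos_form_add[OF D.pos_form_axioms pos_form_axioms] by simp
  have "\<exists>u\<in>D. \<forall>v\<in>D. q u v + d u v = d f v" for f
  proof (rule Q.riesz[OF complq])
    fix x assume x: "x \<in> D"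
    have "form_norm d x \<le> form_norm (\<lambda>u v. q u v + d u v) x"
      using D.form_self_ge_0[OF x] by (simp add: form_norm_def)
    then have "form_norm d f * form_norm d x \<le> form_norm d f * form_norm (\<lambda>u v. q u v + d u v) x"
      by (intro mult_left_mono) (simp_all add: fnorm_ge_0)
    then show "cmod (d f x) \<le> form_norm d f * form_norm (\<lambda>u v. q u v + d u v) x"
      using cauchy_schwarz[of f x] by simp
  qed (simp_all add: form_simps)
  then obtain T where "\<And>f. T f \<in> D \<and> (\<forall>v\<in>D. q (T f) v + d (T f) v = d f v)"
    by metis
  then have "form_resolvent s d D q T"
    using def compl by unfold_locales auto
  then show ?thesis by blast
qed

text \<open>The defect of linearity is orthogonal to the range of \<open>E\<close>, which is the
  whole space.\<close>

lemma isometry_linear: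
  assumes p: "pos_form s UNIV p" and d: "pos_form s UNIV d" and def: "\<And>x. d x x = 0 \<Longrightarrow> x = 0"
    and E: "surj E" "\<And>u w. d (E u) (E w) = p u w"
  shows "E (x - y) = E x - E y" "E (s c x) = s c (E x)" "form_norm d (E x) = form_norm p x"
proof -
  interpret P: pos_form s UNIV p by (fact p)
  interpret pos_form s UNIV d by (fact d)
  have zero: "w = 0" if "\<And>y. d w (E y) = 0" for w
    using that E(1) def by (metis surjD)
  have "E (x - y) - (E x - E y) = 0"
    by (rule zero) (simp add: form_simps E P.form_simps)
  then show "E (x - y) = E x - E y" by simp
  have "E (s c x) - s c (E x) = 0"
    by (rule zero) (simp add: form_simps E P.form_simps)
  then show "E (s c x) = s c (E x)" by simp
  show "form_norm d (E x) = form_norm p x" by (simp add: form_norm_def E)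
qed

text \<open>An approximate eigenvector of one operator, carried over by the isometry, is one of the
  other. One \<delta> is the tolerance with which it was chosen, the second is the distance of the
  operators.\<close>

lemma approx_spectrum_transfer:
  assumes G: "sym_op s p G B1" and T: "sym_op s d T B2" and def: "\<And>x. d x x = 0 \<Longrightarrow> x = 0"
    and E: "bij E" "\<And>u w. d (E u) (E w) = p u w"
    and close: "\<And>x. form_norm d (T (E x) - E (G x)) \<le> \<delta> * form_norm p x" and \<delta>: "\<delta> > 0"
  shows "\<sigma> \<in> approx_spectrum s p G \<Longrightarrow> \<exists>\<tau>\<in>approx_spectrum s d T. \<bar>\<tau> - \<sigma>\<bar> \<le> 2 * \<delta>"
    and "\<tau> \<in> approx_spectrum s d T \<Longrightarrow> \<exists>\<sigma>\<in>approx_spectrum s p G. \<bar>\<sigma> - \<tau>\<bar> \<le> 2 * \<delta>"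
proof -
  interpret G: sym_op s p G B1 by (fact G)
  interpret T: sym_op s d T B2 by (fact T)
  note lin = isometry_linear[OF G.pos_form_axioms T.pos_form_axioms def bij_is_surj[OF E(1)] E(2)]
  have eq: "form_norm p (G x - s c x) = form_norm d (E (G x) - s c (E x))" for x c
    using lin(3)[of "G x - s c x"] by (simp add: lin)
  have pos: "form_norm p x > 0" if "form_norm p y < \<delta> * form_norm p x" for x y
    using that G.fnorm_ge_0[of y] \<delta> by (smt (verit) UNIV_I mult_nonneg_nonpos)
  {
    assume "\<sigma> \<in> approx_spectrum s p G"
    then obtain x where x: "form_norm p (G x - s (of_real \<sigma>) x) < \<delta> * form_norm p x"
      using approx_spectrumD \<delta> by blast
    have "T (E x) - s (of_real \<sigma>) (E x) = (T (E x) - E (G x)) + (E (G x) - s (of_real \<sigma>) (E x))"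
      by simp
    then have "form_norm d (T (E x) - s (of_real \<sigma>) (E x))
        \<le> form_norm d (T (E x) - E (G x)) + form_norm d (E (G x) - s (of_real \<sigma>) (E x))"
      using T.fnorm_triangle by (metis UNIV_I)
    also have "\<dots> \<le> 2 * \<delta> * form_norm d (E x)"
      using close[of x] x by (simp add: eq lin(3))
    finally show "\<exists>\<tau>\<in>approx_spectrum s d T. \<bar>\<tau> - \<sigma>\<bar> \<le> 2 * \<delta>"
      using pos[OF x] by (intro T.approx_spectrum_near[of "E x"]) (simp_all add: lin(3))
  next
    assume "\<tau> \<in> approx_spectrum s d T"
    then obtain y where y: "form_norm d (T y - s (of_real \<tau>) y) < \<delta> * form_norm d y"
      using approx_spectrumD \<delta> by blast
    obtain x where Ex: "y = E x" using E(1) by (metis bij_pointE)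
    have "E (G x) - s (of_real \<tau>) (E x) = (T (E x) - s (of_real \<tau>) (E x)) - (T (E x) - E (G x))"
      by simp
    then have "form_norm d (E (G x) - s (of_real \<tau>) (E x))
        \<le> form_norm d (T (E x) - s (of_real \<tau>) (E x)) + form_norm d (T (E x) - E (G x))"
      using T.fnorm_triangle_diff by (metis UNIV_I)
    then have "form_norm p (G x - s (of_real \<tau>) x) \<le> 2 * \<delta> * form_norm p x"
      using close[of x] y by (simp add: eq lin(3) Ex)
    moreover have "form_norm p x > 0"
      using y \<delta> T.fnorm_ge_0[of "T y - s (of_real \<tau>) y"] lin(3)[of x] unfolding Ex
      by (smt (verit) UNIV_I mult_nonneg_nonpos)
    ultimately show "\<exists>\<sigma>\<in>approx_spectrum s p G. \<bar>\<sigma> - \<tau>\<bar> \<le> 2 * \<delta>"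
      by (intro G.approx_spectrum_near)
  }
qed

text \<open>The vector \<open>v\<close> satisfies \<open>|T v - v|\<^sup>2 \<le> (1 - \<rho>) |v|\<^sup>2\<close>, so \<open>T\<close> has spectrum close to \<open>1\<close>.\<close>

lemma (in form_resolvent) approx_spectrum_rayleigh:
  assumes v: "v \<in> D" "form_norm d v > 0"
  defines "\<rho> \<equiv> Re (d v v) / (Re (q v v) + Re (d v v))"
  shows "\<exists>\<tau>\<in>approx_spectrum s d T. 1 - sqrt (1 - \<rho>) \<le> \<tau>" "0 < 1 - sqrt (1 - \<rho>)"
proof -
  define N where "N = (form_norm d v)\<^sup>2"
  define M where "M = Re (q v v) + Re (d v v)"
  have N: "N > 0" using v(2) unfolding N_def by (rule zero_less_power)
  have N': "Re (d v v) = N" using fnorm_sq[of v] by (simp add: N_def)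
  have M: "M \<ge> N" "M > 0" using D.form_self_ge_0[OF v(1)] N N' by (simp_all add: M_def)
  have \<rho>: "\<rho> = N / M" using N' by (simp add: \<rho>_def M_def)
  have \<rho>01: "0 < \<rho>" "\<rho> \<le> 1" using N M by (simp_all add: \<rho>)
  interpret Q: pos_form s D "\<lambda>u v. q u v + d u v"
  using pos_form_add[OF D.pos_form_axioms pos_form_axioms] by simp
  define R where "R = Re (d v (T v))"
  \<comment> \<open>Cauchy-Schwarz for q + d at T v and v: the product of the two vectors is
    \<open>N\<close>, their energies are \<open>R\<close> and \<open>M\<close>, hence N^2 \<le> R
    M.\<close>
  have "N = cmod (q (T v) v + d (T v) v)"
    using T_eq[OF v(1), of v] by (simp add: form_self N_def norm_power)
  then have "N\<^sup>2 \<le> (form_norm (\<lambda>u v. q u v + d u v) (T v) * form_norm (\<lambda>u v. q u v + d u v) v)\<^sup>2"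
    using Q.cauchy_schwarz[OF T_dom v(1), of v] N by (intro power_mono) auto
  also have "\<dots> = R * M"
    using Q.fnorm_sq[OF T_dom, of v] Q.fnorm_sq[OF v(1)] T_eq[OF T_dom, of v v]
    by (simp add: power_mult_distrib R_def M_def flip: plus_complex.sel)
  finally have R: "\<rho> * N \<le> R"
    using M by (simp add: \<rho> power2_eq_square pos_divide_le_eq)
  \<comment> \<open>As |T v|^2 \<le> R, the right side is at most N - R, and R \<ge> \<rho>
    N.\<close>
  have "(form_norm d (T v - s (of_real 1) v))\<^sup>2 = (form_norm d (T v))\<^sup>2 - 2 * R + N"
    using op_sym[of v v] form_hermitian[of v "T v"]
    by (simp add: fnorm_sq form_simps R_def N')
  also have "\<dots> \<le> (1 - \<rho>) * N"
    using R T_bound_sq[of v] by (simp add: R_def algebra_simps)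
  also have "\<dots> = (sqrt (1 - \<rho>) * form_norm d v)\<^sup>2"
    using \<rho>01 by (simp add: power_mult_distrib N_def)
  finally have "form_norm d (T v - s (of_real 1) v) \<le> sqrt (1 - \<rho>) * form_norm d v"
    by (rule power2_le_imp_le) (use \<rho>01 v(2) in simp)
  from approx_spectrum_near[OF v(2) this]
  obtain \<tau> where "\<tau> \<in> approx_spectrum s d T" "\<bar>\<tau> - 1\<bar> \<le> sqrt (1 - \<rho>)" by blast
  then show "\<exists>\<tau>\<in>approx_spectrum s d T. 1 - sqrt (1 - \<rho>) \<le> \<tau>"
    by (intro bexI[of _ \<tau>]) (simp_all add: abs_le_iff)
  show "0 < 1 - sqrt (1 - \<rho>)" using \<rho>01 by simp
qed

section \<open>The family of forms\<close>

lemma cdot_scale: "cdot x (t *\<^sub>R \<theta>) = of_real t * cdot x \<theta>"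
  by (simp add: cdot_def sum_distrib_left mult_ac)

definition qdot :: "complex^'n^'n \<Rightarrow> real^'n \<Rightarrow> complex" where
  "qdot A \<theta> = cdot (A *v cvec \<theta>) \<theta>"

lemma qdot_sum: "qdot A \<theta> = (\<Sum>i\<in>UNIV. \<Sum>j\<in>UNIV. A $ i $ j * of_real (\<theta> $ i * \<theta> $ j))"
  by (simp add: qdot_def cdot_def matrix_vector_mult_def cvec_def sum_distrib_left mult_ac)

lemma qdot_scale: "qdot A (t *\<^sub>R \<theta>) = of_real (t\<^sup>2) * qdot A \<theta>"
  by (simp add: qdot_sum sum_distrib_left power2_eq_square mult_ac)

lemma sesquilinear_cdot:
  assumes "\<And>i. sesquilinear_on s U V (\<lambda>v u. f v u $ i)"
  shows "sesquilinear_on s U V (\<lambda>v u. cdot (f v u) \<theta>)"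
  using assms unfolding sesquilinear_on_def cdot_def
  by (simp add: sum.distrib distrib_right sum_distrib_left mult.assoc)

lemma sesquilinear_qdot:
  assumes "\<And>i j. sesquilinear_on s U V (\<lambda>v u. f v u $ i $ j)"
  shows "sesquilinear_on s U V (\<lambda>v u. qdot (f v u) \<theta>)"
  using assms unfolding sesquilinear_on_def qdot_sum
  by (simp add: sum.distrib distrib_right sum_distrib_left mult.assoc)

text \<open>The limit t \<rightarrow> 0 as an inequality. It compares lowest-order coefficients of
  expansions along a ray t \<theta>.\<close>

lemma small_scale_zero:
  fixes x C t0 :: real
  assumes "t0 > 0" "\<And>t. 0 < t \<Longrightarrow> t \<le> t0 \<Longrightarrow> x \<le> C * t"
  shows "x \<le> 0"
proof (rule ccontr)
  assume "\<not> x \<le> 0"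
  \<comment> \<open>Small enough for |C| t to stay below x / 2.\<close>
  define t where "t = min t0 (x / (2 * (\<bar>C\<bar> + 1)))"
  have t: "0 < t" "t \<le> t0" using assms(1) \<open>\<not> x \<le> 0\<close> by (auto simp: t_def)
  have "t * (2 * (\<bar>C\<bar> + 1)) \<le> x"
    by (subst pos_le_divide_eq[symmetric]) (auto simp: t_def)
  moreover have "C * t \<le> \<bar>C\<bar> * t" using t by (intro mult_right_mono) auto
  ultimately show False using assms(2)[OF t] t \<open>\<not> x \<le> 0\<close> by (simp add: algebra_simps)
qed

text \<open>The hypotheses with their constants fixed, in the shape in which they are applied:
  \<open>r\<close> and \<open>R\<close> are radii of balls around 0 inside and around the parameter
  set, the Lipschitz bounds for \<open>a\<close> and \<open>E\<close> compare with 0 only, and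
  removability supplies an actual approximating vector instead of an infimum.\<close>

locale two_scale = vector_space s
  for s :: "complex \<Rightarrow> 'h::ab_group_add \<Rightarrow> 'h" +
  fixes H :: "'h set"
    and \<Theta> :: "(real^'n) set"
    and a b d :: "real^'n \<Rightarrow> 'h \<Rightarrow> 'h \<Rightarrow> complex"
    and Vs Z :: "'h set"
    and a' :: "'h \<Rightarrow> 'h \<Rightarrow> complex^'n"
    and a'' :: "'h \<Rightarrow> 'h \<Rightarrow> complex^'n^'n"
    and E :: "real^'n \<Rightarrow> 'h \<Rightarrow> 'h"
    and r R K L Ls KZ \<gamma> \<nu> Ka Ka2 Lb Kb Ke :: real
  assumes H_subspace: "subspace H"
    and r_pos: "r > 0" and ball_\<Theta>: "norm \<theta> \<le> r \<Longrightarrow> \<theta> \<in> \<Theta>"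
    and bound_\<Theta>: "\<theta> \<in> \<Theta> \<Longrightarrow> norm \<theta> \<le> R"
    and a_form: "\<theta> \<in> \<Theta> \<Longrightarrow> nonneg_form_on s H (a \<theta>)"
    and b_form: "\<theta> \<in> \<Theta> \<Longrightarrow> nonneg_form_on s H (b \<theta>)"
    and n_definite: "\<theta> \<in> \<Theta> \<Longrightarrow> u \<in> H \<Longrightarrow> norm_form a b \<theta> u u = 0 \<Longrightarrow> u = 0"
    and n_complete: "\<theta> \<in> \<Theta> \<Longrightarrow> norm_complete H (norm_form a b \<theta>)"
    and K1: "K \<ge> 1"
    and n_equiv: "\<theta>1 \<in> \<Theta> \<Longrightarrow> \<theta>2 \<in> \<Theta> \<Longrightarrow> u \<in> H \<Longrightarrow>
      form_norm (norm_form a b \<theta>1) u \<le> K * form_norm (norm_form a b \<theta>2) u"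
    and L0: "L \<ge> 0"
    and a_lip: "\<theta> \<in> \<Theta> \<Longrightarrow> u \<in> H \<Longrightarrow> v \<in> H \<Longrightarrow> cmod (a \<theta> u v - a 0 u v)
      \<le> L * norm \<theta> * form_norm (norm_form a b 0) u * form_norm (norm_form a b 0) v"
    and \<nu>_pos: "\<nu> > 0"
    and gap: "w \<in> null_complement H a b 0 \<Longrightarrow> \<nu> * (form_norm (norm_form a b 0) w)\<^sup>2 \<le> Re (a 0 w w)"
    and Vs_subspace: "subspace Vs" and Z_subspace: "subspace Z"
    and Ls0: "Ls \<ge> 0"
    and removable: "\<theta>1 \<in> \<Theta> \<Longrightarrow> \<theta>2 \<in> \<Theta> \<Longrightarrow> v1 \<in> V_star H a Vs \<theta>1 \<Longrightarrow> \<exists>v2\<in>V_star H a Vs \<theta>2.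
      form_norm (norm_form a b \<theta>2) (v1 - v2) \<le> Ls * norm (\<theta>1 - \<theta>2) * form_norm (norm_form a b \<theta>1) v1"
    and V0_sum: "direct_sum (null_space H a 0) Vs Z"
    and KZ: "0 \<le> KZ" "KZ < 1"
    and angle: "v \<in> Vs \<Longrightarrow> z \<in> Z \<Longrightarrow> cmod (norm_form a b 0 v z)
      \<le> KZ * form_norm (norm_form a b 0) v * form_norm (norm_form a b 0) z"
    and \<gamma>_pos: "\<gamma> > 0"
    and degeneracy: "\<theta> \<in> \<Theta> \<Longrightarrow> w \<in> null_complement H a b \<theta> \<Longrightarrow>
      \<gamma> * (norm \<theta>)\<^sup>2 * (form_norm (norm_form a b \<theta>) w)\<^sup>2 \<le> Re (a \<theta> w w)"
    and a'_form: "sesquilinear_on s (null_space H a 0) H (\<lambda>v u. a' v u $ i)"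
    and a''_form: "sesquilinear_on s (null_space H a 0) (null_space H a 0) (\<lambda>v u. a'' v u $ i $ j)"
    and Ka0: "Ka \<ge> 0"
    and a'_reg: "v \<in> null_space H a 0 \<Longrightarrow> u \<in> H \<Longrightarrow> \<theta> \<in> \<Theta> \<Longrightarrow> cmod (a \<theta> v u - cdot (a' v u) \<theta>)
      \<le> Ka * (norm \<theta>)\<^sup>2 * form_norm (norm_form a b 0) v * form_norm (norm_form a b 0) u"
    and Ka20: "Ka2 \<ge> 0"
    and a''_reg: "v \<in> null_space H a 0 \<Longrightarrow> u \<in> null_space H a 0 \<Longrightarrow> \<theta> \<in> \<Theta> \<Longrightarrow>
      cmod (a \<theta> v u - qdot (a'' v u) \<theta>)
      \<le> Ka2 * norm \<theta> ^ 3 * form_norm (norm_form a b 0) v * form_norm (norm_form a b 0) u"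
    and Lb0: "Lb \<ge> 0"
    and b_reg: "v \<in> null_space H a 0 \<Longrightarrow> u \<in> null_space H a 0 \<Longrightarrow> \<theta> \<in> \<Theta> \<Longrightarrow>
      cmod (b \<theta> v u - b 0 v u)
      \<le> Lb * norm \<theta> * form_norm (norm_form a b 0) v * form_norm (norm_form a b \<theta>) u"
    and d_inner: "\<theta> \<in> \<Theta> \<Longrightarrow> inner_product_on s UNIV (d \<theta>)"
    and d_complete: "\<theta> \<in> \<Theta> \<Longrightarrow> norm_complete UNIV (d \<theta>)"
    and d_le_b: "\<theta> \<in> \<Theta> \<Longrightarrow> u \<in> H \<Longrightarrow> Re (d \<theta> u u) \<le> Re (b \<theta> u u)"
    and E_range: "\<theta> \<in> \<Theta> \<Longrightarrow> E \<theta> ` Vs = V_star H a Vs \<theta>"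
    and E_b: "\<theta> \<in> \<Theta> \<Longrightarrow> v \<in> Vs \<Longrightarrow> w \<in> Vs \<Longrightarrow> b \<theta> (E \<theta> v) (E \<theta> w) = b 0 v w"
    and E_bij: "\<theta> \<in> \<Theta> \<Longrightarrow> bij (E \<theta>)"
    and E_d: "\<theta> \<in> \<Theta> \<Longrightarrow> d \<theta> (E \<theta> u) (E \<theta> w) = d 0 u w"
    and Kb0: "Kb \<ge> 0"
    and E_bz: "\<theta> \<in> \<Theta> \<Longrightarrow> v \<in> Vs \<Longrightarrow> z \<in> Z \<Longrightarrow> cmod (b \<theta> (E \<theta> v) z - b 0 v z)
      \<le> Kb * norm \<theta> * form_norm (norm_form a b 0) v * form_norm (norm_form a b 0) z"
    and Ke0: "Ke \<ge> 0"
    and E_near: "\<theta> \<in> \<Theta> \<Longrightarrow> form_norm (d \<theta>) (E \<theta> u - u) \<le> Ke * norm \<theta> * form_norm (d 0) u"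
begin

abbreviation nrm :: "real^'n \<Rightarrow> 'h \<Rightarrow> real" where "nrm \<theta> \<equiv> form_norm (norm_form a b \<theta>)"
abbreviation n0 :: "'h \<Rightarrow> real" where "n0 \<equiv> form_norm (norm_form a b 0)"
abbreviation dn :: "real^'n \<Rightarrow> 'h \<Rightarrow> real" where "dn \<theta> \<equiv> form_norm (d \<theta>)"
abbreviation V :: "real^'n \<Rightarrow> 'h set" where "V \<equiv> null_space H a"
abbreviation W :: "real^'n \<Rightarrow> 'h set" where "W \<equiv> null_complement H a b"

lemma zero_in_\<Theta>: "0 \<in> \<Theta>" using ball_\<Theta>[of 0] r_pos by simp

lemma pos_a: "\<theta> \<in> \<Theta> \<Longrightarrow> pos_form s H (a \<theta>)"
  and pos_b: "\<theta> \<in> \<Theta> \<Longrightarrow> pos_form s H (b \<theta>)"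
  by (simp_all add: pos_formI vector_space_axioms H_subspace a_form b_form)

lemma pos_n: "\<theta> \<in> \<Theta> \<Longrightarrow> pos_form s H (norm_form a b \<theta>)"
  using a_form[of \<theta>] b_form[of \<theta>]
  by (intro pos_formI)
     (auto simp: vector_space_axioms H_subspace nonneg_form_on_def sesquilinear_on_def norm_form_def
       algebra_simps nonneg_Reals_add_I)

lemma pos_d: "\<theta> \<in> \<Theta> \<Longrightarrow> pos_form s UNIV (d \<theta>)"
  using d_inner[of \<theta>]
  by (intro pos_formI) (auto simp: vector_space_axioms inner_product_on_def subspace_UNIV)

lemma d_definite: "\<theta> \<in> \<Theta> \<Longrightarrow> d \<theta> x x = 0 \<Longrightarrow> x = 0"
  using d_inner[of \<theta>] by (auto simp: inner_product_on_def)

lemma H_intros: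
  "0 \<in> H" "x \<in> H \<Longrightarrow> y \<in> H \<Longrightarrow> x + y \<in> H" "x \<in> H \<Longrightarrow> y \<in> H \<Longrightarrow> x - y \<in> H"
  "x \<in> H \<Longrightarrow> s c x \<in> H" "x \<in> H \<Longrightarrow> - x \<in> H"
  using pos_form.carrier_intros[OF pos_a[OF zero_in_\<Theta>]] by blast+

lemma n0_ge_0: "u \<in> H \<Longrightarrow> 0 \<le> n0 u"
  using pos_form.fnorm_ge_0[OF pos_n[OF zero_in_\<Theta>]] .

lemma nrm_ge_0: "\<theta> \<in> \<Theta> \<Longrightarrow> u \<in> H \<Longrightarrow> 0 \<le> nrm \<theta> u"
  using pos_form.fnorm_ge_0[OF pos_n] .

lemma dn_ge_0: "\<theta> \<in> \<Theta> \<Longrightarrow> 0 \<le> dn \<theta> u"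
  using pos_form.fnorm_ge_0[OF pos_d] by blast

lemma nrm_le: "\<theta> \<in> \<Theta> \<Longrightarrow> u \<in> H \<Longrightarrow> nrm \<theta> u \<le> K * n0 u"
  and n0_le: "\<theta> \<in> \<Theta> \<Longrightarrow> u \<in> H \<Longrightarrow> n0 u \<le> K * nrm \<theta> u"
  using n_equiv zero_in_\<Theta> by blast+

lemma a_le_nrm: "\<theta> \<in> \<Theta> \<Longrightarrow> u \<in> H \<Longrightarrow> form_norm (a \<theta>) u \<le> nrm \<theta> u"
  and b_le_nrm: "\<theta> \<in> \<Theta> \<Longrightarrow> u \<in> H \<Longrightarrow> form_norm (b \<theta>) u \<le> nrm \<theta> u"
  using pos_form.form_self_ge_0[OF pos_a] pos_form.form_self_ge_0[OF pos_b]
  by (auto simp: form_norm_def norm_form_def)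

lemma dn_le_b: "\<theta> \<in> \<Theta> \<Longrightarrow> u \<in> H \<Longrightarrow> dn \<theta> u \<le> form_norm (b \<theta>) u"
  using d_le_b by (simp add: form_norm_def)

lemma dn_le: "\<theta> \<in> \<Theta> \<Longrightarrow> u \<in> H \<Longrightarrow> dn \<theta> u \<le> K * n0 u"
  using dn_le_b b_le_nrm nrm_le by (meson order_trans)

lemma dn0_le: "u \<in> H \<Longrightarrow> dn 0 u \<le> n0 u"
  using dn_le_b b_le_nrm zero_in_\<Theta> by (meson order_trans)

lemma a_bound:
  assumes "\<theta> \<in> \<Theta>" "u \<in> H" "v \<in> H"
  shows "cmod (a \<theta> u v) \<le> K\<^sup>2 * n0 u * n0 v"
proof -
  have "cmod (a \<theta> u v) \<le> form_norm (a \<theta>) u * form_norm (a \<theta>) v"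
    using pos_form.cauchy_schwarz[OF pos_a] assms by blast
  also have "\<dots> \<le> (K * n0 u) * (K * n0 v)"
    using assms K1 by (intro mult_mono order_trans[OF a_le_nrm nrm_le] mult_nonneg_nonneg
        n0_ge_0 pos_form.fnorm_ge_0[OF pos_a]) auto
  finally show ?thesis by (simp add: power2_eq_square mult_ac)
qed

lemma b_bound:
  assumes "\<theta> \<in> \<Theta>" "u \<in> H" "v \<in> H"
  shows "cmod (b \<theta> u v) \<le> K\<^sup>2 * n0 u * n0 v"
proof -
  have "cmod (b \<theta> u v) \<le> form_norm (b \<theta>) u * form_norm (b \<theta>) v"
    using pos_form.cauchy_schwarz[OF pos_b] assms by blast
  also have "\<dots> \<le> (K * n0 u) * (K * n0 v)"
    using assms K1 by (intro mult_mono order_trans[OF b_le_nrm nrm_le] mult_nonneg_nonneg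
        n0_ge_0 pos_form.fnorm_ge_0[OF pos_b]) auto
  finally show ?thesis by (simp add: power2_eq_square mult_ac)
qed

lemma V_subset: "V \<theta> \<subseteq> H" and V_in: "v \<in> V \<theta> \<Longrightarrow> v \<in> H"
  by (auto simp: null_space_def)

lemma W_in: "w \<in> W \<theta> \<Longrightarrow> w \<in> H"
  by (auto simp: null_complement_def)

text \<open>By Cauchy-Schwarz a vector of zero energy lies in the kernel of the whole form. This
  makes the null space linear and lets null components drop out of
  \<open>a \<theta>\<close>.\<close>

lemma a_null:
  assumes "\<theta> \<in> \<Theta>" "v \<in> V \<theta>" "u \<in> H"
  shows "a \<theta> v u = 0" "a \<theta> u v = 0"
proof -
  interpret A: pos_form s H "a \<theta>" using pos_a assms by blast
  have v: "v \<in> H" "form_norm (a \<theta>) v = 0"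
    using assms by (auto simp: null_space_def form_norm_def)
  show "a \<theta> v u = 0" "a \<theta> u v = 0"
    using A.cauchy_schwarz[of v u] A.cauchy_schwarz[of u v] v assms(3) by auto
qed

lemma V_subspace: "\<theta> \<in> \<Theta> \<Longrightarrow> subspace (V \<theta>)"
proof -
  assume \<theta>: "\<theta> \<in> \<Theta>"
  interpret A: pos_form s H "a \<theta>" using pos_a \<theta> by blast
  show ?thesis
    unfolding subspace_def
  proof (intro conjI allI ballI)
    show "0 \<in> V \<theta>" by (simp add: null_space_def A.form_simps)
  next
    fix x y assume xy: "x \<in> V \<theta>" "y \<in> V \<theta>"
    show "x + y \<in> V \<theta>"
      using a_null(1)[OF \<theta> xy(1)] a_null(1)[OF \<theta> xy(2)] V_in[OF xy(1)] V_in[OF xy(2)]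
      by (simp add: null_space_def A.form_add_left H_intros)
  next
    fix c x assume x: "x \<in> V \<theta>"
    show "s c x \<in> V \<theta>"
      using a_null(1)[OF \<theta> x] V_in[OF x] by (simp add: null_space_def A.form_scale_left H_intros)
  qed
qed

lemma V_intros:
  assumes "\<theta> \<in> \<Theta>"
  shows "0 \<in> V \<theta>" "x \<in> V \<theta> \<Longrightarrow> y \<in> V \<theta> \<Longrightarrow> x + y \<in> V \<theta>"
    "x \<in> V \<theta> \<Longrightarrow> y \<in> V \<theta> \<Longrightarrow> x - y \<in> V \<theta>" "x \<in> V \<theta> \<Longrightarrow> s c x \<in> V \<theta>"
  using V_subspace[OF assms] by (auto simp: subspace_0 subspace_add subspace_diff subspace_scale)

lemma W_subspace: "\<theta> \<in> \<Theta> \<Longrightarrow> subspace (W \<theta>)"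
proof -
  assume \<theta>: "\<theta> \<in> \<Theta>"
  interpret N: pos_form s H "norm_form a b \<theta>" using pos_n \<theta> by blast
  show ?thesis
    unfolding subspace_def
  proof (intro conjI allI ballI)
    show "0 \<in> W \<theta>" by (simp add: null_complement_def H_intros N.form_zero_left V_in)
  next
    fix x y assume xy: "x \<in> W \<theta>" "y \<in> W \<theta>"
    then show "x + y \<in> W \<theta>"
      by (simp add: null_complement_def N.form_add_left H_intros V_in)
  next
    fix c x assume x: "x \<in> W \<theta>"
    then show "s c x \<in> W \<theta>"
      by (simp add: null_complement_def N.form_scale_left H_intros V_in)
  qed
qed

lemma Vs_sub: "v \<in> Vs \<Longrightarrow> v \<in> V 0" and Z_sub: "z \<in> Z \<Longrightarrow> z \<in> V 0"
  using V0_sum subspace_0[OF Vs_subspace] subspace_0[OF Z_subspace]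
  unfolding direct_sum_def by force+

lemma E_null: "\<theta> \<in> \<Theta> \<Longrightarrow> v \<in> Vs \<Longrightarrow> E \<theta> v \<in> V \<theta>"
  using E_range[of \<theta>] Vs_sub by (cases "\<theta> = 0") (auto simp: V_star_def)

lemma V_complete:
  assumes \<theta>: "\<theta> \<in> \<Theta>"
  shows "norm_complete (V \<theta>) (norm_form a b \<theta>)"
proof (rule norm_complete_subset[OF n_complete[OF \<theta>] V_subset])
  interpret A: pos_form s H "a \<theta>" using pos_a \<theta> by blast
  interpret N: pos_form s H "norm_form a b \<theta>" using pos_n \<theta> by blast
  fix \<sigma> l assume \<sigma>: "range \<sigma> \<subseteq> V \<theta>" and l: "l \<in> H" "(\<lambda>n. nrm \<theta> (\<sigma> n - l)) \<longlonglongrightarrow> 0"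
  have "form_norm (a \<theta>) l \<le> nrm \<theta> (\<sigma> n - l)" for n
  proof -
    have \<sigma>n: "\<sigma> n \<in> V \<theta>" "\<sigma> n \<in> H" using \<sigma> V_in by auto
    have "form_norm (a \<theta>) l \<le> form_norm (a \<theta>) (\<sigma> n - l) + form_norm (a \<theta>) (\<sigma> n)"
      using A.fnorm_triangle_diff[of "\<sigma> n" "\<sigma> n - l"] \<sigma>n l(1) by (simp add: H_intros)
    moreover have "form_norm (a \<theta>) (\<sigma> n) = 0"
      using \<sigma>n by (simp add: form_norm_def null_space_def)
    ultimately show ?thesis
      using a_le_nrm[OF \<theta>, of "\<sigma> n - l"] \<sigma>n l(1) by (simp add: H_intros)
  qed
  then have "form_norm (a \<theta>) l \<le> 0"
    using l(2) by (intro LIMSEQ_le_const) auto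
  then have "form_norm (a \<theta>) l = 0" using A.fnorm_ge_0[OF l(1)] by simp
  then show "l \<in> V \<theta>" using l(1) by (simp add: null_space_def A.form_self)
qed

lemma W_complete:
  assumes \<theta>: "\<theta> \<in> \<Theta>"
  shows "norm_complete (W \<theta>) (norm_form a b \<theta>)"
proof (rule norm_complete_subset[OF n_complete[OF \<theta>]])
  interpret N: pos_form s H "norm_form a b \<theta>" using pos_n \<theta> by blast
  fix \<sigma> l assume \<sigma>: "range \<sigma> \<subseteq> W \<theta>" and l: "l \<in> H" "(\<lambda>n. nrm \<theta> (\<sigma> n - l)) \<longlonglongrightarrow> 0"
  have "norm_form a b \<theta> l v = 0" if v: "v \<in> V \<theta>" for v
  proof -
    have "cmod (norm_form a b \<theta> l v) \<le> nrm \<theta> (\<sigma> n - l) * nrm \<theta> v" for n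
    proof -
      have \<sigma>n: "\<sigma> n \<in> W \<theta>" "\<sigma> n \<in> H" using \<sigma> W_in by auto
      have "norm_form a b \<theta> (\<sigma> n) v = 0"
        using \<sigma>n v by (simp add: null_complement_def)
      then have "norm_form a b \<theta> (\<sigma> n - l) v = - norm_form a b \<theta> l v"
        using \<sigma>n l(1) V_in[OF v] by (simp add: N.form_simps)
      then show ?thesis
        using N.cauchy_schwarz[of "\<sigma> n - l" v] \<sigma>n l(1) V_in[OF v] by (simp add: H_intros)
    qed
    moreover have "(\<lambda>n. nrm \<theta> (\<sigma> n - l) * nrm \<theta> v) \<longlonglongrightarrow> 0"
      using tendsto_mult_right[OF l(2)] by simp
    ultimately have "cmod (norm_form a b \<theta> l v) \<le> 0"
      by (intro LIMSEQ_le_const) auto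
    then show ?thesis by simp
  qed
  then show "l \<in> W \<theta>" using l(1) by (simp add: null_complement_def)
qed (auto simp: null_complement_def)

text \<open>The projection onto the null space is the Riesz representative there of the product with
  u.\<close>

lemma orthogonal_split:
  assumes \<theta>: "\<theta> \<in> \<Theta>" and u: "u \<in> H"
  obtains p w where "p \<in> V \<theta>" "w \<in> W \<theta>" "u = p + w"
    "nrm \<theta> p \<le> nrm \<theta> u" "nrm \<theta> w \<le> nrm \<theta> u"
proof -
  interpret N: pos_form s H "norm_form a b \<theta>" using pos_n \<theta> by blast
  interpret NV: pos_form s "V \<theta>" "norm_form a b \<theta>"
    using N.subform V_subspace[OF \<theta>] V_subset by blast
  obtain p where p: "p \<in> V \<theta>" "\<And>v. v \<in> V \<theta> \<Longrightarrow> norm_form a b \<theta> p v = norm_form a b \<theta> u v"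
    using NV.riesz[OF V_complete[OF \<theta>], of "norm_form a b \<theta> u" "nrm \<theta> u"] u
      N.cauchy_schwarz[OF u] by (auto simp: N.form_simps V_in)
  define w where "w = u - p"
  have wH: "w \<in> H" using u V_in[OF p(1)] by (simp add: w_def H_intros)
  have w: "w \<in> W \<theta>"
    using wH u V_in[OF p(1)] p by (auto simp: null_complement_def w_def N.form_simps V_in)
  have wp: "norm_form a b \<theta> w p = 0" using w p(1) by (simp add: null_complement_def)
  have "u = p + w" by (simp add: w_def)
  then have "Re (norm_form a b \<theta> u u) = Re (norm_form a b \<theta> p p) + Re (norm_form a b \<theta> w w)"
    using wp N.form_hermitian[of w p] wH V_in[OF p(1)] by (simp add: N.form_simps)
  then have "nrm \<theta> p \<le> nrm \<theta> u" "nrm \<theta> w \<le> nrm \<theta> u"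
    using N.form_self_ge_0[OF wH] N.form_self_ge_0[OF V_in[OF p(1)]] by (simp_all add: form_norm_def)
  then show thesis using that[OF p(1) w \<open>u = p + w\<close>] by blast
qed

end

section \<open>Correctors and the homogenised form\<close>

context two_scale begin

abbreviation N :: "real^'n \<Rightarrow> 'h \<Rightarrow> 'h" where "N \<equiv> corrector H a b a'"
abbreviation ah :: "real^'n \<Rightarrow> 'h \<Rightarrow> 'h \<Rightarrow> complex" where "ah \<equiv> a_hom H a b a' a''"

lemma W0_in: "w \<in> W 0 \<Longrightarrow> w \<in> H"
  by (rule W_in)

lemma to_sphere:
  assumes "\<theta> \<noteq> 0"
  shows "norm ((r / norm \<theta>) *\<^sub>R \<theta>) = r" "(r / norm \<theta>) *\<^sub>R \<theta> \<in> \<Theta>"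
proof -
  show "norm ((r / norm \<theta>) *\<^sub>R \<theta>) = r" using assms r_pos by simp
  then show "(r / norm \<theta>) *\<^sub>R \<theta> \<in> \<Theta>" using ball_\<Theta> by simp
qed

lemma small_in_\<Theta>: "0 < t \<Longrightarrow> t \<le> r / (norm \<theta> + 1) \<Longrightarrow> t *\<^sub>R \<theta> \<in> \<Theta>"
proof (rule ball_\<Theta>)
  assume t: "0 < t" "t \<le> r / (norm \<theta> + 1)"
  have "t * (norm \<theta> + 1) \<le> r"
    using t(2) by (subst (asm) pos_le_divide_eq) (auto intro: add_nonneg_pos)
  then show "norm (t *\<^sub>R \<theta>) \<le> r" using t(1) by (simp add: distrib_left)
qed

text \<open>By linearity in \<theta> it suffices to compare at radius \<open>r\<close>. There
  \<open>a \<theta> v u\<close> is controlled by the Lipschitz bound, because \<open>a 0 v u\<close>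
  vanishes.\<close>

lemma cdot_a'_bound:
  assumes v: "v \<in> V 0" and u: "u \<in> H"
  shows "cmod (cdot (a' v u) \<theta>) \<le> (L + Ka * r) * norm \<theta> * n0 v * n0 u"
proof (cases "\<theta> = 0")
  case False
  define t where "t = r / norm \<theta>"
  have t: "t > 0" "norm (t *\<^sub>R \<theta>) = r" "t *\<^sub>R \<theta> \<in> \<Theta>"
    using to_sphere[OF False] r_pos False by (simp_all add: t_def)
  have tn: "t * norm \<theta> = r" using False by (simp add: t_def)
  have "cmod (a (t *\<^sub>R \<theta>) v u) \<le> L * r * n0 v * n0 u"
    using a_lip[OF t(3) V_in[OF v] u] a_null[OF zero_in_\<Theta> v u] t(2) by simp
  moreover have "cmod (a (t *\<^sub>R \<theta>) v u - cdot (a' v u) (t *\<^sub>R \<theta>)) \<le> Ka * r\<^sup>2 * n0 v * n0 u"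
    using a'_reg[OF v u t(3)] t(2) by simp
  ultimately have "cmod (cdot (a' v u) (t *\<^sub>R \<theta>)) \<le> L * r * n0 v * n0 u + Ka * r\<^sup>2 * n0 v * n0 u"
    using norm_triangle_ineq4[of "a (t *\<^sub>R \<theta>) v u" "a (t *\<^sub>R \<theta>) v u - cdot (a' v u) (t *\<^sub>R \<theta>)"]
    by simp
  also have "\<dots> = t * ((L + Ka * r) * norm \<theta> * n0 v * n0 u)"
    unfolding tn[symmetric] by (simp add: power2_eq_square algebra_simps)
  finally show ?thesis using t(1) by (simp add: cdot_scale norm_mult)
qed (simp add: cdot_def)

text \<open>On the null space at 0 the form \<open>a \<theta>\<close> is of second order by the
  expansion with \<open>a''\<close>, so the coefficient of first order must vanish.\<close>

lemma cdot_a'_null: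
  assumes v: "v \<in> V 0" and u: "u \<in> V 0"
  shows "cdot (a' v u) \<theta> = 0"
proof -
  define nn where "nn = n0 v * n0 u"
  \<comment> \<open>One power of t in the cubic term is replaced by its upper bound, so that all
    terms carry t^2; dividing by t leaves C t.\<close>
  define C where "C = cmod (qdot (a'' v u) \<theta>) + Ka2 * norm \<theta> ^ 3 * (r / (norm \<theta> + 1)) * nn
    + Ka * (norm \<theta>)\<^sup>2 * nn"
  have nn: "0 \<le> nn" using n0_ge_0 V_in v u by (simp add: nn_def)
  have "cmod (cdot (a' v u) \<theta>) \<le> C * t" if t: "0 < t" "t \<le> r / (norm \<theta> + 1)" for t
  proof -
    have \<Theta>: "t *\<^sub>R \<theta> \<in> \<Theta>" using small_in_\<Theta>[OF t] .
    have "cmod (a (t *\<^sub>R \<theta>) v u - cdot (a' v u) (t *\<^sub>R \<theta>)) \<le> t\<^sup>2 * (Ka * (norm \<theta>)\<^sup>2 * nn)"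
      using a'_reg[OF v V_in[OF u] \<Theta>] t by (simp add: nn_def power_mult_distrib mult_ac)
    moreover have "cmod (a (t *\<^sub>R \<theta>) v u - qdot (a'' v u) (t *\<^sub>R \<theta>)) \<le> t ^ 3 * (Ka2 * norm \<theta> ^ 3 * nn)"
      using a''_reg[OF v u \<Theta>] t by (simp add: nn_def power_mult_distrib mult_ac)
    moreover have "t ^ 3 * (Ka2 * norm \<theta> ^ 3 * nn) \<le> t\<^sup>2 * (r / (norm \<theta> + 1)) * (Ka2 * norm \<theta> ^ 3 * nn)"
      using mult_left_mono[OF t(2), of "t\<^sup>2"] Ka20 nn
      by (intro mult_right_mono) (auto simp: power2_eq_square power3_eq_cube)
    moreover have "cmod (qdot (a'' v u) (t *\<^sub>R \<theta>)) = t\<^sup>2 * cmod (qdot (a'' v u) \<theta>)"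
      by (simp add: qdot_scale norm_mult norm_power)
    moreover have "cmod (cdot (a' v u) (t *\<^sub>R \<theta>)) = t * cmod (cdot (a' v u) \<theta>)"
      using t by (simp add: cdot_scale norm_mult)
    moreover have "cmod (cdot (a' v u) (t *\<^sub>R \<theta>)) \<le> cmod (a (t *\<^sub>R \<theta>) v u - cdot (a' v u) (t *\<^sub>R \<theta>))
        + cmod (a (t *\<^sub>R \<theta>) v u - qdot (a'' v u) (t *\<^sub>R \<theta>)) + cmod (qdot (a'' v u) (t *\<^sub>R \<theta>))"
      using norm_triangle_ineq4[of "a (t *\<^sub>R \<theta>) v u" "a (t *\<^sub>R \<theta>) v u - cdot (a' v u) (t *\<^sub>R \<theta>)"]
        norm_triangle_ineq[of "a (t *\<^sub>R \<theta>) v u - qdot (a'' v u) (t *\<^sub>R \<theta>)" "qdot (a'' v u) (t *\<^sub>R \<theta>)"]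
      by simp
    ultimately have "t * cmod (cdot (a' v u) \<theta>) \<le> t * (C * t)"
      by (simp add: C_def power2_eq_square algebra_simps)
    then show ?thesis using t(1) by simp
  qed
  then have "cmod (cdot (a' v u) \<theta>) \<le> 0"
    using r_pos by (intro small_scale_zero[of "r / (norm \<theta> + 1)"]) (auto intro!: divide_pos_pos add_nonneg_pos)
  then show ?thesis by simp
qed

text \<open>Again a comparison at radius \<open>r\<close>, now with quadratic homogeneity, which is
  the origin of K^2 / r^2.\<close>

lemma qdot_a''_bound:
  assumes v: "v \<in> V 0" and u: "u \<in> V 0"
  shows "cmod (qdot (a'' v u) \<theta>) \<le> (K\<^sup>2 / r\<^sup>2 + Ka2 * r) * (norm \<theta>)\<^sup>2 * n0 v * n0 u"
proof (cases "\<theta> = 0")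
  case False
  define t where "t = r / norm \<theta>"
  have t: "t > 0" "norm (t *\<^sub>R \<theta>) = r" "t *\<^sub>R \<theta> \<in> \<Theta>"
    using to_sphere[OF False] r_pos False by (simp_all add: t_def)
  have tn: "r = t * norm \<theta>" using False by (simp add: t_def)
  have "cmod (a (t *\<^sub>R \<theta>) v u) \<le> K\<^sup>2 * n0 v * n0 u"
    using a_bound[OF t(3) V_in[OF v] V_in[OF u]] .
  moreover have "cmod (a (t *\<^sub>R \<theta>) v u - qdot (a'' v u) (t *\<^sub>R \<theta>)) \<le> Ka2 * r ^ 3 * n0 v * n0 u"
    using a''_reg[OF v u t(3)] t(2) by simp
  ultimately have "cmod (qdot (a'' v u) (t *\<^sub>R \<theta>)) \<le> K\<^sup>2 * n0 v * n0 u + Ka2 * r ^ 3 * n0 v * n0 u"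
    using norm_triangle_ineq4[of "a (t *\<^sub>R \<theta>) v u" "a (t *\<^sub>R \<theta>) v u - qdot (a'' v u) (t *\<^sub>R \<theta>)"]
    by simp
  also have "\<dots> = (K\<^sup>2 / r\<^sup>2 + Ka2 * r) * n0 v * n0 u * r\<^sup>2"
    using r_pos by (simp add: power2_eq_square power3_eq_cube field_simps)
  also have "\<dots> = t\<^sup>2 * ((K\<^sup>2 / r\<^sup>2 + Ka2 * r) * (norm \<theta>)\<^sup>2 * n0 v * n0 u)"
    by (subst (3) tn) (simp add: power_mult_distrib mult_ac)
  finally show ?thesis using t(1) by (simp add: qdot_scale norm_mult norm_power)
qed (simp add: qdot_sum)

lemma a_quadratic:
  "\<exists>C\<ge>0. \<forall>\<theta>\<in>\<Theta>. \<forall>v\<in>V 0. \<forall>u\<in>V 0. cmod (a \<theta> v u) \<le> C * (norm \<theta>)\<^sup>2 * n0 v * n0 u"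
proof (intro exI[of _ "K\<^sup>2 / r\<^sup>2 + Ka2 * r + Ka2 * R"] conjI ballI)
  show "0 \<le> K\<^sup>2 / r\<^sup>2 + Ka2 * r + Ka2 * R"
    using Ka20 r_pos bound_\<Theta>[OF zero_in_\<Theta>] by simp
  fix \<theta> v u assume *: "\<theta> \<in> \<Theta>" "v \<in> V 0" "u \<in> V 0"
  have nn: "0 \<le> n0 v * n0 u" using * n0_ge_0 V_in by (metis mult_nonneg_nonneg)
  have "cmod (a \<theta> v u) \<le> cmod (a \<theta> v u - qdot (a'' v u) \<theta>) + cmod (qdot (a'' v u) \<theta>)"
    using norm_triangle_ineq[of "a \<theta> v u - qdot (a'' v u) \<theta>" "qdot (a'' v u) \<theta>"] by simp
  also have "cmod (a \<theta> v u - qdot (a'' v u) \<theta>) \<le> Ka2 * (norm \<theta>) ^ 3 * (n0 v * n0 u)"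
    using a''_reg[OF *(2,3,1)] by (simp add: mult_ac)
  also have "\<dots> \<le> Ka2 * (R * (norm \<theta>)\<^sup>2) * (n0 v * n0 u)"
    using mult_right_mono[OF bound_\<Theta>[OF *(1)], of "(norm \<theta>)\<^sup>2"] Ka20 nn
    by (intro mult_right_mono mult_left_mono) (auto simp: power2_eq_square power3_eq_cube)
  finally show "cmod (a \<theta> v u) \<le> (K\<^sup>2 / r\<^sup>2 + Ka2 * r + Ka2 * R) * (norm \<theta>)\<^sup>2 * n0 v * n0 u"
    using qdot_a''_bound[OF *(2,3), of \<theta>] by (simp add: algebra_simps)
qed

lemma W0_zero:
  assumes "w \<in> W 0" "a 0 w w = 0"
  shows "w = 0"
proof -
  interpret N0: pos_form s H "norm_form a b 0" using pos_n zero_in_\<Theta> by blast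
  have "\<nu> * (n0 w)\<^sup>2 \<le> 0" using gap[OF assms(1)] assms(2) by simp
  then have "n0 w = 0" using \<nu>_pos by (simp add: mult_le_0_iff)
  then show ?thesis
    using n_definite[OF zero_in_\<Theta> W_in[OF assms(1)]] N0.form_self[OF W_in[OF assms(1)]] by simp
qed

text \<open>The gap makes \<open>a 0\<close> definite on \<open>W 0\<close>, so the description in
  \<open>corrector\<close> has at most one candidate. Additivity and homogeneity of \<open>N\<close>
  follow by exhibiting a solution.\<close>

lemma corrector_unique:
  assumes "w \<in> W 0" "\<And>w'. w' \<in> W 0 \<Longrightarrow> a 0 w w' = - cdot (a' v w') \<theta>"
  shows "N \<theta> v = w"
  unfolding corrector_def
proof (rule the_equality)
  interpret A: pos_form s H "a 0" using pos_a zero_in_\<Theta> by blast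
  fix x assume x: "x \<in> W 0 \<and> (\<forall>w'\<in>W 0. a 0 x w' = - cdot (a' v w') \<theta>)"
  have "x - w \<in> W 0" using x assms(1) W_subspace[OF zero_in_\<Theta>] subspace_diff by blast
  moreover from this have "a 0 (x - w) (x - w) = 0"
    using x assms W0_in by (simp add: A.form_diff_left)
  ultimately show "x = w" using W0_zero by force
qed (use assms in blast)

text \<open>By the gap, \<open>a 0\<close> is an inner product on \<open>W 0\<close> whose norm is
  equivalent to \<open>n0\<close>; the Riesz lemma in this inner product gives the solution.\<close>

lemma corrector:
  assumes v: "v \<in> V 0"
  shows "N \<theta> v \<in> W 0" "w \<in> W 0 \<Longrightarrow> a 0 (N \<theta> v) w = - cdot (a' v w) \<theta>"
proof -
  interpret A: pos_form s H "a 0" using pos_a zero_in_\<Theta> by blast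
  interpret AW: pos_form s "W 0" "a 0"
    using A.subform W_subspace[OF zero_in_\<Theta>] W_in by blast
  have lo: "n0 w \<le> (1 / sqrt \<nu>) * form_norm (a 0) w" if w: "w \<in> W 0" for w
  proof -
    have "sqrt (\<nu> * (n0 w)\<^sup>2) \<le> form_norm (a 0) w"
      unfolding form_norm_def[of "a 0"] using gap[OF w] by (rule real_sqrt_le_mono)
    then show ?thesis
      using \<nu>_pos n0_ge_0[OF W_in[OF w]] by (simp add: real_sqrt_mult field_simps)
  qed
  have compl: "norm_complete (W 0) (a 0)"
  proof (rule norm_complete_equivalent[OF W_complete[OF zero_in_\<Theta>] lo _ AW.pos_form_axioms])
    show "form_norm (a 0) u \<le> 1 * n0 u" if "u \<in> W 0" for u
      using a_le_nrm[OF zero_in_\<Theta> W_in[OF that]] by simp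
  qed
  have ses: "sesquilinear_on s (V 0) H (\<lambda>v u. cdot (a' v u) \<theta>)"
    by (rule sesquilinear_cdot) (rule a'_form)
  have bd: "cmod (- cdot (a' v w) \<theta>) \<le> ((L + Ka * r) * norm \<theta> * n0 v * (1 / sqrt \<nu>)) * form_norm (a 0) w"
    if w: "w \<in> W 0" for w
  proof -
    have "cmod (- cdot (a' v w) \<theta>) \<le> (L + Ka * r) * norm \<theta> * n0 v * n0 w"
      using cdot_a'_bound[OF v W_in[OF w], of \<theta>] by simp
    also have "\<dots> \<le> (L + Ka * r) * norm \<theta> * n0 v * ((1 / sqrt \<nu>) * form_norm (a 0) w)"
      using L0 Ka0 r_pos n0_ge_0[OF V_in[OF v]] by (intro mult_left_mono lo w) auto
    finally show ?thesis by (simp add: mult_ac)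
  qed
  have "\<exists>u\<in>W 0. \<forall>w\<in>W 0. a 0 u w = - cdot (a' v w) \<theta>"
    by (rule AW.riesz[OF compl _ _ bd])
       (use ses v in \<open>auto simp: sesquilinear_on_def W_in\<close>)
  then obtain u where u: "u \<in> W 0" "\<And>w. w \<in> W 0 \<Longrightarrow> a 0 u w = - cdot (a' v w) \<theta>" by blast
  then have "N \<theta> v = u" by (rule corrector_unique)
  then show "N \<theta> v \<in> W 0" "w \<in> W 0 \<Longrightarrow> a 0 (N \<theta> v) w = - cdot (a' v w) \<theta>" using u by auto
qed

lemma corrector_in: "v \<in> V 0 \<Longrightarrow> N \<theta> v \<in> H"
  using corrector(1) W_in by blast

text \<open>The corrector equation extends from \<open>W 0\<close> to \<open>H\<close>, since both sides vanish on \<open>V 0\<close>.\<close>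

lemma corrector_eq:
  assumes v: "v \<in> V 0" and u: "u \<in> H"
  shows "a 0 (N \<theta> v) u = - cdot (a' v u) \<theta>"
proof -
  interpret A: pos_form s H "a 0" using pos_a zero_in_\<Theta> by blast
  obtain p w where pw: "p \<in> V 0" "w \<in> W 0" "u = p + w"
    using orthogonal_split[OF zero_in_\<Theta> u] by metis
  have ses: "sesquilinear_on s (V 0) H (\<lambda>v u. cdot (a' v u) \<theta>)"
    by (rule sesquilinear_cdot) (rule a'_form)
  then have "cdot (a' v u) \<theta> = cdot (a' v p) \<theta> + cdot (a' v w) \<theta>"
    using v V_in[OF pw(1)] W_in[OF pw(2)] by (simp add: pw(3) sesquilinear_on_def)
  then show ?thesis
    using corrector[OF v] cdot_a'_null[OF v pw(1)] a_null(2)[OF zero_in_\<Theta> pw(1)] pw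
      corrector_in[OF v] V_in[OF pw(1)] W_in[OF pw(2)]
    by (simp add: A.form_add_right)
qed

lemma corrector_add:
  assumes "v \<in> V 0" "u \<in> V 0"
  shows "N \<theta> (v + u) = N \<theta> v + N \<theta> u"
proof (rule corrector_unique)
  interpret A: pos_form s H "a 0" using pos_a zero_in_\<Theta> by blast
  have ses: "sesquilinear_on s (V 0) H (\<lambda>v u. cdot (a' v u) \<theta>)"
    by (rule sesquilinear_cdot) (rule a'_form)
  show "N \<theta> v + N \<theta> u \<in> W 0"
    using assms corrector(1) W_subspace[OF zero_in_\<Theta>] subspace_add by blast
  show "a 0 (N \<theta> v + N \<theta> u) w = - cdot (a' (v + u) w) \<theta>" if "w \<in> W 0" for w
    using assms corrector that ses W0_in by (simp add: A.form_add_left sesquilinear_on_def)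
qed

lemma corrector_scale:
  assumes "v \<in> V 0"
  shows "N \<theta> (s c v) = s c (N \<theta> v)"
proof (rule corrector_unique)
  interpret A: pos_form s H "a 0" using pos_a zero_in_\<Theta> by blast
  have ses: "sesquilinear_on s (V 0) H (\<lambda>v u. cdot (a' v u) \<theta>)"
    by (rule sesquilinear_cdot) (rule a'_form)
  show "s c (N \<theta> v) \<in> W 0"
    using assms corrector(1) W_subspace[OF zero_in_\<Theta>] subspace_scale by blast
  show "a 0 (s c (N \<theta> v)) w = - cdot (a' (s c v) w) \<theta>" if "w \<in> W 0" for w
    using assms corrector that ses W0_in by (simp add: A.form_scale_left sesquilinear_on_def)
qed

lemma corrector_homogeneous:
  assumes "v \<in> V 0"
  shows "N (t *\<^sub>R \<theta>) v = s (of_real t) (N \<theta> v)"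
proof (rule corrector_unique)
  interpret A: pos_form s H "a 0" using pos_a zero_in_\<Theta> by blast
  show "s (of_real t) (N \<theta> v) \<in> W 0"
    using assms corrector(1) W_subspace[OF zero_in_\<Theta>] subspace_scale by blast
  show "a 0 (s (of_real t) (N \<theta> v)) w = - cdot (a' v w) (t *\<^sub>R \<theta>)" if "w \<in> W 0" for w
    using assms corrector that W0_in by (simp add: A.form_scale_left cdot_scale)
qed

text \<open>The corrector equation is tested with the corrector itself; the gap supplies the
  denominator \<nu>.\<close>

lemma corrector_bound: "\<exists>C\<ge>0. \<forall>\<theta>. \<forall>v\<in>V 0. n0 (N \<theta> v) \<le> C * norm \<theta> * n0 v"
proof (intro exI[of _ "(L + Ka * r) / \<nu>"] conjI allI ballI)
  show "0 \<le> (L + Ka * r) / \<nu>" using L0 Ka0 r_pos \<nu>_pos by simp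
  fix \<theta> v assume v: "v \<in> V 0"
  have w: "N \<theta> v \<in> W 0" "N \<theta> v \<in> H" using corrector(1)[OF v] corrector_in[OF v] by auto
  have "\<nu> * (n0 (N \<theta> v))\<^sup>2 \<le> cmod (a 0 (N \<theta> v) (N \<theta> v))"
    using gap[OF w(1)] complex_Re_le_cmod order_trans by blast
  also have "\<dots> \<le> ((L + Ka * r) * norm \<theta> * n0 v) * n0 (N \<theta> v)"
    using corrector_eq[OF v w(2)] cdot_a'_bound[OF v w(2)] by simp
  finally have "\<nu> * n0 (N \<theta> v) \<le> (L + Ka * r) * norm \<theta> * n0 v"
    by (rule mult_square_le_cancel)
       (use L0 Ka0 r_pos n0_ge_0[OF V_in[OF v]] n0_ge_0[OF w(2)] in auto)
  then show "n0 (N \<theta> v) \<le> (L + Ka * r) / \<nu> * norm \<theta> * n0 v"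
    using \<nu>_pos by (simp add: field_simps)
qed

text \<open>The corrector cancels the part linear in \<theta>, even against arbitrary test vectors.
  What is left is the error of the expansion and the Lipschitz error times the size |\<theta>| of
  the corrector.\<close>

lemma a_corrected:
  "\<exists>C\<ge>0. \<forall>\<theta>\<in>\<Theta>. \<forall>v\<in>V 0. \<forall>u\<in>H. cmod (a \<theta> (v + N \<theta> v) u) \<le> C * (norm \<theta>)\<^sup>2 * n0 v * n0 u"
proof -
  obtain C where C: "C \<ge> 0" "\<And>\<theta> v. v \<in> V 0 \<Longrightarrow> n0 (N \<theta> v) \<le> C * norm \<theta> * n0 v"
    using corrector_bound by blast
  have "cmod (a \<theta> (v + N \<theta> v) u) \<le> (Ka + L * C) * (norm \<theta>)\<^sup>2 * n0 v * n0 u"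
    if *: "\<theta> \<in> \<Theta>" "v \<in> V 0" "u \<in> H" for \<theta> v u
  proof -
    interpret A: pos_form s H "a \<theta>" using pos_a * by blast
    have "a \<theta> (v + N \<theta> v) u = (a \<theta> v u - cdot (a' v u) \<theta>) + (a \<theta> (N \<theta> v) u - a 0 (N \<theta> v) u)"
      using * V_in corrector_in by (simp add: A.form_add_left corrector_eq)
    then have "cmod (a \<theta> (v + N \<theta> v) u)
        \<le> cmod (a \<theta> v u - cdot (a' v u) \<theta>) + cmod (a \<theta> (N \<theta> v) u - a 0 (N \<theta> v) u)"
      by (simp only: norm_triangle_ineq)
    also have "\<dots> \<le> Ka * (norm \<theta>)\<^sup>2 * n0 v * n0 u + L * norm \<theta> * n0 (N \<theta> v) * n0 u"
      using a'_reg[OF *(2,3,1)] a_lip[OF *(1) corrector_in[OF *(2)] *(3)] by (rule add_mono)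
    also have "L * norm \<theta> * n0 (N \<theta> v) * n0 u \<le> L * norm \<theta> * (C * norm \<theta> * n0 v) * n0 u"
      using C(2)[OF *(2)] L0 n0_ge_0[OF *(3)] by (intro mult_right_mono mult_left_mono) auto
    finally show ?thesis by (simp add: algebra_simps power2_eq_square)
  qed
  then show ?thesis using C(1) Ka0 L0 by (intro exI[of _ "Ka + L * C"]) auto
qed

lemma ah_eq: "ah \<theta> v u = qdot (a'' v u) \<theta> - a 0 (N \<theta> v) (N \<theta> u)"
  by (simp add: a_hom_def qdot_def)

text \<open>Against null vectors the quadratic part is identified as well. The corrector equation
  for u rewrites \<open>a 0 (N \<theta> v) (N \<theta> u)\<close> as a first-order coefficient at
  \<open>N \<theta> v\<close>; comparing it with \<open>a \<theta> u (N \<theta> v)\<close> costs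
  |\<theta>|^2 times the corrector, so the error is cubic.\<close>

lemma a_corrected_hom:
  "\<exists>C\<ge>0. \<forall>\<theta>\<in>\<Theta>. \<forall>v\<in>V 0. \<forall>u\<in>V 0.
    cmod (a \<theta> (v + N \<theta> v) u - ah \<theta> v u) \<le> C * norm \<theta> ^ 3 * n0 v * n0 u"
proof -
  obtain C where C: "C \<ge> 0" "\<And>\<theta> v. v \<in> V 0 \<Longrightarrow> n0 (N \<theta> v) \<le> C * norm \<theta> * n0 v"
    using corrector_bound by blast
  have "cmod (a \<theta> (v + N \<theta> v) u - ah \<theta> v u) \<le> (Ka2 + Ka * C) * norm \<theta> ^ 3 * n0 v * n0 u"
    if *: "\<theta> \<in> \<Theta>" "v \<in> V 0" "u \<in> V 0" for \<theta> v u
  proof -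
    interpret A: pos_form s H "a \<theta>" using pos_a * by blast
    interpret A0: pos_form s H "a 0" using pos_a zero_in_\<Theta> by blast
    have in_H: "v \<in> H" "u \<in> H" "N \<theta> v \<in> H" "N \<theta> u \<in> H" using * V_in corrector_in by auto
    have "a 0 (N \<theta> v) (N \<theta> u) = - cnj (cdot (a' u (N \<theta> v)) \<theta>)"
      using A0.form_hermitian[of "N \<theta> u" "N \<theta> v"] corrector_eq[OF *(3) in_H(3)] in_H by simp
    then have "a \<theta> (v + N \<theta> v) u - ah \<theta> v u
      = (a \<theta> v u - qdot (a'' v u) \<theta>) + cnj (a \<theta> u (N \<theta> v) - cdot (a' u (N \<theta> v)) \<theta>)"
      using in_H A.form_hermitian[of u "N \<theta> v"] by (simp add: A.form_add_left ah_eq)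
    then have "cmod (a \<theta> (v + N \<theta> v) u - ah \<theta> v u)
        \<le> cmod (a \<theta> v u - qdot (a'' v u) \<theta>) + cmod (a \<theta> u (N \<theta> v) - cdot (a' u (N \<theta> v)) \<theta>)"
      using norm_triangle_ineq complex_mod_cnj by metis
    also have "\<dots> \<le> Ka2 * norm \<theta> ^ 3 * n0 v * n0 u + Ka * (norm \<theta>)\<^sup>2 * n0 u * n0 (N \<theta> v)"
      using a''_reg[OF *(2,3,1)] a'_reg[OF *(3) in_H(3) *(1)] by (rule add_mono)
    also have "Ka * (norm \<theta>)\<^sup>2 * n0 u * n0 (N \<theta> v) \<le> Ka * (norm \<theta>)\<^sup>2 * n0 u * (C * norm \<theta> * n0 v)"
      using C(2)[OF *(2)] Ka0 n0_ge_0[OF in_H(2)] by (intro mult_left_mono) auto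
    finally show ?thesis by (simp add: algebra_simps power2_eq_square power3_eq_cube)
  qed
  then show ?thesis using C(1) Ka0 Ka20 by (intro exI[of _ "Ka2 + Ka * C"]) auto
qed

text \<open>Leading coefficients inherit the symmetry of \<open>a\<close> along the ray t \<theta>:
  the defect is quadratic in t but bounded by t^3.\<close>

lemma qdot_a''_hermitian:
  assumes v: "v \<in> V 0" and u: "u \<in> V 0"
  shows "qdot (a'' u v) \<theta> = cnj (qdot (a'' v u) \<theta>)"
proof -
  define x where "x = qdot (a'' u v) \<theta> - cnj (qdot (a'' v u) \<theta>)"
  have "cmod x \<le> (2 * Ka2 * norm \<theta> ^ 3 * n0 v * n0 u) * t" if t: "0 < t" "t \<le> r / (norm \<theta> + 1)" for t
  proof -
    define \<eta> where "\<eta> = t *\<^sub>R \<theta>"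
    have \<Theta>: "\<eta> \<in> \<Theta>" using small_in_\<Theta>[OF t] by (simp add: \<eta>_def)
    interpret A: pos_form s H "a \<eta>" using pos_a \<Theta> by blast
    have "of_real (t\<^sup>2) * x = cnj (a \<eta> v u - qdot (a'' v u) \<eta>) - (a \<eta> u v - qdot (a'' u v) \<eta>)"
      using A.form_hermitian[OF V_in[OF v] V_in[OF u]]
      by (simp add: x_def \<eta>_def qdot_scale algebra_simps)
    then have "cmod (of_real (t\<^sup>2) * x) \<le> cmod (a \<eta> v u - qdot (a'' v u) \<eta>) + cmod (a \<eta> u v - qdot (a'' u v) \<eta>)"
      using norm_triangle_ineq4 complex_mod_cnj by metis
    also have "\<dots> \<le> 2 * Ka2 * norm \<eta> ^ 3 * n0 v * n0 u"
      using a''_reg[OF v u \<Theta>] a''_reg[OF u v \<Theta>] by (simp add: mult_ac)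
    finally have "t\<^sup>2 * cmod x \<le> t\<^sup>2 * ((2 * Ka2 * norm \<theta> ^ 3 * n0 v * n0 u) * t)"
      using t by (simp add: \<eta>_def norm_mult norm_power power_mult_distrib power2_eq_square power3_eq_cube mult_ac)
    then show ?thesis using t(1) by simp
  qed
  then have "cmod x \<le> 0"
    using r_pos by (intro small_scale_zero[of "r / (norm \<theta> + 1)"]) (auto intro!: divide_pos_pos add_nonneg_pos)
  then show ?thesis by (simp add: x_def)
qed

lemma ah_hermitian:
  assumes "v \<in> V 0" "u \<in> V 0"
  shows "ah \<theta> u v = cnj (ah \<theta> v u)"
proof -
  interpret A0: pos_form s H "a 0" using pos_a zero_in_\<Theta> by blast
  show ?thesis
    using qdot_a''_hermitian[OF assms] A0.form_hermitian[of "N \<theta> v" "N \<theta> u"] assms corrector_in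
    by (simp add: ah_eq)
qed

lemma ah_sesquilinear: "sesquilinear_on s (V 0) (V 0) (ah \<theta>)"
proof -
  interpret A0: pos_form s H "a 0" using pos_a zero_in_\<Theta> by blast
  have "sesquilinear_on s (V 0) (V 0) (\<lambda>v u. qdot (a'' v u) \<theta>)"
    by (rule sesquilinear_qdot) (rule a''_form)
  then show ?thesis
    unfolding sesquilinear_on_def ah_eq
    by (simp add: corrector_add corrector_scale A0.form_add_left A0.form_add_right
        A0.form_scale_left A0.form_scale_right corrector_in algebra_simps)
qed

lemma ah_homogeneous:
  assumes "v \<in> V 0" "u \<in> V 0"
  shows "ah (t *\<^sub>R \<theta>) v u = of_real (t\<^sup>2) * ah \<theta> v u"
proof -
  interpret A0: pos_form s H "a 0" using pos_a zero_in_\<Theta> by blast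
  show ?thesis
    using assms corrector_in
    by (simp add: ah_eq corrector_homogeneous qdot_scale A0.form_simps H_intros power2_eq_square algebra_simps)
qed

lemma ah_bound:
  "\<exists>C\<ge>0. \<forall>\<theta>. \<forall>v\<in>V 0. \<forall>u\<in>V 0. cmod (ah \<theta> v u) \<le> C * (norm \<theta>)\<^sup>2 * n0 v * n0 u"
proof -
  obtain C where C: "C \<ge> 0" "\<And>\<theta> v. v \<in> V 0 \<Longrightarrow> n0 (N \<theta> v) \<le> C * norm \<theta> * n0 v"
    using corrector_bound by blast
  define C' where "C' = K\<^sup>2 / r\<^sup>2 + Ka2 * r + K\<^sup>2 * C\<^sup>2"
  have "cmod (ah \<theta> v u) \<le> C' * (norm \<theta>)\<^sup>2 * n0 v * n0 u"
    if *: "v \<in> V 0" "u \<in> V 0" for \<theta> v u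
  proof -
    have "cmod (ah \<theta> v u) \<le> cmod (qdot (a'' v u) \<theta>) + cmod (a 0 (N \<theta> v) (N \<theta> u))"
      unfolding ah_eq by (rule norm_triangle_ineq4)
    also have "cmod (a 0 (N \<theta> v) (N \<theta> u)) \<le> K\<^sup>2 * (n0 (N \<theta> v) * n0 (N \<theta> u))"
      using a_bound[OF zero_in_\<Theta>] corrector_in * by (simp add: mult.assoc)
    also have "\<dots> \<le> K\<^sup>2 * ((C * norm \<theta> * n0 v) * (C * norm \<theta> * n0 u))"
      using C * n0_ge_0 corrector_in V_in by (intro mult_left_mono mult_mono) auto
    finally show ?thesis
      using qdot_a''_bound[OF *, of \<theta>] by (simp add: C'_def algebra_simps power2_eq_square)
  qed
  moreover have "C' \<ge> 0" using C(1) Ka20 r_pos by (simp add: C'_def)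
  ultimately show ?thesis by blast
qed

end

section \<open>Coercivity and decomposition of the energy\<close>

context two_scale begin

lemma Vs_in: "v \<in> Vs \<Longrightarrow> v \<in> H" and Z_in: "z \<in> Z \<Longrightarrow> z \<in> H" and V0_in: "v \<in> V 0 \<Longrightarrow> v \<in> H"
  using Vs_sub Z_sub V_in by blast+

lemma V0_split:
  assumes "u \<in> V 0"
  obtains v z where "v \<in> Vs" "z \<in> Z" "u = v + z"
  using assms V0_sum unfolding direct_sum_def by blast

lemma Z_part_sum:
  assumes "v \<in> Vs" "z \<in> Z"
  shows "Z_part Vs Z (v + z) = z"
  unfolding Z_part_def
proof (rule the_equality)
  fix x assume x: "x \<in> Z \<and> v + z - x \<in> Vs"
  have "v + z - x - v \<in> Vs" using x assms(1) Vs_subspace subspace_diff by blast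
  then have "z - x \<in> Vs" by (simp add: algebra_simps)
  moreover have "z - x \<in> Z" using x assms(2) Z_subspace subspace_diff by blast
  ultimately have "z - x \<in> {0}" using V0_sum unfolding direct_sum_def by blast
  then show "x = z" by simp
qed (use assms in simp)

lemma n0_interp: "pos_form s H (norm_form a b 0)" using pos_n[OF zero_in_\<Theta>] .

text \<open>A strengthened Cauchy-Schwarz inequality: the mixed term takes away at most the fraction
  \<open>KZ\<close> of |v|^2 + |z|^2, hence \<kappa> = 1 / sqrt (1 - KZ).\<close>

lemma angle_bound:
  "\<exists>\<kappa>\<ge>1. \<forall>v\<in>Vs. \<forall>z\<in>Z. n0 v \<le> \<kappa> * n0 (v + z) \<and> n0 z \<le> \<kappa> * n0 (v + z)"
proof -
  interpret N0: pos_form s H "norm_form a b 0" by (rule n0_interp)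
  define \<kappa> where "\<kappa> = 1 / sqrt (1 - KZ)"
  have KZ': "0 < 1 - KZ" "1 - KZ \<le> 1" using KZ by auto
  have "n0 v \<le> \<kappa> * n0 (v + z) \<and> n0 z \<le> \<kappa> * n0 (v + z)" if vz: "v \<in> Vs" "z \<in> Z" for v z
  proof -
    note H = Vs_in[OF vz(1)] Z_in[OF vz(2)]
    have "\<bar>Re (norm_form a b 0 v z)\<bar> \<le> KZ * (n0 v * n0 z)"
      using angle[OF vz] abs_Re_le_cmod[of "norm_form a b 0 v z"] by (simp add: mult.assoc)
    moreover have "KZ * (2 * (n0 v * n0 z)) \<le> KZ * ((n0 v)\<^sup>2 + (n0 z)\<^sup>2)"
      using KZ(1) sum_squares_bound[of "n0 v" "n0 z"] by (intro mult_left_mono) (auto simp: mult_ac)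
    moreover have "(n0 (v + z))\<^sup>2 = (n0 v)\<^sup>2 + (n0 z)\<^sup>2 + 2 * Re (norm_form a b 0 v z)"
      using H N0.form_hermitian[of v z] by (simp add: N0.fnorm_sq N0.form_simps)
    ultimately have *: "(1 - KZ) * ((n0 v)\<^sup>2 + (n0 z)\<^sup>2) \<le> (n0 (v + z))\<^sup>2"
      by (simp add: algebra_simps abs_le_iff)
    have "sqrt (1 - KZ) * x \<le> n0 (v + z)" if "0 \<le> x" "x\<^sup>2 \<le> (n0 v)\<^sup>2 + (n0 z)\<^sup>2" for x
    proof (rule power2_le_imp_le)
      have "(1 - KZ) * x\<^sup>2 \<le> (1 - KZ) * ((n0 v)\<^sup>2 + (n0 z)\<^sup>2)"
        using that KZ' by (intro mult_left_mono) auto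
      moreover have "(sqrt (1 - KZ) * x)\<^sup>2 = (1 - KZ) * x\<^sup>2"
        using KZ' by (simp add: power_mult_distrib)
      ultimately show "(sqrt (1 - KZ) * x)\<^sup>2 \<le> (n0 (v + z))\<^sup>2"
        using * by linarith
    qed (use H in \<open>simp add: n0_ge_0 H_intros\<close>)
    from this[of "n0 v"] this[of "n0 z"] show ?thesis
      using KZ' H by (simp add: \<kappa>_def n0_ge_0 field_simps)
  qed
  moreover have "\<kappa> \<ge> 1" using KZ' by (simp add: \<kappa>_def)
  ultimately show ?thesis by blast
qed

lemma n0_triangle: "u \<in> H \<Longrightarrow> v \<in> H \<Longrightarrow> n0 (u + v) \<le> n0 u + n0 v"
  and n0_triangle_diff: "u \<in> H \<Longrightarrow> v \<in> H \<Longrightarrow> n0 (u - v) \<le> n0 u + n0 v"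
  using pos_form.fnorm_triangle[OF n0_interp] pos_form.fnorm_triangle_diff[OF n0_interp] by auto

text \<open>A corrected \<open>z \<in> Z\<close> stays away from \<open>V \<theta>\<close> by removability of the singularity, so that the
  quadratic degeneracy bounds its energy from below.\<close>

lemma ah_coercive_sphere:
  "\<exists>c>0. \<exists>\<rho>>0. \<forall>\<theta>. norm \<theta> = \<rho> \<longrightarrow> (\<forall>z\<in>Z. c * (n0 z)\<^sup>2 \<le> Re (ah \<theta> z z))"
proof -
  obtain \<kappa> where \<kappa>: "\<kappa> \<ge> 1" "\<And>v z. v \<in> Vs \<Longrightarrow> z \<in> Z \<Longrightarrow> n0 z \<le> \<kappa> * n0 (v + z)"
    using angle_bound by blast
  obtain CN where CN: "CN \<ge> 0" "\<And>\<theta> v. v \<in> V 0 \<Longrightarrow> n0 (N \<theta> v) \<le> CN * norm \<theta> * n0 v"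
    using corrector_bound by blast
  obtain C1 where C1: "C1 \<ge> 0" "\<And>\<theta> v u. \<theta> \<in> \<Theta> \<Longrightarrow> v \<in> V 0 \<Longrightarrow> u \<in> H \<Longrightarrow>
      cmod (a \<theta> (v + N \<theta> v) u) \<le> C1 * (norm \<theta>)\<^sup>2 * n0 v * n0 u"
    using a_corrected by blast
  obtain C2 where C2: "C2 \<ge> 0" "\<And>\<theta> v u. \<theta> \<in> \<Theta> \<Longrightarrow> v \<in> V 0 \<Longrightarrow> u \<in> V 0 \<Longrightarrow>
      cmod (a \<theta> (v + N \<theta> v) u - ah \<theta> v u) \<le> C2 * norm \<theta> ^ 3 * n0 v * n0 u"
    using a_corrected_hom by blast
  have R0: "R \<ge> 0" using bound_\<Theta>[OF zero_in_\<Theta>] by simp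
  \<comment> \<open>\<open>M\<close> collects the errors of relative size |\<theta>|, namely the
    corrector and the distance from V \<theta> to \<open>Vs\<close>; \<open>c0\<close> is the
    constant that the degeneracy yields once they are absorbed.\<close>
  define M where "M = \<kappa> * (CN + Ls * K * (1 + CN * R))"
  have M: "M \<ge> 0" using \<kappa> CN Ls0 K1 R0 by (simp add: M_def)
  define c0 where "c0 = \<gamma> / (2 * \<kappa> * K)\<^sup>2"
  have c0: "c0 > 0" using \<gamma>_pos \<kappa> K1 by (simp add: c0_def)
  define D where "D = C2 + C1 * CN"
  have D: "D \<ge> 0" using C1 C2 CN by (simp add: D_def)
  \<comment> \<open>The radius makes M \<rho> at most 1 / 2 and the cubic error, with constant
    \<open>D\<close>, at most half of the quadratic lower bound.\<close>
  define \<rho> where "\<rho> = min r (min (1 / (2 * M + 1)) (c0 / (2 * D + 1)))"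
  have \<rho>: "\<rho> > 0" using r_pos M D c0 by (simp add: \<rho>_def add_nonneg_pos)
  have \<rho>M: "\<rho> * (2 * M + 1) \<le> 1"
    using M by (subst pos_le_divide_eq[symmetric]) (auto simp: \<rho>_def)
  have \<rho>D: "\<rho> * (2 * D + 1) \<le> c0"
    using D by (subst pos_le_divide_eq[symmetric]) (auto simp: \<rho>_def)
  have "c0 / 2 * \<rho>\<^sup>2 * (n0 z)\<^sup>2 \<le> Re (ah \<theta> z z)" if n\<theta>: "norm \<theta> = \<rho>" and z: "z \<in> Z" for \<theta> z
  proof -
    have "\<rho> \<le> r" by (simp add: \<rho>_def)
    then have \<theta>: "\<theta> \<in> \<Theta>" "\<theta> \<noteq> 0" using n\<theta> \<rho> ball_\<Theta> by auto
    interpret A: pos_form s H "a \<theta>" using pos_a \<theta> by blast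
    have zV: "z \<in> V 0" "z \<in> H" "N \<theta> z \<in> H" using z Z_sub Z_in corrector_in by auto
    define h where "h = z + N \<theta> z"
    have h: "h \<in> H" using zV by (simp add: h_def H_intros)
    have nz: "0 \<le> n0 z" by (rule n0_ge_0[OF zV(2)])
    have nN: "n0 (N \<theta> z) \<le> CN * \<rho> * n0 z" using CN(2)[OF zV(1), of \<theta>] n\<theta> by simp
    have "CN * \<rho> \<le> CN * R" using CN bound_\<Theta>[OF \<theta>(1)] n\<theta> by (intro mult_left_mono) auto
    then have "CN * \<rho> * n0 z \<le> CN * R * n0 z" using nz by (intro mult_right_mono)
    then have nh: "n0 h \<le> (1 + CN * R) * n0 z"
      using n0_triangle[OF zV(2,3)] nN by (simp add: h_def algebra_simps)
    obtain p w where pw: "p \<in> V \<theta>" "w \<in> W \<theta>" "h = p + w" "nrm \<theta> p \<le> nrm \<theta> h"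
      using orthogonal_split[OF \<theta>(1) h] by metis
    have pwH: "p \<in> H" "w \<in> H" using pw V_in W_in by auto
    obtain v where v: "v \<in> Vs" "n0 (p - v) \<le> Ls * norm \<theta> * nrm \<theta> p"
      using removable[OF \<theta>(1) zero_in_\<Theta>, of p] pw(1) \<theta>(2) by (auto simp: V_star_def)
    have vH: "v \<in> H" "- v \<in> Vs" using v Vs_in subspace_neg[OF Vs_subspace] by auto
    have "nrm \<theta> p \<le> K * ((1 + CN * R) * n0 z)"
      using pw(4) nrm_le[OF \<theta>(1) h] mult_left_mono[OF nh, of K] K1 by linarith
    then have "Ls * norm \<theta> * nrm \<theta> p \<le> Ls * norm \<theta> * (K * ((1 + CN * R) * n0 z))"
      using Ls0 by (intro mult_left_mono) auto
    with v(2) have npv: "n0 (p - v) \<le> Ls * K * (1 + CN * R) * \<rho> * n0 z"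
      by (simp add: n\<theta> mult_ac)
    have "n0 z \<le> \<kappa> * n0 (- v + z)" using \<kappa>(2)[OF vH(2) z] .
    \<comment> \<open>Two expressions for \<open>h\<close> are compared. The angle bound thus
      controls z by the orthogonal part w up to errors of order |\<theta>|.\<close>
    also have "- v + z = (w - N \<theta> z) + (p - v)"
      using pw(3) by (simp add: h_def algebra_simps)
    also have "n0 ((w - N \<theta> z) + (p - v)) \<le> n0 w + n0 (N \<theta> z) + n0 (p - v)"
      using n0_triangle[of "w - N \<theta> z" "p - v"] n0_triangle_diff[of w "N \<theta> z"] pwH zV vH
      by (simp add: H_intros)
    also have "\<dots> \<le> K * nrm \<theta> w + CN * \<rho> * n0 z + Ls * K * (1 + CN * R) * \<rho> * n0 z"
      using n0_le[OF \<theta>(1) pwH(2)] nN npv by linarith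
    finally have "n0 z \<le> \<kappa> * (K * nrm \<theta> w + CN * \<rho> * n0 z + Ls * K * (1 + CN * R) * \<rho> * n0 z)"
      using \<kappa>(1) by (simp add: mult_left_mono)
    also have "\<dots> = \<kappa> * K * nrm \<theta> w + M * \<rho> * n0 z"
      by (simp add: M_def algebra_simps)
    finally have "n0 z \<le> \<kappa> * K * nrm \<theta> w + M * \<rho> * n0 z" .
    moreover have "M * \<rho> * n0 z \<le> 1 / 2 * n0 z"
      using \<rho>M \<rho> nz by (intro mult_right_mono) (auto simp: algebra_simps)
    ultimately have nzw: "n0 z \<le> 2 * \<kappa> * K * nrm \<theta> w" by simp
    have "(n0 z)\<^sup>2 \<le> (2 * \<kappa> * K)\<^sup>2 * (nrm \<theta> w)\<^sup>2"
      using power_mono[OF nzw nz, of 2] by (simp add: power_mult_distrib)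
    then have "c0 * (n0 z)\<^sup>2 \<le> \<gamma> * (nrm \<theta> w)\<^sup>2"
      using \<kappa> K1 \<gamma>_pos by (simp add: c0_def divide_simps) (metis mult_left_mono less_imp_le mult.commute mult.left_commute)
    then have "\<rho>\<^sup>2 * (c0 * (n0 z)\<^sup>2) \<le> \<rho>\<^sup>2 * (\<gamma> * (nrm \<theta> w)\<^sup>2)" by (intro mult_left_mono) auto
    also have "\<dots> \<le> Re (a \<theta> w w)" using degeneracy[OF \<theta>(1) pw(2)] n\<theta> by (simp add: mult_ac)
    \<comment> \<open>\<open>p\<close> is a null vector of \<open>a \<theta>\<close>, so it does not
      contribute to the energy.\<close>
    also have "a \<theta> w w = a \<theta> h h"
      using a_null[OF \<theta>(1) pw(1)] pwH by (simp add: pw(3) A.form_simps)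
    also have "a \<theta> h h = a \<theta> h z + a \<theta> h (N \<theta> z)"
      using h zV by (subst (2) h_def) (simp add: A.form_add_right)
    also have "Re \<dots> = Re (ah \<theta> z z) + (Re (a \<theta> h z - ah \<theta> z z) + Re (a \<theta> h (N \<theta> z)))"
      by simp
    also have "Re (a \<theta> h z - ah \<theta> z z) \<le> C2 * \<rho> ^ 3 * n0 z * n0 z"
      using C2(2)[OF \<theta>(1) zV(1,1)] complex_Re_le_cmod n\<theta> unfolding h_def by (metis order_trans)
    also have "Re (a \<theta> h (N \<theta> z)) \<le> C1 * \<rho>\<^sup>2 * n0 z * n0 (N \<theta> z)"
      using C1(2)[OF \<theta>(1) zV(1,3)] complex_Re_le_cmod n\<theta> unfolding h_def by (metis order_trans)
    also have "C1 * \<rho>\<^sup>2 * n0 z * n0 (N \<theta> z) \<le> C1 * \<rho>\<^sup>2 * n0 z * (CN * \<rho> * n0 z)"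
      using nN C1 nz by (intro mult_left_mono) auto
    finally have "\<rho>\<^sup>2 * (c0 * (n0 z)\<^sup>2) \<le> Re (ah \<theta> z z)
        + (C2 * \<rho> ^ 3 * n0 z * n0 z + C1 * \<rho>\<^sup>2 * n0 z * (CN * \<rho> * n0 z))" by simp
    then have "\<rho>\<^sup>2 * (c0 * (n0 z)\<^sup>2) \<le> Re (ah \<theta> z z) + (\<rho> * D) * (\<rho>\<^sup>2 * (n0 z)\<^sup>2)"
      by (simp add: D_def power2_eq_square power3_eq_cube algebra_simps)
    moreover have "(\<rho> * D) * (\<rho>\<^sup>2 * (n0 z)\<^sup>2) \<le> (c0 / 2) * (\<rho>\<^sup>2 * (n0 z)\<^sup>2)"
      using \<rho>D \<rho> by (intro mult_right_mono) (auto simp: algebra_simps)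
    ultimately show ?thesis by (simp add: algebra_simps)
  qed
  then show ?thesis using c0 \<rho> by (intro exI[of _ "c0 / 2 * \<rho>\<^sup>2"] conjI exI[of _ \<rho>]) auto
qed

text \<open>Quadratic homogeneity spreads the bound from one sphere to all \<xi>.\<close>

lemma ah_coercive: "\<exists>c>0. \<forall>\<xi>. \<forall>z\<in>Z. c * (norm \<xi>)\<^sup>2 * (n0 z)\<^sup>2 \<le> Re (ah \<xi> z z)"
proof -
  obtain c \<rho> where c: "c > 0" "\<rho> > 0"
    "\<And>\<theta> z. norm \<theta> = \<rho> \<Longrightarrow> z \<in> Z \<Longrightarrow> c * (n0 z)\<^sup>2 \<le> Re (ah \<theta> z z)"
    using ah_coercive_sphere by blast
  have "c / \<rho>\<^sup>2 * (norm \<xi>)\<^sup>2 * (n0 z)\<^sup>2 \<le> Re (ah \<xi> z z)" if z: "z \<in> Z" for \<xi> z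
  proof (cases "\<xi> = 0")
    case True
    then show ?thesis using ah_homogeneous[OF Z_sub[OF z] Z_sub[OF z], of 0 0] by simp
  next
    case False
    define t where "t = norm \<xi> / \<rho>"
    define \<theta> where "\<theta> = (\<rho> / norm \<xi>) *\<^sub>R \<xi>"
    have \<theta>: "norm \<theta> = \<rho>" "\<xi> = t *\<^sub>R \<theta>" using False c by (simp_all add: \<theta>_def t_def)
    have "t\<^sup>2 * (c * (n0 z)\<^sup>2) \<le> t\<^sup>2 * Re (ah \<theta> z z)"
      using c(3)[OF \<theta>(1) z] by (intro mult_left_mono) auto
    also have "\<dots> = Re (ah \<xi> z z)"
      unfolding \<theta>(2) by (subst ah_homogeneous) (use z Z_sub in auto)
    finally show ?thesis by (simp add: t_def power_divide mult_ac)
  qed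
  then show ?thesis using c by (intro exI[of _ "c / \<rho>\<^sup>2"]) auto
qed

section \<open>The limit form and bounds for its resolvent\<close>

abbreviation S :: "real^'n \<Rightarrow> 'h \<Rightarrow> 'h \<Rightarrow> complex" where "S \<equiv> S_form H a b a' a'' Vs Z"

lemma S_eq:
  assumes "v \<in> Vs" "z \<in> Z" "v' \<in> Vs" "z' \<in> Z"
  shows "S \<xi> (v + z) (v' + z') = ah \<xi> z z' + b 0 (v + z) (v' + z')"
  using assms by (simp add: S_form_def Z_part_sum)

lemma pos_S: "pos_form s (V 0) (S \<xi>)"
proof (rule pos_formI)
  interpret B: pos_form s H "b 0" using pos_b zero_in_\<Theta> by blast
  have zero: "0 \<in> Vs" "0 \<in> Z" using subspace_0 Vs_subspace Z_subspace by auto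
  have Zs: "x \<in> Z \<Longrightarrow> y \<in> Z \<Longrightarrow> x + y \<in> Z" "x \<in> Z \<Longrightarrow> s c x \<in> Z"
    and Vss: "x \<in> Vs \<Longrightarrow> y \<in> Vs \<Longrightarrow> x + y \<in> Vs" "x \<in> Vs \<Longrightarrow> s c x \<in> Vs" for x y c
    using Vs_subspace Z_subspace subspace_add subspace_scale by auto
  have P: "Z_part Vs Z x \<in> V 0" "Z_part Vs Z x \<in> Z" if x: "x \<in> V 0" for x
  proof -
    obtain v z where "v \<in> Vs" "z \<in> Z" "x = v + z" using V0_split[OF x] by metis
    then show "Z_part Vs Z x \<in> V 0" "Z_part Vs Z x \<in> Z" using Z_sub by (simp_all add: Z_part_sum)
  qed
  have Padd: "Z_part Vs Z (x + y) = Z_part Vs Z x + Z_part Vs Z y" if xy: "x \<in> V 0" "y \<in> V 0" for x y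
  proof -
    obtain v z v' z' where *: "v \<in> Vs" "z \<in> Z" "x = v + z" "v' \<in> Vs" "z' \<in> Z" "y = v' + z'"
      using V0_split[OF xy(1)] V0_split[OF xy(2)] by metis
    then have "x + y = (v + v') + (z + z')" by (simp add: algebra_simps)
    then show ?thesis using * Zs Vss by (simp only: Z_part_sum)
  qed
  have Psc: "Z_part Vs Z (s c x) = s c (Z_part Vs Z x)" if x: "x \<in> V 0" for x c
  proof -
    obtain v z where *: "v \<in> Vs" "z \<in> Z" "x = v + z"
      using V0_split[OF x] by metis
    then have "s c x = s c v + s c z" by (simp add: scale_right_distrib)
    then show ?thesis using * Zs Vss by (simp only: Z_part_sum)
  qed
  have "sesquilinear_on s (V 0) (V 0) (S \<xi>)"
    using ah_sesquilinear[of \<xi>] P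
    unfolding sesquilinear_on_def S_form_def
    by (simp add: Padd Psc B.form_add_left B.form_add_right B.form_scale_left B.form_scale_right
        V0_in algebra_simps)
  moreover have "S \<xi> u u \<in> \<real>\<^sub>\<ge>\<^sub>0" if u: "u \<in> V 0" for u
  proof -
    obtain c where c: "c > 0" "\<And>\<xi> z. z \<in> Z \<Longrightarrow> c * (norm \<xi>)\<^sup>2 * (n0 z)\<^sup>2 \<le> Re (ah \<xi> z z)"
      using ah_coercive by blast
    define z where "z = Z_part Vs Z u"
    have z: "z \<in> V 0" "z \<in> Z" using P[OF u] by (simp_all add: z_def)
    have "0 \<le> c * (norm \<xi>)\<^sup>2 * (n0 z)\<^sup>2" using c by simp
    then have "0 \<le> Re (ah \<xi> z z)" using c(2)[OF z(2), of \<xi>] by linarith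
    moreover have "Im (ah \<xi> z z) = 0"
      using arg_cong[OF ah_hermitian[OF z(1) z(1), of \<xi>], of Im] by simp
    ultimately show ?thesis
      using B.form_self_ge_0[OF V0_in[OF u]] B.form_self_real[OF V0_in[OF u]]
      by (simp add: S_form_def z_def complex_nonneg_Reals_iff)
  qed
  ultimately show "nonneg_form_on s (V 0) (S \<xi>)" by (simp add: nonneg_form_on_def)
qed (use vector_space_axioms V_subspace[OF zero_in_\<Theta>] in auto)

lemma n0_sq_V0: "u \<in> V 0 \<Longrightarrow> (n0 u)\<^sup>2 = Re (b 0 u u)"
  using pos_form.fnorm_sq[OF n0_interp V0_in] by (simp add: norm_form_def null_space_def)

lemma n0_sq_le_S: "u \<in> V 0 \<Longrightarrow> (n0 u)\<^sup>2 \<le> Re (S \<xi> u u)"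
proof -
  assume u: "u \<in> V 0"
  obtain v z where vz: "v \<in> Vs" "z \<in> Z" "u = v + z" using V0_split[OF u] by metis
  obtain c where c: "c > 0" "c * (norm \<xi>)\<^sup>2 * (n0 z)\<^sup>2 \<le> Re (ah \<xi> z z)"
    using ah_coercive vz by blast
  have "0 \<le> c * (norm \<xi>)\<^sup>2 * (n0 z)\<^sup>2" using c(1) by simp
  then show ?thesis using n0_sq_V0[OF u] c(2) S_eq[OF vz(1,2,1,2), of \<xi>] vz by simp
qed

text \<open>On \<open>V 0\<close> the norm of the total form is equivalent to \<open>n0\<close>,
  from below by positivity of \<open>ah\<close>, from above by its boundedness for fixed
  \<xi>.\<close>

lemma hom_resolvent_exists: "\<exists>G. form_resolvent s (d 0) (V 0) (S \<xi>) G"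
proof (rule form_resolvent_exists)
  interpret D: pos_form s UNIV "d 0" using pos_d zero_in_\<Theta> by blast
  interpret S: pos_form s "V 0" "S \<xi>" by (rule pos_S)
  interpret P: pos_form s "V 0" "\<lambda>u v. S \<xi> u v + d 0 u v"
  using pos_form_add[OF S.pos_form_axioms D.pos_form_axioms] by simp
  obtain \<kappa> where \<kappa>: "\<kappa> \<ge> 1" "\<And>v z. v \<in> Vs \<Longrightarrow> z \<in> Z \<Longrightarrow> n0 z \<le> \<kappa> * n0 (v + z)"
    using angle_bound by blast
  obtain C where C: "C \<ge> 0"
    "\<And>\<theta> v u. v \<in> V 0 \<Longrightarrow> u \<in> V 0 \<Longrightarrow> cmod (ah \<theta> v u) \<le> C * (norm \<theta>)\<^sup>2 * n0 v * n0 u"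
    using ah_bound by blast
  show "norm_complete (V 0) (\<lambda>u v. S \<xi> u v + d 0 u v)"
  proof (rule norm_complete_equivalent[OF V_complete[OF zero_in_\<Theta>] _ _ P.pos_form_axioms])
    fix u assume u: "u \<in> V 0"
    have "sqrt ((n0 u)\<^sup>2) \<le> form_norm (\<lambda>u v. S \<xi> u v + d 0 u v) u"
      unfolding form_norm_def[of "\<lambda>u v. S \<xi> u v + d 0 u v"]
      using n0_sq_le_S[OF u, of \<xi>] D.form_self_ge_0[of u] by (intro real_sqrt_le_mono) simp
    then show "n0 u \<le> 1 * form_norm (\<lambda>u v. S \<xi> u v + d 0 u v) u"
      using n0_ge_0[OF V0_in[OF u]] by simp
    define C' where "C' = C * (norm \<xi>)\<^sup>2 * \<kappa>\<^sup>2 + 2"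
    obtain v z where vz: "v \<in> Vs" "z \<in> Z" "u = v + z" using V0_split[OF u] by metis
    have "Re (ah \<xi> z z) \<le> C * (norm \<xi>)\<^sup>2 * (n0 z)\<^sup>2"
      using C(2)[OF Z_sub Z_sub, OF vz(2) vz(2), of \<xi>] complex_Re_le_cmod[of "ah \<xi> z z"]
      by (simp add: power2_eq_square mult.assoc)
    also have "\<dots> \<le> C * (norm \<xi>)\<^sup>2 * (\<kappa> * n0 u)\<^sup>2"
      using C(1) \<kappa>(2)[OF vz(1,2)] n0_ge_0[OF Z_in[OF vz(2)]] vz(3)
      by (intro mult_left_mono power_mono) auto
    finally have "Re (S \<xi> u u) \<le> C * (norm \<xi>)\<^sup>2 * (\<kappa> * n0 u)\<^sup>2 + (n0 u)\<^sup>2"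
      using S_eq[OF vz(1,2,1,2), of \<xi>] n0_sq_V0[OF u] vz by simp
    moreover have "Re (d 0 u u) \<le> (n0 u)\<^sup>2"
      using d_le_b[OF zero_in_\<Theta> V0_in[OF u]] n0_sq_V0[OF u] by simp
    ultimately have "Re (S \<xi> u u + d 0 u u) \<le> C' * (n0 u)\<^sup>2"
      by (simp add: C'_def algebra_simps power_mult_distrib)
    then have "form_norm (\<lambda>u v. S \<xi> u v + d 0 u v) u \<le> sqrt (C' * (n0 u)\<^sup>2)"
      unfolding form_norm_def[of "\<lambda>u v. S \<xi> u v + d 0 u v"] by (rule real_sqrt_le_mono)
    then show "form_norm (\<lambda>u v. S \<xi> u v + d 0 u v) u \<le> sqrt C' * n0 u"
      using n0_ge_0[OF V0_in[OF u]] by (simp add: real_sqrt_mult)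
  qed
qed (use pos_d zero_in_\<Theta> d_definite d_complete pos_S in auto)

text \<open>Testing with the solution bounds it by f. Testing with z alone isolates
  \<open>ah \<xi> z z\<close> against three terms of size |f| |z|, whence 3 / c, and coercivity
  gains the factor |\<xi>|^2. This decay makes the later estimates uniform in \<xi>.\<close>

lemma hom_resolvent_bounds:
  "\<exists>C\<ge>0. \<forall>\<xi> G f. form_resolvent s (d 0) (V 0) (S \<xi>) G \<longrightarrow>
     (\<exists>v\<in>Vs. \<exists>z\<in>Z. G f = v + z \<and> n0 v \<le> C * dn 0 f \<and> (1 + (norm \<xi>)\<^sup>2) * n0 z \<le> C * dn 0 f)"
proof -
  interpret D: pos_form s UNIV "d 0" using pos_d zero_in_\<Theta> by blast
  interpret B: pos_form s H "b 0" using pos_b zero_in_\<Theta> by blast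
  obtain \<kappa> where \<kappa>: "\<kappa> \<ge> 1" "\<And>v z. v \<in> Vs \<Longrightarrow> z \<in> Z \<Longrightarrow> n0 v \<le> \<kappa> * n0 (v + z)"
    "\<And>v z. v \<in> Vs \<Longrightarrow> z \<in> Z \<Longrightarrow> n0 z \<le> \<kappa> * n0 (v + z)"
    using angle_bound by blast
  obtain c where c: "c > 0" "\<And>\<xi> z. z \<in> Z \<Longrightarrow> c * (norm \<xi>)\<^sup>2 * (n0 z)\<^sup>2 \<le> Re (ah \<xi> z z)"
    using ah_coercive by blast
  have "\<exists>v\<in>Vs. \<exists>z\<in>Z. G f = v + z \<and> n0 v \<le> (\<kappa> + 3 / c) * dn 0 f
      \<and> (1 + (norm \<xi>)\<^sup>2) * n0 z \<le> (\<kappa> + 3 / c) * dn 0 f"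
    if G: "form_resolvent s (d 0) (V 0) (S \<xi>) G" for \<xi> G f
  proof -
    interpret G: form_resolvent s "d 0" "V 0" "S \<xi>" G by (rule G)
    define u where "u = G f"
    have u: "u \<in> V 0" "u \<in> H" using G.T_dom V0_in by (auto simp: u_def)
    have eq: "S \<xi> u w + d 0 u w = d 0 f w" if "w \<in> V 0" for w
      using G.T_eq[OF that, of f] by (simp add: u_def)
    obtain v z where vz: "v \<in> Vs" "z \<in> Z" "u = v + z" using V0_split[OF u(1)] by metis
    have zH: "z \<in> H" "z \<in> V 0" using vz Z_in Z_sub by auto
    have f0: "0 \<le> dn 0 f" by (rule dn_ge_0[OF zero_in_\<Theta>])
    have "1 * (n0 u)\<^sup>2 \<le> Re (d 0 f u)"
      using n0_sq_le_S[OF u(1), of \<xi>] D.form_self_ge_0[of u] arg_cong[OF eq[OF u(1)], of Re] by simp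
    also have "\<dots> \<le> dn 0 f * dn 0 u"
      using complex_Re_le_cmod D.cauchy_schwarz[of f u] by (blast intro: order_trans)
    also have "\<dots> \<le> dn 0 f * n0 u"
      using dn0_le[OF u(2)] f0 by (rule mult_left_mono)
    finally have "1 * n0 u \<le> dn 0 f"
      by (rule mult_square_le_cancel) (use n0_ge_0[OF u(2)] f0 in auto)
    then have nu: "n0 u \<le> dn 0 f" by simp
    have "S \<xi> u z = ah \<xi> z z + b 0 u z"
      using S_eq[OF vz(1,2) subspace_0[OF Vs_subspace] vz(2), of \<xi>] vz(3) by simp
    then have "ah \<xi> z z = d 0 f z - b 0 u z - d 0 u z"
      unfolding eq[OF zH(2), symmetric] by simp
    then have "Re (ah \<xi> z z) = Re (d 0 f z - b 0 u z - d 0 u z)" by simp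
    also have "\<dots> \<le> cmod (d 0 f z) + cmod (b 0 u z) + cmod (d 0 u z)"
      using complex_Re_le_cmod[of "d 0 f z - b 0 u z - d 0 u z"]
        norm_triangle_ineq4[of "d 0 f z - b 0 u z" "d 0 u z"] norm_triangle_ineq4[of "d 0 f z" "b 0 u z"]
      by linarith
    also have "\<dots> \<le> dn 0 f * n0 z + dn 0 f * n0 z + dn 0 f * n0 z"
    proof (intro add_mono)
      have dz: "dn 0 z \<le> n0 z" "form_norm (b 0) z \<le> n0 z" "form_norm (b 0) u \<le> n0 u" "dn 0 u \<le> n0 u"
        using dn0_le b_le_nrm[OF zero_in_\<Theta>] zH u by auto
      show "cmod (d 0 f z) \<le> dn 0 f * n0 z"
        using D.cauchy_schwarz[of f z] mult_left_mono[OF dz(1) f0] by simp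
      have "cmod (d 0 u z) \<le> dn 0 u * dn 0 z" by (rule D.cauchy_schwarz) auto
      also have "\<dots> \<le> dn 0 f * n0 z"
        using dz nu f0 by (intro mult_mono) (auto simp: dn_ge_0 zero_in_\<Theta>)
      finally show "cmod (d 0 u z) \<le> dn 0 f * n0 z" .
      have "cmod (b 0 u z) \<le> form_norm (b 0) u * form_norm (b 0) z"
        using B.cauchy_schwarz u zH by blast
      also have "\<dots> \<le> dn 0 f * n0 z"
        using dz nu f0 B.fnorm_ge_0[OF zH(1)] by (intro mult_mono) auto
      finally show "cmod (b 0 u z) \<le> dn 0 f * n0 z" .
    qed
    finally have "(c * (norm \<xi>)\<^sup>2) * (n0 z)\<^sup>2 \<le> (3 * dn 0 f) * n0 z"
      using c(2)[OF vz(2), of \<xi>] by simp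
    then have "c * (norm \<xi>)\<^sup>2 * n0 z \<le> 3 * dn 0 f"
      by (rule mult_square_le_cancel) (use n0_ge_0[OF zH(1)] f0 in auto)
    then have "(norm \<xi>)\<^sup>2 * n0 z \<le> 3 / c * dn 0 f"
      using c(1) by (simp add: field_simps)
    moreover have "\<kappa> * n0 u \<le> \<kappa> * dn 0 f" using nu \<kappa>(1) by (intro mult_left_mono) auto
    then have "n0 z \<le> \<kappa> * dn 0 f" "n0 v \<le> \<kappa> * dn 0 f"
      using \<kappa>(2,3)[OF vz(1,2)] unfolding vz(3) by linarith+
    moreover have "0 \<le> 3 / c * dn 0 f" using c(1) f0 by simp
    ultimately show ?thesis
      using vz by (intro bexI[of _ v] bexI[of _ z]) (auto simp: u_def algebra_simps)
  qed
  then show ?thesis using \<kappa>(1) c(1) by (intro exI[of _ "\<kappa> + 3 / c"]) auto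
qed

text \<open>The \<open>Vs\<close> component of the part of \<open>u\<close> in \<open>W \<theta>\<close> is moved into \<open>V \<theta>\<close> by removability of the singularity,
  which costs a factor \<open>norm \<theta>\<close>.\<close>

lemma energy_decomposition:
  "\<exists>C\<ge>0. \<forall>\<theta>\<in>\<Theta>. \<forall>u\<in>H. \<exists>v\<in>Vs. \<exists>z\<in>Z. \<exists>w\<in>H. u = E \<theta> v + z + w \<and>
     n0 (E \<theta> v) \<le> C * n0 u \<and> n0 z \<le> C * n0 u \<and>
     norm \<theta> * n0 z \<le> C * form_norm (a \<theta>) u \<and> n0 w \<le> C * form_norm (a \<theta>) u"
proof -
  \<comment> \<open>\<open>P\<close> asks for a vector of \<open>V_star\<close> and leaves
    \<open>E \<theta>\<close> out; as \<open>E \<theta>\<close> maps \<open>Vs\<close> onto that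
    set, the translation is made once at the end.\<close>
  define P where "P C \<theta> u \<longleftrightarrow> (\<exists>p\<in>V_star H a Vs \<theta>. \<exists>z\<in>Z. \<exists>w\<in>H. u = p + z + w \<and>
     n0 p \<le> C * n0 u \<and> n0 z \<le> C * n0 u \<and>
     norm \<theta> * n0 z \<le> C * form_norm (a \<theta>) u \<and> n0 w \<le> C * form_norm (a \<theta>) u)" for C \<theta> u
  have P_mono: "P C' \<theta> u" if "P C \<theta> u" "C \<le> C'" "\<theta> \<in> \<Theta>" "u \<in> H" for C C' \<theta> u
  proof -
    have "C * n0 u \<le> C' * n0 u" "C * form_norm (a \<theta>) u \<le> C' * form_norm (a \<theta>) u"
      using that n0_ge_0 pos_form.fnorm_ge_0[OF pos_a] by (auto intro: mult_right_mono)
    then show ?thesis using that(1) unfolding P_def by (meson order_trans)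
  qed
  have zeroZ: "0 \<in> Z" using subspace_0[OF Z_subspace] .
  obtain \<kappa> where \<kappa>: "\<kappa> \<ge> 1" "\<And>v z. v \<in> Vs \<Longrightarrow> z \<in> Z \<Longrightarrow> n0 v \<le> \<kappa> * n0 (v + z)"
    "\<And>v z. v \<in> Vs \<Longrightarrow> z \<in> Z \<Longrightarrow> n0 z \<le> \<kappa> * n0 (v + z)"
    using angle_bound by blast
  obtain Ca where Ca: "Ca \<ge> 0" "\<And>\<theta> v u. \<theta> \<in> \<Theta> \<Longrightarrow> v \<in> V 0 \<Longrightarrow> u \<in> V 0 \<Longrightarrow>
      cmod (a \<theta> v u) \<le> Ca * (norm \<theta>)\<^sup>2 * n0 v * n0 u"
    using a_quadratic by blast
  have R0: "R \<ge> 0" using bound_\<Theta>[OF zero_in_\<Theta>] by simp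
  \<comment> \<open>Within this radius the Lipschitz error of \<open>a\<close> is at most half of
    the gap at 0.\<close>
  define \<rho> where "\<rho> = \<nu> / (2 * L + 1)"
  have \<rho>: "\<rho> > 0" "L * \<rho> \<le> \<nu> / 2"
    using \<nu>_pos L0 by (simp_all add: \<rho>_def field_simps)
  define g where "g = 1 / sqrt \<gamma>"
  have g: "g > 0" using \<gamma>_pos by (simp add: g_def)
  have en_w: "norm \<theta> * nrm \<theta> w \<le> g * form_norm (a \<theta>) w" if "\<theta> \<in> \<Theta>" "w \<in> W \<theta>" for \<theta> w
  proof -
    have "sqrt (\<gamma> * (norm \<theta>)\<^sup>2 * (nrm \<theta> w)\<^sup>2) \<le> form_norm (a \<theta>) w"
      unfolding form_norm_def[of "a \<theta>"] using degeneracy[OF that] by (rule real_sqrt_le_mono)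
    then show ?thesis
      using \<gamma>_pos nrm_ge_0[OF that(1) W_in[OF that(2)]] by (simp add: real_sqrt_mult g_def field_simps)
  qed
  have en_split: "form_norm (a \<theta>) (p + w) = form_norm (a \<theta>) w" if "\<theta> \<in> \<Theta>" "p \<in> V \<theta>" "w \<in> H" for \<theta> p w
  proof -
    interpret A: pos_form s H "a \<theta>" using pos_a that by blast
    show ?thesis
      using that a_null[OF that(1,2)] V_in[OF that(2)] by (simp add: form_norm_def A.form_simps)
  qed
  define Cz where "Cz = \<kappa> + 1 / sqrt \<nu>"
  have at_zero: "P Cz 0 u" if u: "u \<in> H" for u
  proof -
    obtain y w where yw: "y \<in> V 0" "w \<in> W 0" "u = y + w" "n0 y \<le> n0 u"
      using orthogonal_split[OF zero_in_\<Theta> u] by metis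
    obtain v z where vz: "v \<in> Vs" "z \<in> Z" "y = v + z" using V0_split[OF yw(1)] by metis
    have wH: "w \<in> H" using yw W_in by blast
    have "sqrt (\<nu> * (n0 w)\<^sup>2) \<le> form_norm (a 0) w"
      unfolding form_norm_def[of "a 0"] using gap[OF yw(2)] by (rule real_sqrt_le_mono)
    then have w: "n0 w \<le> 1 / sqrt \<nu> * form_norm (a 0) u"
      using \<nu>_pos n0_ge_0[OF wH] en_split[OF zero_in_\<Theta> yw(1) wH] yw(3)
      by (simp add: real_sqrt_mult field_simps)
    have e: "0 \<le> form_norm (a 0) u" "0 \<le> n0 u"
      using pos_form.fnorm_ge_0[OF pos_a[OF zero_in_\<Theta>] u] n0_ge_0[OF u] by auto
    have "\<kappa> * n0 y \<le> \<kappa> * n0 u" using yw(4) \<kappa>(1) by (intro mult_left_mono) auto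
    then have "n0 v \<le> \<kappa> * n0 u" "n0 z \<le> \<kappa> * n0 u"
      using \<kappa>(2,3)[OF vz(1,2)] unfolding vz(3) by linarith+
    moreover have "\<kappa> \<le> Cz" "1 / sqrt \<nu> \<le> Cz" "0 \<le> Cz" using \<kappa>(1) \<nu>_pos by (simp_all add: Cz_def)
    note this(3) mult_right_mono[OF this(1) e(2)] mult_right_mono[OF this(2) e(1)]
      mult_nonneg_nonneg[OF this(3) e(1)]
    ultimately show ?thesis
      unfolding P_def using vz yw(3) wH w
      by (intro bexI[of _ v] bexI[of _ z] bexI[of _ w]) (auto simp: V_star_def)
  qed
  define Cl where "Cl = K\<^sup>2 + K * g / \<rho>"
  \<comment> \<open>Away from 0 the degeneracy bound is a uniform gap, so the orthogonal splitting
    at \<theta> suffices and z = 0.\<close>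
  have large: "P Cl \<theta> u" if \<theta>: "\<theta> \<in> \<Theta>" "\<rho> \<le> norm \<theta>" and u: "u \<in> H" for \<theta> u
  proof -
    obtain p w where pw: "p \<in> V \<theta>" "w \<in> W \<theta>" "u = p + w" "nrm \<theta> p \<le> nrm \<theta> u"
      using orthogonal_split[OF \<theta>(1) u] by metis
    have H: "p \<in> H" "w \<in> H" using pw V_in W_in by auto
    have e: "0 \<le> form_norm (a \<theta>) u" "0 \<le> n0 u"
      using pos_form.fnorm_ge_0[OF pos_a[OF \<theta>(1)] u] n0_ge_0[OF u] by auto
    have "n0 p \<le> K * nrm \<theta> p" by (rule n0_le[OF \<theta>(1) H(1)])
    also have "\<dots> \<le> K * (K * n0 u)"
      using K1 pw(4) nrm_le[OF \<theta>(1) u] by (intro mult_left_mono) auto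
    finally have p: "n0 p \<le> K\<^sup>2 * n0 u" by (simp add: power2_eq_square)
    have "\<rho> * nrm \<theta> w \<le> norm \<theta> * nrm \<theta> w"
      using \<theta>(2) nrm_ge_0[OF \<theta>(1) H(2)] by (rule mult_right_mono)
    also have "\<dots> \<le> g * form_norm (a \<theta>) u"
      using en_w[OF \<theta>(1) pw(2)] en_split[OF \<theta>(1) pw(1) H(2)] pw(3) by simp
    finally have "nrm \<theta> w \<le> g / \<rho> * form_norm (a \<theta>) u"
      using \<rho>(1) by (simp add: field_simps)
    then have "K * nrm \<theta> w \<le> K * (g / \<rho> * form_norm (a \<theta>) u)" using K1 by (intro mult_left_mono) auto
    then have w: "n0 w \<le> K * g / \<rho> * form_norm (a \<theta>) u" using n0_le[OF \<theta>(1) H(2)] by simp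
    have "0 \<le> K * g / \<rho>" using K1 g \<rho> by simp
    then have "K\<^sup>2 \<le> Cl" "K * g / \<rho> \<le> Cl" "0 \<le> Cl" by (simp_all add: Cl_def)
    note mult_right_mono[OF this(1) e(2)] mult_right_mono[OF this(2) e(1)]
      mult_nonneg_nonneg[OF this(3) e(2)] mult_nonneg_nonneg[OF this(3) e(1)]
    moreover have "p \<in> V_star H a Vs \<theta>" using pw(1) \<theta> \<rho> by (auto simp: V_star_def)
    moreover have "n0 0 = 0" by (rule pos_form.fnorm_zero[OF n0_interp])
    ultimately show ?thesis
      unfolding P_def using pw(3) H p w zeroZ
      by (intro bexI[of _ p] bexI[of _ 0] bexI[of _ w]) auto
  qed
  \<comment> \<open>\<open>q\<close> bounds the part in \<open>W 0\<close> by the energy of u: the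
    denominator is the halved gap, and the numerator adds the energy of y, which is at most sqrt Ca
    |\<theta>| |y|. \<open>Cm\<close> adds up the constants of all components.\<close>
  define q where "q = (1 + sqrt Ca * (K * g)) / sqrt (\<nu> / 2)"
  define Cm where "Cm = K\<^sup>2 + (\<kappa> + K * Ls * R * \<kappa>) * K\<^sup>2 + \<kappa> * K\<^sup>2 + \<kappa> * (K * g) + q + K * Ls * \<kappa> * (K * g)"
  have q0: "0 \<le> q" using Ca K1 g \<nu>_pos by (simp add: q_def)
  have small: "P Cm \<theta> u" if \<theta>: "\<theta> \<in> \<Theta>" "\<theta> \<noteq> 0" "norm \<theta> \<le> \<rho>" and u: "u \<in> H" for \<theta> u
  proof -
    interpret A: pos_form s H "a \<theta>" using pos_a \<theta> by blast
    define e where "e = form_norm (a \<theta>) u"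
    have e: "0 \<le> e" "0 \<le> n0 u"
      using A.fnorm_ge_0[OF u] n0_ge_0[OF u] by (auto simp: e_def)
    obtain p \<omega> where p\<omega>: "p \<in> V \<theta>" "\<omega> \<in> W \<theta>" "u = p + \<omega>" "nrm \<theta> p \<le> nrm \<theta> u" "nrm \<theta> \<omega> \<le> nrm \<theta> u"
      using orthogonal_split[OF \<theta>(1) u] by metis
    have H: "p \<in> H" "\<omega> \<in> H" using p\<omega> V_in W_in by auto
    have e\<omega>: "form_norm (a \<theta>) \<omega> = e"
      using en_split[OF \<theta>(1) p\<omega>(1) H(2)] p\<omega>(3) by (simp add: e_def)
    have Kn: "K * nrm \<theta> x \<le> K\<^sup>2 * n0 u" if "nrm \<theta> x \<le> nrm \<theta> u" for x
    proof -
      have "K * nrm \<theta> x \<le> K * (K * n0 u)"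
        using K1 that nrm_le[OF \<theta>(1) u] by (intro mult_left_mono) auto
      then show ?thesis by (simp add: power2_eq_square)
    qed
    have p: "n0 p \<le> K\<^sup>2 * n0 u" and \<omega>: "n0 \<omega> \<le> K\<^sup>2 * n0 u"
      using n0_le[OF \<theta>(1)] H Kn p\<omega>(4,5) by (meson order_trans)+
    have "norm \<theta> * n0 \<omega> \<le> norm \<theta> * (K * nrm \<theta> \<omega>)"
      using n0_le[OF \<theta>(1) H(2)] by (rule mult_left_mono) simp
    also have "\<dots> \<le> K * (g * e)"
      using en_w[OF \<theta>(1) p\<omega>(2)] K1 e\<omega> by (subst mult.left_commute) (intro mult_left_mono, auto)
    finally have \<theta>\<omega>: "norm \<theta> * n0 \<omega> \<le> K * g * e" by (simp add: mult.assoc)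
    \<comment> \<open>On \<open>W \<theta>\<close> the lower bound is only of order |\<theta>|^2. A
      second splitting, now at 0, isolates the part on which the gap survives.\<close>
    obtain y w where yw: "y \<in> V 0" "w \<in> W 0" "\<omega> = y + w" "n0 y \<le> n0 \<omega>"
      using orthogonal_split[OF zero_in_\<Theta> H(2)] by metis
    have H2: "y \<in> H" "w \<in> H" using yw V_in W_in by auto
    obtain v z where vz: "v \<in> Vs" "z \<in> Z" "y = v + z" using V0_split[OF yw(1)] by metis
    have H3: "v \<in> H" "z \<in> H" using vz Vs_in Z_in by auto
    have "\<kappa> * n0 y \<le> \<kappa> * n0 \<omega>" using yw(4) \<kappa>(1) by (intro mult_left_mono) auto
    then have nv: "n0 v \<le> \<kappa> * n0 \<omega>" and nz: "n0 z \<le> \<kappa> * n0 \<omega>"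
      using \<kappa>(2,3)[OF vz(1,2)] unfolding vz(3) by linarith+
    obtain v2 where v2: "v2 \<in> V \<theta>" "nrm \<theta> (v - v2) \<le> Ls * norm \<theta> * n0 v"
      using removable[OF zero_in_\<Theta> \<theta>(1), of v] vz(1) \<theta>(2) by (auto simp: V_star_def)
    have H4: "v2 \<in> H" "v - v2 \<in> H" using v2 V_in H3 H_intros by auto
    have "n0 (v - v2) \<le> K * (Ls * norm \<theta> * n0 v)"
      using n0_le[OF \<theta>(1) H4(2)] v2(2) K1 by (meson order_trans mult_left_mono zero_le_one)
    also have "\<dots> \<le> K * (Ls * norm \<theta> * (\<kappa> * n0 \<omega>))"
      using nv K1 Ls0 by (intro mult_left_mono) auto
    finally have nvv: "n0 (v - v2) \<le> K * Ls * \<kappa> * (norm \<theta> * n0 \<omega>)" by (simp add: mult_ac)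
    have K\<kappa>: "0 \<le> K * Ls * \<kappa>" using K1 Ls0 \<kappa>(1) by simp
    have nvv1: "n0 (v - v2) \<le> K * Ls * \<kappa> * (K * g) * e"
      using order_trans[OF nvv mult_left_mono[OF \<theta>\<omega> K\<kappa>]] by (simp add: mult.assoc)
    have R1: "norm \<theta> * n0 \<omega> \<le> R * n0 \<omega>"
      using bound_\<Theta>[OF \<theta>(1)] n0_ge_0[OF H(2)] by (rule mult_right_mono)
    have nvv2: "n0 (v - v2) \<le> K * Ls * R * \<kappa> * n0 \<omega>"
      using order_trans[OF nvv mult_left_mono[OF R1 K\<kappa>]] by (simp add: mult_ac)
    have "\<nu> * (n0 w)\<^sup>2 \<le> Re (a \<theta> w w) + Re (a 0 w w - a \<theta> w w)" using gap[OF yw(2)] by simp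
    also have "Re (a 0 w w - a \<theta> w w) \<le> cmod (a \<theta> w w - a 0 w w)"
      using complex_Re_le_cmod[of "a 0 w w - a \<theta> w w"] by (simp add: norm_minus_commute)
    also have "\<dots> \<le> L * norm \<theta> * (n0 w)\<^sup>2"
      using a_lip[OF \<theta>(1) H2(2) H2(2)] by (simp add: power2_eq_square mult.assoc)
    also have "\<dots> \<le> \<nu> / 2 * (n0 w)\<^sup>2"
      using order_trans[OF mult_left_mono[OF \<theta>(3) L0] \<rho>(2)] by (intro mult_right_mono) auto
    finally have "\<nu> / 2 * (n0 w)\<^sup>2 \<le> Re (a \<theta> w w)" by simp
    then have "sqrt (\<nu> / 2 * (n0 w)\<^sup>2) \<le> form_norm (a \<theta>) w"
      unfolding form_norm_def[of "a \<theta>"] by (rule real_sqrt_le_mono)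
    then have "sqrt (\<nu> / 2) * n0 w \<le> form_norm (a \<theta>) w"
      using n0_ge_0[OF H2(2)] by (simp only: real_sqrt_mult real_sqrt_abs abs_of_nonneg)
    also have "form_norm (a \<theta>) w \<le> e + form_norm (a \<theta>) y"
      using A.fnorm_triangle_diff[OF H(2) H2(1)] e\<omega> by (simp add: yw(3))
    also have "form_norm (a \<theta>) y \<le> sqrt (Ca * (norm \<theta> * n0 y)\<^sup>2)"
      unfolding form_norm_def[of "a \<theta>"]
      using Ca(2)[OF \<theta>(1) yw(1) yw(1)] complex_Re_le_cmod[of "a \<theta> y y"]
      by (intro real_sqrt_le_mono) (simp add: power_mult_distrib power2_eq_square mult_ac)
    also have "\<dots> = sqrt Ca * (norm \<theta> * n0 y)"
      using n0_ge_0[OF H2(1)] by (simp add: real_sqrt_mult)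
    also have "\<dots> \<le> sqrt Ca * (K * g * e)"
      using yw(4) \<theta>\<omega> Ca(1) by (intro mult_left_mono order_trans[OF _ \<theta>\<omega>]) auto
    finally have "sqrt (\<nu> / 2) * n0 w \<le> (1 + sqrt Ca * (K * g)) * e"
      by (simp add: algebra_simps)
    then have nw: "n0 w \<le> q * e"
      unfolding q_def using \<nu>_pos by (simp add: pos_le_divide_eq mult.commute[of "n0 w"] del: real_sqrt_divide)
    have pv2: "p + v2 \<in> V_star H a Vs \<theta>"
      using p\<omega>(1) v2(1) V_intros(2)[OF \<theta>(1)] \<theta>(2) by (simp add: V_star_def)
    have "n0 v2 \<le> n0 v + n0 (v - v2)" using n0_triangle_diff[OF H3(1) H4(2)] by simp
    also have "\<dots> \<le> (\<kappa> + K * Ls * R * \<kappa>) * n0 \<omega>" using nv nvv2 by (simp add: algebra_simps)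
    also have "\<dots> \<le> (\<kappa> + K * Ls * R * \<kappa>) * (K\<^sup>2 * n0 u)"
      using \<omega> \<kappa>(1) K1 Ls0 R0 by (intro mult_left_mono) auto
    finally have npv2: "n0 (p + v2) \<le> (K\<^sup>2 + (\<kappa> + K * Ls * R * \<kappa>) * K\<^sup>2) * n0 u"
      using n0_triangle[OF H(1) H4(1)] p by (simp add: algebra_simps)
    have nw2: "n0 (w + (v - v2)) \<le> (q + K * Ls * \<kappa> * (K * g)) * e"
      using n0_triangle[OF H2(2) H4(2)] nw nvv1 by (simp add: algebra_simps)
    have nz1: "n0 z \<le> (\<kappa> * K\<^sup>2) * n0 u"
      using order_trans[OF nz mult_left_mono[OF \<omega>]] \<kappa>(1) by (simp add: mult.assoc)
    have "norm \<theta> * n0 z \<le> norm \<theta> * (\<kappa> * n0 \<omega>)" using nz by (rule mult_left_mono) simp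
    also have "\<dots> \<le> \<kappa> * (K * g * e)"
      using \<theta>\<omega> \<kappa>(1) by (subst mult.left_commute) (intro mult_left_mono, auto)
    finally have nz2: "norm \<theta> * n0 z \<le> (\<kappa> * (K * g)) * e" by (simp add: mult_ac)
    have Cm: "K\<^sup>2 + (\<kappa> + K * Ls * R * \<kappa>) * K\<^sup>2 \<le> Cm" "\<kappa> * K\<^sup>2 \<le> Cm" "\<kappa> * (K * g) \<le> Cm"
      "q + K * Ls * \<kappa> * (K * g) \<le> Cm"
    proof -
      have "0 \<le> K\<^sup>2" "0 \<le> (\<kappa> + K * Ls * R * \<kappa>) * K\<^sup>2" "0 \<le> \<kappa> * K\<^sup>2" "0 \<le> \<kappa> * (K * g)"
        "0 \<le> K * Ls * \<kappa> * (K * g)"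
        using \<kappa>(1) K1 Ls0 R0 g by simp_all
      then show "K\<^sup>2 + (\<kappa> + K * Ls * R * \<kappa>) * K\<^sup>2 \<le> Cm" "\<kappa> * K\<^sup>2 \<le> Cm" "\<kappa> * (K * g) \<le> Cm"
        "q + K * Ls * \<kappa> * (K * g) \<le> Cm"
        using q0 by (simp_all add: Cm_def)
    qed
    \<comment> \<open>Putting v - v2 into the remainder is affordable: its size is |\<theta>|
      |\<omega>|, which the energy controls.\<close>
    have "u = (p + v2) + z + (w + (v - v2))"
      by (simp add: p\<omega>(3) yw(3) vz(3) algebra_simps)
    then show ?thesis
      unfolding P_def e_def[symmetric] using pv2 vz(2) H2 H4
        order_trans[OF npv2 mult_right_mono[OF Cm(1) e(2)]]
        order_trans[OF nz1 mult_right_mono[OF Cm(2) e(2)]]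
        order_trans[OF nz2 mult_right_mono[OF Cm(3) e(1)]]
        order_trans[OF nw2 mult_right_mono[OF Cm(4) e(1)]]
      by (intro bexI[of _ "p + v2"] bexI[of _ z] bexI[of _ "w + (v - v2)"]) (auto intro: H_intros)
  qed
  define C where "C = max Cz (max Cl Cm)"
  have "C \<ge> 0" using \<kappa>(1) \<nu>_pos by (simp add: C_def Cz_def le_max_iff_disj)
  moreover have "P C \<theta> u" if "\<theta> \<in> \<Theta>" "u \<in> H" for \<theta> u
  proof -
    consider "\<theta> = 0" | "\<rho> \<le> norm \<theta>" | "\<theta> \<noteq> 0" "norm \<theta> \<le> \<rho>" by linarith
    then show ?thesis
    proof cases
      case 1
      then show ?thesis using P_mono[OF at_zero[OF that(2)], of C] that by (simp add: C_def)
    next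
      case 2
      then show ?thesis using P_mono[OF large[OF that(1) 2 that(2)], of C] that by (simp add: C_def)
    next
      case 3
      then show ?thesis using P_mono[OF small[OF that(1) 3 that(2)], of C] that by (simp add: C_def)
    qed
  qed
  ultimately show ?thesis
    unfolding P_def by (intro exI[of _ C]) (simp flip: E_range)
qed

end

section \<open>Comparison of the resolvents\<close>

text \<open>Bookkeeping for residual terms, each a product of a factor x from the approximate
  solution and a factor y from the test vector; the power of \<epsilon> may sit in either
  scale.\<close>

lemma mult_le_scaled:
  fixes k x y p q s t :: real
  assumes "0 \<le> k" "0 \<le> y" "0 \<le> p" "0 \<le> s" "x \<le> p * s" "y \<le> q * t"
  shows "k * x * y \<le> (k * p * q) * (s * t)"
proof -
  have "x * y \<le> (p * s) * (q * t)"
    using assms by (intro mult_mono) auto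
  then have "k * (x * y) \<le> k * ((p * s) * (q * t))" using assms(1) by (rule mult_left_mono)
  then show ?thesis by (simp add: mult_ac)
qed

context two_scale begin

abbreviation Lf :: "real \<Rightarrow> real^'n \<Rightarrow> 'h \<Rightarrow> 'h \<Rightarrow> complex" where
  "Lf \<epsilon> \<theta> \<equiv> \<lambda>u v. complex_of_real (1 / \<epsilon>\<^sup>2) * a \<theta> u v + b \<theta> u v"

text \<open>The energy norm of the operator shifted by 1. It carries the weight \<epsilon>^(-2) on
  \<open>a \<theta>\<close>, which is the source of every gained factor \<epsilon> on the test
  side.\<close>

definition energy :: "real \<Rightarrow> real^'n \<Rightarrow> 'h \<Rightarrow> real" where
  "energy \<epsilon> \<theta> u = form_norm (\<lambda>u v. Lf \<epsilon> \<theta> u v + d \<theta> u v) u"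

lemma pos_Lf:
  assumes "\<theta> \<in> \<Theta>"
  shows "pos_form s H (Lf \<epsilon> \<theta>)" "pos_form s H (\<lambda>u v. Lf \<epsilon> \<theta> u v + d \<theta> u v)"
proof -
  have nn: "complex_of_real (1 / \<epsilon>\<^sup>2) * x \<in> \<real>\<^sub>\<ge>\<^sub>0" if "x \<in> \<real>\<^sub>\<ge>\<^sub>0" for x
    using that by (intro nonneg_Reals_mult_I) (simp only: nonneg_Reals_of_real_iff, simp)
  show "pos_form s H (Lf \<epsilon> \<theta>)"
    using a_form[OF assms] b_form[OF assms]
    by (intro pos_formI[OF vector_space_axioms H_subspace])
       (simp add: nonneg_form_on_def sesquilinear_on_def algebra_simps nonneg_Reals_add_I nn
         del: of_real_divide)
  then show "pos_form s H (\<lambda>u v. Lf \<epsilon> \<theta> u v + d \<theta> u v)"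
    by (rule pos_form_add[OF _ pos_d[OF assms]]) simp
qed

lemma energy_sq:
  assumes "\<theta> \<in> \<Theta>" "u \<in> H"
  shows "(energy \<epsilon> \<theta> u)\<^sup>2 = Re (a \<theta> u u) / \<epsilon>\<^sup>2 + Re (b \<theta> u u) + Re (d \<theta> u u)"
  using pos_form.fnorm_sq[OF pos_Lf(2)[OF assms(1)] assms(2), of \<epsilon>]
  by (simp add: energy_def)

lemma energy_ge_0: "\<theta> \<in> \<Theta> \<Longrightarrow> u \<in> H \<Longrightarrow> 0 \<le> energy \<epsilon> \<theta> u"
  unfolding energy_def by (rule pos_form.fnorm_ge_0[OF pos_Lf(2)])

lemma energy_bounds:
  assumes \<theta>: "\<theta> \<in> \<Theta>" and u: "u \<in> H" and \<epsilon>: "0 < \<epsilon>" "\<epsilon> < 1"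
  shows "form_norm (a \<theta>) u \<le> \<epsilon> * energy \<epsilon> \<theta> u" "n0 u \<le> K * energy \<epsilon> \<theta> u" "dn \<theta> u \<le> energy \<epsilon> \<theta> u"
proof -
  have nn: "0 \<le> Re (a \<theta> u u)" "0 \<le> Re (b \<theta> u u)" "0 \<le> Re (d \<theta> u u)"
    using pos_form.form_self_ge_0 pos_a pos_b pos_d \<theta> u by blast+
  have "\<epsilon>\<^sup>2 * (Re (a \<theta> u u) / \<epsilon>\<^sup>2) \<le> \<epsilon>\<^sup>2 * (energy \<epsilon> \<theta> u)\<^sup>2"
    unfolding energy_sq[OF \<theta> u] using nn by (intro mult_left_mono) auto
  then have "(form_norm (a \<theta>) u)\<^sup>2 \<le> (\<epsilon> * energy \<epsilon> \<theta> u)\<^sup>2"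
    using \<epsilon> pos_form.fnorm_sq[OF pos_a[OF \<theta>] u] by (simp add: power_mult_distrib)
  then show "form_norm (a \<theta>) u \<le> \<epsilon> * energy \<epsilon> \<theta> u"
    by (rule power2_le_imp_le) (use \<epsilon> energy_ge_0[OF \<theta> u] in simp)
  have "\<epsilon>\<^sup>2 \<le> 1" using \<epsilon> by (simp add: power_le_one)
  then have "Re (a \<theta> u u) * \<epsilon>\<^sup>2 \<le> Re (a \<theta> u u)" using nn(1) by (simp add: mult_left_le)
  then have "Re (a \<theta> u u) \<le> Re (a \<theta> u u) / \<epsilon>\<^sup>2"
    using \<epsilon> by (simp add: pos_le_divide_eq)
  then have "(nrm \<theta> u)\<^sup>2 \<le> (energy \<epsilon> \<theta> u)\<^sup>2"
    using pos_form.fnorm_sq[OF pos_n[OF \<theta>] u] nn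
    by (simp add: energy_sq[OF \<theta> u] norm_form_def)
  then have "nrm \<theta> u \<le> energy \<epsilon> \<theta> u"
    by (rule power2_le_imp_le) (use energy_ge_0[OF \<theta> u] in simp)
  then show "n0 u \<le> K * energy \<epsilon> \<theta> u"
    using n0_le[OF \<theta> u] K1 mult_left_mono[of "nrm \<theta> u" "energy \<epsilon> \<theta> u" K] by linarith
  have "(dn \<theta> u)\<^sup>2 \<le> (energy \<epsilon> \<theta> u)\<^sup>2"
    using pos_form.fnorm_sq[OF pos_d[OF \<theta>], of u] nn \<epsilon> by (simp add: energy_sq[OF \<theta> u])
  then show "dn \<theta> u \<le> energy \<epsilon> \<theta> u"
    by (rule power2_le_imp_le) (use energy_ge_0[OF \<theta> u] in simp)
qed

lemma Lf_resolvent_exists: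
  assumes \<theta>: "\<theta> \<in> \<Theta>" and \<epsilon>: "0 < \<epsilon>" "\<epsilon> < 1"
  shows "\<exists>T. form_resolvent s (d \<theta>) H (Lf \<epsilon> \<theta>) T"
proof (rule form_resolvent_exists)
  show "norm_complete H (\<lambda>u v. Lf \<epsilon> \<theta> u v + d \<theta> u v)"
  proof (rule norm_complete_equivalent[OF n_complete[OF zero_in_\<Theta>] _ _ pos_Lf(2)[OF \<theta>]])
    fix u assume u: "u \<in> H"
    show "n0 u \<le> K * form_norm (\<lambda>u v. Lf \<epsilon> \<theta> u v + d \<theta> u v) u"
      using energy_bounds(2)[OF \<theta> u \<epsilon>] by (simp add: energy_def)
    have "Re (a \<theta> u u) \<le> (K * n0 u)\<^sup>2" "Re (b \<theta> u u) \<le> (K * n0 u)\<^sup>2"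
    proof -
      have "form_norm (a \<theta>) u \<le> K * n0 u" "form_norm (b \<theta>) u \<le> K * n0 u"
        using a_le_nrm[OF \<theta> u] b_le_nrm[OF \<theta> u] nrm_le[OF \<theta> u] by auto
      then show "Re (a \<theta> u u) \<le> (K * n0 u)\<^sup>2" "Re (b \<theta> u u) \<le> (K * n0 u)\<^sup>2"
        using pos_form.fnorm_sq[OF pos_a[OF \<theta>] u] pos_form.fnorm_sq[OF pos_b[OF \<theta>] u]
          pos_form.fnorm_ge_0[OF pos_a[OF \<theta>] u] pos_form.fnorm_ge_0[OF pos_b[OF \<theta>] u]
        by (metis power_mono)+
    qed
    moreover from this have "Re (a \<theta> u u) / \<epsilon>\<^sup>2 \<le> (K * n0 u)\<^sup>2 / \<epsilon>\<^sup>2" by (intro divide_right_mono) auto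
    ultimately have "(energy \<epsilon> \<theta> u)\<^sup>2 \<le> (K * n0 u)\<^sup>2 / \<epsilon>\<^sup>2 + 2 * (K * n0 u)\<^sup>2"
      using d_le_b[OF \<theta> u] by (simp add: energy_sq[OF \<theta> u])
    also have "\<dots> = (sqrt (1 / \<epsilon>\<^sup>2 + 2) * K * n0 u)\<^sup>2"
      by (simp add: power_mult_distrib add_divide_distrib algebra_simps)
    finally have "energy \<epsilon> \<theta> u \<le> sqrt (1 / \<epsilon>\<^sup>2 + 2) * K * n0 u"
      by (rule power2_le_imp_le) (use K1 n0_ge_0[OF u] in simp)
    then show "form_norm (\<lambda>u v. Lf \<epsilon> \<theta> u v + d \<theta> u v) u \<le> (sqrt (1 / \<epsilon>\<^sup>2 + 2) * K) * n0 u"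
      by (simp add: energy_def)
  qed
qed (use pos_d pos_Lf d_definite d_complete \<theta> in auto)

text \<open>The error U - T f, used as test vector, has its squared energy equal to the residual.
  Hence a bound for the residual in the dual of the energy norm bounds the error.\<close>

lemma residual_bound:
  assumes T: "form_resolvent s (d \<theta>) H (Lf \<epsilon> \<theta>) T" and \<theta>: "\<theta> \<in> \<Theta>" and \<epsilon>: "0 < \<epsilon>" "\<epsilon> < 1"
    and U: "U \<in> H" and M: "0 \<le> M"
    and res: "\<And>w. w \<in> H \<Longrightarrow> cmod (Lf \<epsilon> \<theta> U w + d \<theta> U w - d \<theta> f w) \<le> M * energy \<epsilon> \<theta> w"
  shows "dn \<theta> (T f - U) \<le> M"
proof -
  interpret T: form_resolvent s "d \<theta>" H "Lf \<epsilon> \<theta>" T by (rule T)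
  interpret Q: pos_form s H "\<lambda>u v. Lf \<epsilon> \<theta> u v + d \<theta> u v" using pos_Lf(2)[OF \<theta>] .
  define w where "w = U - T f"
  have w: "w \<in> H" using U T.T_dom by (simp add: w_def H_intros)
  have "Lf \<epsilon> \<theta> w w + d \<theta> w w = (Lf \<epsilon> \<theta> U w + d \<theta> U w) - (Lf \<epsilon> \<theta> (T f) w + d \<theta> (T f) w)"
    unfolding w_def by (rule Q.form_diff_left) (use U T.T_dom in \<open>auto intro: H_intros\<close>)
  also have "\<dots> = Lf \<epsilon> \<theta> U w + d \<theta> U w - d \<theta> f w"
    by (simp only: T.T_eq[OF w])
  finally have eq: "Lf \<epsilon> \<theta> w w + d \<theta> w w = Lf \<epsilon> \<theta> U w + d \<theta> U w - d \<theta> f w" .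
  have "1 * (energy \<epsilon> \<theta> w)\<^sup>2 = Re (Lf \<epsilon> \<theta> w w + d \<theta> w w)"
    using Q.fnorm_sq[OF w] by (simp only: energy_def mult_1)
  also have "\<dots> \<le> M * energy \<epsilon> \<theta> w"
    unfolding eq using complex_Re_le_cmod res[OF w] by (rule order_trans)
  finally have "1 * energy \<epsilon> \<theta> w \<le> M"
    by (rule mult_square_le_cancel) (use M energy_ge_0[OF \<theta> w] in auto)
  then have "dn \<theta> w \<le> M" using energy_bounds(3)[OF \<theta> w \<epsilon>] by simp
  then show ?thesis using T.fnorm_minus_commute[of "T f" U] by (simp add: w_def)
qed

lemma d_bound:
  assumes "\<theta> \<in> \<Theta>" "u \<in> H" "v \<in> H"
  shows "cmod (d \<theta> u v) \<le> K\<^sup>2 * n0 u * n0 v"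
proof -
  have "cmod (d \<theta> u v) \<le> dn \<theta> u * dn \<theta> v"
    using pos_form.cauchy_schwarz[OF pos_d[OF assms(1)]] by blast
  also have "\<dots> \<le> (K * n0 u) * (K * n0 v)"
    using assms dn_le dn_ge_0 n0_ge_0 K1 by (intro mult_mono) auto
  finally show ?thesis by (simp add: power2_eq_square mult_ac)
qed

lemma E_linear:
  assumes "\<theta> \<in> \<Theta>"
  shows "E \<theta> (x - y) = E \<theta> x - E \<theta> y" "E \<theta> (x + y) = E \<theta> x + E \<theta> y" "dn \<theta> (E \<theta> x) = dn 0 x"
proof -
  note lin = isometry_linear[OF pos_d[OF zero_in_\<Theta>] pos_d[OF assms] d_definite[OF assms]
      bij_is_surj[OF E_bij[OF assms]] E_d[OF assms]]
  show *: "E \<theta> (x - y) = E \<theta> x - E \<theta> y" for x y using lin by simp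
  show "E \<theta> (x + y) = E \<theta> x + E \<theta> y" using *[of "x + y" y] by simp
  show "dn \<theta> (E \<theta> x) = dn 0 x" using lin by simp
qed

lemma nrm_E:
  assumes \<theta>: "\<theta> \<in> \<Theta>" and v: "v \<in> Vs"
  shows "nrm \<theta> (E \<theta> v) = n0 v"
proof -
  have "a \<theta> (E \<theta> v) (E \<theta> v) = 0" "a 0 v v = 0"
    using E_null[OF \<theta> v] Vs_sub[OF v] by (simp_all add: null_space_def)
  then show ?thesis using E_b[OF \<theta> v v] by (simp add: form_norm_def norm_form_def)
qed

lemma E_bounds:
  assumes \<theta>: "\<theta> \<in> \<Theta>" and v: "v \<in> Vs"
  shows "E \<theta> v \<in> H" "n0 (E \<theta> v) \<le> K * n0 v" "n0 v \<le> K * n0 (E \<theta> v)"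
proof -
  show H: "E \<theta> v \<in> H" using E_null[OF \<theta> v] V_in by blast
  show "n0 (E \<theta> v) \<le> K * n0 v" "n0 v \<le> K * n0 (E \<theta> v)"
    using n0_le[OF \<theta> H] nrm_le[OF \<theta> H] nrm_E[OF \<theta> v] by simp_all
qed

lemma hom_equation_Z:
  assumes G: "form_resolvent s (d 0) (V 0) (S \<xi>) G" and "G g = v + z" "v \<in> Vs" "z \<in> Z" and z': "z' \<in> Z"
  shows "ah \<xi> z z' + b 0 (v + z) z' + d 0 (v + z) z' = d 0 g z'"
proof -
  have "S \<xi> (v + z) (0 + z') = ah \<xi> z z' + b 0 (v + z) (0 + z')"
    by (rule S_eq[OF assms(3,4) subspace_0[OF Vs_subspace] z'])
  then show ?thesis using form_resolvent.T_eq[OF G Z_sub[OF z'], of g] assms(2) by simp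
qed

lemma hom_equation_Vs:
  assumes G: "form_resolvent s (d 0) (V 0) (S \<xi>) G" and "G g = v + z" "v \<in> Vs" "z \<in> Z" and v': "v' \<in> Vs"
  shows "d 0 g v' = b 0 (v + z) v' + d 0 (v + z) v'"
proof -
  have "S \<xi> (v + z) (v' + 0) = ah \<xi> z 0 + b 0 (v + z) (v' + 0)"
    by (rule S_eq[OF assms(3,4) v' subspace_0[OF Z_subspace]])
  moreover have "ah \<xi> z (s 0 0) = cnj 0 * ah \<xi> z 0"
    using ah_sesquilinear[of \<xi>] Z_sub[OF assms(4)] V_intros(1)[OF zero_in_\<Theta>]
    unfolding sesquilinear_on_def by blast
  then have "ah \<xi> z 0 = 0" by simp
  ultimately show ?thesis using form_resolvent.T_eq[OF G Vs_sub[OF v'], of g] assms(2) by simp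
qed

text \<open>The residual behaves differently on the three parts of the test vector. On the null part
  \<open>a \<theta>\<close> drops out and only \<open>b\<close> and \<open>d\<close> are compared.
  On the part in \<open>Z\<close> the homogenised equation cancels the leading terms and leaves the
  cubic error. On the remainder each term is merely bounded, but the remainder itself is
  O(\<epsilon>).\<close>

lemma resolvent_estimate_near:
  "\<exists>C\<ge>0. \<forall>\<theta>\<in>\<Theta>. \<forall>\<epsilon> \<xi> T G g. 0 < \<epsilon> \<longrightarrow> \<epsilon> < 1 \<longrightarrow> \<theta> = \<epsilon> *\<^sub>R \<xi> \<longrightarrow>
    form_resolvent s (d \<theta>) H (Lf \<epsilon> \<theta>) T \<longrightarrow> form_resolvent s (d 0) (V 0) (S \<xi>) G \<longrightarrow>
    dn \<theta> (T (E \<theta> g) - E \<theta> (G g)) \<le> C * \<epsilon> * dn 0 g"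
proof -
  obtain CG where CG: "CG \<ge> 0" "\<And>\<xi> G f. form_resolvent s (d 0) (V 0) (S \<xi>) G \<Longrightarrow>
      \<exists>v\<in>Vs. \<exists>z\<in>Z. G f = v + z \<and> n0 v \<le> CG * dn 0 f \<and> (1 + (norm \<xi>)\<^sup>2) * n0 z \<le> CG * dn 0 f"
    using hom_resolvent_bounds by metis
  obtain CD where CD: "CD \<ge> 0" "\<And>\<theta> u. \<theta> \<in> \<Theta> \<Longrightarrow> u \<in> H \<Longrightarrow>
      \<exists>v\<in>Vs. \<exists>z\<in>Z. \<exists>w\<in>H. u = E \<theta> v + z + w \<and> n0 (E \<theta> v) \<le> CD * n0 u \<and> n0 z \<le> CD * n0 u \<and>
        norm \<theta> * n0 z \<le> CD * form_norm (a \<theta>) u \<and> n0 w \<le> CD * form_norm (a \<theta>) u"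
    using energy_decomposition by metis
  obtain CN where CN: "CN \<ge> 0" "\<And>\<theta> v. v \<in> V 0 \<Longrightarrow> n0 (N \<theta> v) \<le> CN * norm \<theta> * n0 v"
    using corrector_bound by blast
  obtain C1 where C1: "C1 \<ge> 0" "\<And>\<theta> v u. \<theta> \<in> \<Theta> \<Longrightarrow> v \<in> V 0 \<Longrightarrow> u \<in> H \<Longrightarrow>
      cmod (a \<theta> (v + N \<theta> v) u) \<le> C1 * (norm \<theta>)\<^sup>2 * n0 v * n0 u"
    using a_corrected by blast
  obtain C2 where C2: "C2 \<ge> 0" "\<And>\<theta> v u. \<theta> \<in> \<Theta> \<Longrightarrow> v \<in> V 0 \<Longrightarrow> u \<in> V 0 \<Longrightarrow>
      cmod (a \<theta> (v + N \<theta> v) u - ah \<theta> v u) \<le> C2 * norm \<theta> ^ 3 * n0 v * n0 u"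
    using a_corrected_hom by blast
  \<comment> \<open>In terms of the energy, \<open>cp\<close> bounds z' and E \<theta> v', and
    \<open>cv\<close> bounds v'; \<open>cn\<close> bounds the corrector in terms of \<epsilon> times
    the right-hand side. \<open>M1\<close>, \<open>M2\<close>, \<open>M3\<close> have one summand
    for each residual term on the null part, on \<open>Z\<close> and on the remainder.\<close>
  define cp where "cp = CD * K"
  define cv where "cv = K * cp"
  define cn where "cn = CN * CG"
  define M1 where "M1 = Kb * CG * cv + Ke * CG * cv + 2 * (K\<^sup>2 * cn * cp)"
  define M2 where "M2 = C2 * CG * CD + Kb * CG * CD + (Lb * K) * CG * cp + K\<^sup>2 * cn * cp
    + Ke * (2 * CG + 1) * CD + (Ke * K) * CG * cp + K\<^sup>2 * cn * cp"
  define M3 where "M3 = C1 * CG * CD + 2 * (K\<^sup>2 * (K * CG + CG + cn) * CD) + K * 1 * CD"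
  define M where "M = M1 + M2 + M3"
  have K0: "0 \<le> K" using K1 by simp
  have nn: "0 \<le> cp" "0 \<le> cv" "0 \<le> cn" "0 \<le> M"
    using CG CD CN C1 C2 K0 Kb0 Ke0 Lb0 by (simp_all add: cp_def cv_def cn_def M_def M1_def M2_def M3_def)
  have "dn \<theta> (T (E \<theta> g) - E \<theta> (G g)) \<le> (M + (Ke * CG + K * cn)) * \<epsilon> * dn 0 g"
    if \<theta>: "\<theta> \<in> \<Theta>" and \<epsilon>: "0 < \<epsilon>" "\<epsilon> < 1" and \<theta>\<xi>: "\<theta> = \<epsilon> *\<^sub>R \<xi>"
      and T: "form_resolvent s (d \<theta>) H (Lf \<epsilon> \<theta>) T" and G: "form_resolvent s (d 0) (V 0) (S \<xi>) G"
    for \<theta> \<epsilon> \<xi> T G g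
  proof -
    interpret A: pos_form s H "a \<theta>" using pos_a \<theta> by blast
    interpret B: pos_form s H "b \<theta>" using pos_b \<theta> by blast
    interpret D: pos_form s UNIV "d \<theta>" using pos_d \<theta> by blast
    interpret D0: pos_form s UNIV "d 0" using pos_d zero_in_\<Theta> by blast
    interpret B0: pos_form s H "b 0" using pos_b zero_in_\<Theta> by blast
    interpret G: form_resolvent s "d 0" "V 0" "S \<xi>" G by (rule G)
    define F where "F = dn 0 g"
    have F0: "0 \<le> F" unfolding F_def by (rule dn_ge_0[OF zero_in_\<Theta>])
    have \<epsilon>F: "0 \<le> \<epsilon> * F" using \<epsilon> F0 by simp
    obtain v z where vz: "v \<in> Vs" "z \<in> Z" "G g = v + z" "n0 v \<le> CG * F" "(1 + (norm \<xi>)\<^sup>2) * n0 z \<le> CG * F"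
      using CG(2)[OF G, of g] by (auto simp: F_def)
    have H: "v \<in> H" "z \<in> H" "z \<in> V 0" "N \<theta> z \<in> H" using vz Vs_in Z_in Z_sub corrector_in by auto
    have z0: "0 \<le> n0 z" by (rule n0_ge_0[OF H(2)])
    have n\<theta>: "norm \<theta> = \<epsilon> * norm \<xi>" using \<theta>\<xi> \<epsilon> by simp
    have "2 * norm \<xi> \<le> 1 + (norm \<xi>)\<^sup>2"
      using sum_squares_bound[of 1 "norm \<xi>"] by simp
    then have "norm \<xi> \<le> 1 + (norm \<xi>)\<^sup>2" using norm_ge_zero[of \<xi>] by linarith
    then have z1: "n0 z \<le> CG * F" "(norm \<xi>)\<^sup>2 * n0 z \<le> CG * F" "norm \<xi> * n0 z \<le> CG * F"
      using vz(5) z0 mult_right_mono[of "norm \<xi>" "1 + (norm \<xi>)\<^sup>2" "n0 z"]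
      by (auto simp: algebra_simps intro: order_trans[OF _ vz(5)])
    have z\<theta>: "norm \<theta> * n0 z \<le> CG * (\<epsilon> * F)"
      using mult_left_mono[OF z1(3), of \<epsilon>] \<epsilon> by (simp add: n\<theta> mult_ac)
    have nN: "n0 (N \<theta> z) \<le> cn * (\<epsilon> * F)"
      using CN(2)[OF H(3), of \<theta>] mult_left_mono[OF z\<theta> CN(1)] by (simp add: cn_def mult_ac)
    have nN': "n0 (N \<theta> z) \<le> cn * F"
    proof -
      have "\<epsilon> * F \<le> F" using \<epsilon> F0 by (simp add: mult_left_le_one_le)
      then show ?thesis using nN nn(3) by (meson mult_left_mono order_trans)
    qed
    have EvH: "E \<theta> v \<in> H" "n0 (E \<theta> v) \<le> K * CG * F"
      using E_bounds[OF \<theta> vz(1)] mult_left_mono[OF vz(4) K0] by auto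
    \<comment> \<open>Here z is kept in place of E \<theta> z, which is not known to lie in
      \<open>H\<close>; in the weaker norm \<open>dn \<theta>\<close> the two differ only by a
      multiple of |\<theta>| |z|.\<close>
    define U where "U = E \<theta> v + (z + N \<theta> z)"
    have h: "z + N \<theta> z \<in> H" using H by (simp add: H_intros)
    have U: "U \<in> H" using EvH(1) h by (simp add: U_def H_intros)
    have nU: "n0 U \<le> (K * CG + CG + cn) * F"
      using n0_triangle[OF EvH(1) h] n0_triangle[OF H(2,4)] EvH(2) z1(1) nN'
      by (simp add: U_def algebra_simps)
    have Ez: "dn \<theta> (z - E \<theta> z) \<le> Ke * (norm \<theta> * n0 z)"
    proof -
      have "dn \<theta> (z - E \<theta> z) = dn \<theta> (E \<theta> z - z)" by (rule D.fnorm_minus_commute) auto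
      also have "\<dots> \<le> Ke * norm \<theta> * dn 0 z" by (rule E_near[OF \<theta>])
      also have "\<dots> \<le> Ke * norm \<theta> * n0 z"
        using dn0_le[OF H(2)] Ke0 by (intro mult_left_mono) auto
      finally show ?thesis by (simp add: mult_ac)
    qed
    have "dn \<theta> (T (E \<theta> g) - U) \<le> M * \<epsilon> * F"
    proof (rule residual_bound[OF T \<theta> \<epsilon> U])
      show "0 \<le> M * \<epsilon> * F" using nn \<epsilon> F0 by simp
      fix u assume u: "u \<in> H"
      define e where "e = energy \<epsilon> \<theta> u"
      have e: "0 \<le> e" "n0 u \<le> K * e" "form_norm (a \<theta>) u \<le> \<epsilon> * e"
        using energy_ge_0[OF \<theta> u] energy_bounds[OF \<theta> u \<epsilon>] by (simp_all add: e_def)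
      have \<epsilon>e: "0 \<le> \<epsilon> * e" using e \<epsilon> by simp
      obtain v' z' w where dec: "v' \<in> Vs" "z' \<in> Z" "w \<in> H" "u = E \<theta> v' + z' + w"
        "n0 (E \<theta> v') \<le> CD * n0 u" "n0 z' \<le> CD * n0 u" "norm \<theta> * n0 z' \<le> CD * form_norm (a \<theta>) u"
        "n0 w \<le> CD * form_norm (a \<theta>) u"
        using CD(2)[OF \<theta> u] by blast
      have H': "v' \<in> H" "E \<theta> v' \<in> H" "z' \<in> H" "z' \<in> V 0" "w \<in> H"
        using dec Vs_in Z_in Z_sub E_bounds(1)[OF \<theta>] by auto
      have n': "0 \<le> n0 v'" "0 \<le> n0 (E \<theta> v')" "0 \<le> n0 z'" "0 \<le> n0 w" using H' n0_ge_0 by auto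
      have CDe: "CD * form_norm (a \<theta>) u \<le> CD * (\<epsilon> * e)" "CD * n0 u \<le> cp * e"
        using mult_left_mono[OF e(3) CD(1)] mult_left_mono[OF e(2) CD(1)] by (simp_all add: cp_def mult.assoc)
      have nE': "n0 (E \<theta> v') \<le> cp * e" and nz': "n0 z' \<le> cp * e" and nw: "n0 w \<le> CD * (\<epsilon> * e)"
        and \<theta>z': "norm \<theta> * n0 z' \<le> CD * (\<epsilon> * e)"
        using dec(5-8) CDe by linarith+
      have \<xi>z': "norm \<xi> * n0 z' \<le> CD * e"
        using \<theta>z' \<epsilon> by (simp add: n\<theta>)
      have nv': "n0 v' \<le> cv * e"
        using E_bounds(3)[OF \<theta> dec(1)] mult_left_mono[OF nE' K0] by (simp add: cv_def mult.assoc)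
      define R1 where "R1 = Lf \<epsilon> \<theta> U (E \<theta> v') + d \<theta> U (E \<theta> v') - d \<theta> (E \<theta> g) (E \<theta> v')"
      define R2 where "R2 = Lf \<epsilon> \<theta> U z' + d \<theta> U z' - d \<theta> (E \<theta> g) z'"
      define R3 where "R3 = Lf \<epsilon> \<theta> U w + d \<theta> U w - d \<theta> (E \<theta> g) w"
      have split: "Lf \<epsilon> \<theta> U u + d \<theta> U u - d \<theta> (E \<theta> g) u = R1 + R2 + R3"
        using U H' unfolding dec(4) R1_def R2_def R3_def
        by (simp add: A.form_add_right B.form_add_right D.form_add_right H_intros algebra_simps)
      have aE: "a \<theta> U x = a \<theta> (z + N \<theta> z) x" if "x \<in> H" for x
        using a_null(1)[OF \<theta> E_null[OF \<theta> vz(1)] that] EvH(1) h that by (simp add: U_def A.form_add_left)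
      have "cmod R1 \<le> M1 * (\<epsilon> * F * e)"
      proof -
        have eqn: "d 0 g v' = b 0 (v + z) v' + d 0 (v + z) v'"
          by (rule hom_equation_Vs[OF G vz(3,1,2) dec(1)])
        have "a \<theta> U (E \<theta> v') = 0"
          by (rule a_null(2)[OF \<theta> E_null[OF \<theta> dec(1)] U])
        then have "R1 = (b \<theta> z (E \<theta> v') - b 0 z v') + d \<theta> (z - E \<theta> z) (E \<theta> v')
            + b \<theta> (N \<theta> z) (E \<theta> v') + d \<theta> (N \<theta> z) (E \<theta> v')"
          using EvH(1) H H' E_b[OF \<theta> vz(1) dec(1)] E_d[OF \<theta>]
          by (simp add: R1_def U_def eqn B.form_add_left D.form_add_left D.form_diff_left
              B0.form_add_left D0.form_add_left H_intros)
        then have "cmod R1 \<le> cmod (b \<theta> z (E \<theta> v') - b 0 z v') + cmod (d \<theta> (z - E \<theta> z) (E \<theta> v'))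
            + cmod (b \<theta> (N \<theta> z) (E \<theta> v')) + cmod (d \<theta> (N \<theta> z) (E \<theta> v'))"
          by (simp only: norm_triangle_le order_refl add_mono norm_triangle_ineq)
        moreover have "cmod (b \<theta> z (E \<theta> v') - b 0 z v') \<le> (Kb * CG * cv) * ((\<epsilon> * F) * e)"
        proof -
          have "b \<theta> z (E \<theta> v') - b 0 z v' = cnj (b \<theta> (E \<theta> v') z - b 0 v' z)"
            using B.form_hermitian[OF H'(2) H(2)] B0.form_hermitian[OF H'(1) H(2)] by simp
          then have "cmod (b \<theta> z (E \<theta> v') - b 0 z v') \<le> Kb * norm \<theta> * n0 v' * n0 z"
            using E_bz[OF \<theta> dec(1) vz(2)] by (simp only: complex_mod_cnj)
          also have "\<dots> = Kb * (norm \<theta> * n0 z) * n0 v'" by simp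
          also have "\<dots> \<le> (Kb * CG * cv) * ((\<epsilon> * F) * e)"
            using Kb0 n' CG(1) \<epsilon>F z\<theta> nv' by (intro mult_le_scaled) auto
          finally show ?thesis .
        qed
        moreover have "cmod (d \<theta> (z - E \<theta> z) (E \<theta> v')) \<le> (Ke * CG * cv) * ((\<epsilon> * F) * e)"
        proof -
          have "cmod (d \<theta> (z - E \<theta> z) (E \<theta> v')) \<le> dn \<theta> (z - E \<theta> z) * dn \<theta> (E \<theta> v')"
            by (rule D.cauchy_schwarz) auto
          also have "\<dots> \<le> (Ke * (norm \<theta> * n0 z)) * n0 v'"
            using Ez E_linear(3)[OF \<theta>, of v'] dn0_le[OF H'(1)] Ke0 z0 dn_ge_0[OF zero_in_\<Theta>]
            by (intro mult_mono) auto
          also have "\<dots> \<le> (Ke * CG * cv) * ((\<epsilon> * F) * e)"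
            using Ke0 n' CG(1) \<epsilon>F z\<theta> nv' by (intro mult_le_scaled) auto
          finally show ?thesis .
        qed
        moreover have "K\<^sup>2 * n0 (N \<theta> z) * n0 (E \<theta> v') \<le> (K\<^sup>2 * cn * cp) * ((\<epsilon> * F) * e)"
          using n' nn \<epsilon>F nN nE' by (intro mult_le_scaled) auto
        ultimately show ?thesis
          using b_bound[OF \<theta> H(4) H'(2)] d_bound[OF \<theta> H(4) H'(2)] by (simp add: M1_def algebra_simps)
      qed
      moreover have "cmod R2 \<le> M2 * (\<epsilon> * F * e)"
      proof -
        \<comment> \<open>The homogenised equation contains \<open>d 0 y z'\<close>, which the
          isometry turns into \<open>d \<theta> (E \<theta> y) (E \<theta> z')\<close>. Replacing E
          \<theta> z' by z' costs |\<theta>| |z'|, which is \<epsilon> times the energy.\<close>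
        define y where "y = v + z - g"
        have ny: "dn 0 y \<le> (2 * CG + 1) * F"
          using D0.fnorm_triangle_diff[of "v + z" g] D0.fnorm_triangle[of v z] dn0_le[OF H(1)] dn0_le[OF H(2)]
            vz(4) z1(1) by (simp add: y_def F_def algebra_simps)
        have eqn: "ah \<xi> z z' + b 0 (v + z) z' + d 0 y z' = 0"
          using hom_equation_Z[OF G vz(3,1,2) dec(2), symmetric] by (simp add: y_def D0.form_diff_left)
        have Ey: "E \<theta> y = E \<theta> v + E \<theta> z - E \<theta> g"
          by (simp add: y_def E_linear[OF \<theta>])
        have "complex_of_real (1 / \<epsilon>\<^sup>2) * ah \<theta> z z' = ah \<xi> z z'"
          unfolding \<theta>\<xi> ah_homogeneous[OF H(3) H'(4)] using \<epsilon> by simp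
        then have "complex_of_real (1 / \<epsilon>\<^sup>2) * a \<theta> U z'
            = ah \<xi> z z' + complex_of_real (1 / \<epsilon>\<^sup>2) * (a \<theta> (z + N \<theta> z) z' - ah \<theta> z z')"
          unfolding aE[OF H'(3)] by (simp only: right_diff_distrib) simp
        moreover have "d \<theta> U z' - d \<theta> (E \<theta> g) z'
            = d 0 y z' + (d \<theta> (E \<theta> y) (z' - E \<theta> z') + (d \<theta> (z - E \<theta> z) z' + d \<theta> (N \<theta> z) z'))"
          unfolding E_d[OF \<theta>, of y z', symmetric]
          by (simp add: U_def Ey D.form_simps)
        ultimately have "R2 = complex_of_real (1 / \<epsilon>\<^sup>2) * (a \<theta> (z + N \<theta> z) z' - ah \<theta> z z')
            + (b \<theta> (E \<theta> v) z' - b 0 v z') + (b \<theta> z z' - b 0 z z') + b \<theta> (N \<theta> z) z'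
            + d \<theta> (E \<theta> y) (z' - E \<theta> z') + d \<theta> (z - E \<theta> z) z' + d \<theta> (N \<theta> z) z'
            + (ah \<xi> z z' + b 0 (v + z) z' + d 0 y z')"
          using EvH(1) H H' unfolding R2_def add_diff_eq[symmetric]
          by (simp add: U_def B.form_add_left B0.form_add_left H_intros)
        then have "cmod R2 \<le> cmod (complex_of_real (1 / \<epsilon>\<^sup>2) * (a \<theta> (z + N \<theta> z) z' - ah \<theta> z z'))
            + cmod (b \<theta> (E \<theta> v) z' - b 0 v z') + cmod (b \<theta> z z' - b 0 z z') + cmod (b \<theta> (N \<theta> z) z')
            + cmod (d \<theta> (E \<theta> y) (z' - E \<theta> z')) + cmod (d \<theta> (z - E \<theta> z) z') + cmod (d \<theta> (N \<theta> z) z')"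
          unfolding eqn by (simp only: add_0_right norm_triangle_le order_refl add_mono norm_triangle_ineq)
        moreover have "cmod (complex_of_real (1 / \<epsilon>\<^sup>2) * (a \<theta> (z + N \<theta> z) z' - ah \<theta> z z'))
            \<le> (C2 * CG * CD) * ((\<epsilon> * F) * e)"
        proof -
          have "cmod (complex_of_real (1 / \<epsilon>\<^sup>2) * (a \<theta> (z + N \<theta> z) z' - ah \<theta> z z'))
              = 1 / \<epsilon>\<^sup>2 * cmod (a \<theta> (z + N \<theta> z) z' - ah \<theta> z z')"
            by (simp add: norm_mult norm_divide norm_power)
          also have "\<dots> \<le> 1 / \<epsilon>\<^sup>2 * (C2 * norm \<theta> ^ 3 * n0 z * n0 z')"
            by (intro mult_left_mono C2(2)[OF \<theta> H(3) H'(4)]) simp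
          \<comment> \<open>The three powers of \<xi> are distributed: two to the solution, one to
            the test vector, which is all that each side can bear.\<close>
          also have "\<dots> = C2 * (\<epsilon> * ((norm \<xi>)\<^sup>2 * n0 z)) * (norm \<xi> * n0 z')"
            using \<epsilon> by (simp add: n\<theta> power_mult_distrib power2_eq_square power3_eq_cube)
          also have "\<dots> \<le> (C2 * CG * CD) * ((\<epsilon> * F) * e)"
            using C2(1) n' CG(1) \<epsilon>F \<xi>z' mult_left_mono[OF z1(2), of \<epsilon>] \<epsilon>
            by (intro mult_le_scaled) (auto simp: mult_ac)
          finally show ?thesis .
        qed
        moreover have "cmod (b \<theta> (E \<theta> v) z' - b 0 v z') \<le> (Kb * CG * CD) * (F * (\<epsilon> * e))"
        proof -
          have "cmod (b \<theta> (E \<theta> v) z' - b 0 v z') \<le> Kb * n0 v * (norm \<theta> * n0 z')"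
            using E_bz[OF \<theta> vz(1) dec(2)] by (simp add: mult_ac)
          also have "\<dots> \<le> (Kb * CG * CD) * (F * (\<epsilon> * e))"
            using Kb0 n' CG(1) F0 vz(4) \<theta>z' by (intro mult_le_scaled) auto
          finally show ?thesis .
        qed
        moreover have "cmod (b \<theta> z z' - b 0 z z') \<le> ((Lb * K) * CG * cp) * ((\<epsilon> * F) * e)"
        proof -
          have "cmod (b \<theta> z z' - b 0 z z') \<le> Lb * norm \<theta> * n0 z * nrm \<theta> z'"
            by (rule b_reg[OF H(3) H'(4) \<theta>])
          also have "\<dots> \<le> Lb * norm \<theta> * n0 z * (K * n0 z')"
            using Lb0 z0 nrm_le[OF \<theta> H'(3)] by (intro mult_left_mono) auto
          also have "\<dots> = (Lb * K) * (norm \<theta> * n0 z) * n0 z'" by simp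
          also have "\<dots> \<le> ((Lb * K) * CG * cp) * ((\<epsilon> * F) * e)"
            using Lb0 K0 n' CG(1) \<epsilon>F z\<theta> nz' by (intro mult_le_scaled) auto
          finally show ?thesis .
        qed
        moreover have "K\<^sup>2 * n0 (N \<theta> z) * n0 z' \<le> (K\<^sup>2 * cn * cp) * ((\<epsilon> * F) * e)"
          using n' nn \<epsilon>F nN nz' by (intro mult_le_scaled) auto
        moreover have "cmod (d \<theta> (E \<theta> y) (z' - E \<theta> z')) \<le> (Ke * (2 * CG + 1) * CD) * (F * (\<epsilon> * e))"
        proof -
          have "dn \<theta> (z' - E \<theta> z') = dn \<theta> (E \<theta> z' - z')" by (rule D.fnorm_minus_commute) auto
          also have "\<dots> \<le> Ke * norm \<theta> * dn 0 z'" by (rule E_near[OF \<theta>])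
          also have "\<dots> \<le> Ke * norm \<theta> * n0 z'"
            using dn0_le[OF H'(3)] Ke0 by (intro mult_left_mono) auto
          finally have ez': "dn \<theta> (z' - E \<theta> z') \<le> Ke * norm \<theta> * n0 z'" .
          have "cmod (d \<theta> (E \<theta> y) (z' - E \<theta> z')) \<le> dn \<theta> (E \<theta> y) * dn \<theta> (z' - E \<theta> z')"
            by (rule D.cauchy_schwarz) auto
          also have "\<dots> \<le> dn 0 y * (Ke * norm \<theta> * n0 z')"
            unfolding E_linear(3)[OF \<theta>] using ez' dn_ge_0[OF zero_in_\<Theta>] by (rule mult_left_mono)
          also have "\<dots> = Ke * dn 0 y * (norm \<theta> * n0 z')" by simp
          also have "\<dots> \<le> (Ke * (2 * CG + 1) * CD) * (F * (\<epsilon> * e))"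
            using Ke0 n' CG(1) F0 ny \<theta>z' by (intro mult_le_scaled) auto
          finally show ?thesis .
        qed
        moreover have "cmod (d \<theta> (z - E \<theta> z) z') \<le> ((Ke * K) * CG * cp) * ((\<epsilon> * F) * e)"
        proof -
          have "cmod (d \<theta> (z - E \<theta> z) z') \<le> dn \<theta> (z - E \<theta> z) * dn \<theta> z'"
            by (rule D.cauchy_schwarz) auto
          also have "\<dots> \<le> (Ke * (norm \<theta> * n0 z)) * (K * n0 z')"
            using Ez dn_le[OF \<theta> H'(3)] Ke0 z0 dn_ge_0[OF \<theta>] by (intro mult_mono) auto
          also have "\<dots> = (Ke * K) * (norm \<theta> * n0 z) * n0 z'" by simp
          also have "\<dots> \<le> ((Ke * K) * CG * cp) * ((\<epsilon> * F) * e)"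
            using Ke0 K0 n' CG(1) \<epsilon>F z\<theta> nz' by (intro mult_le_scaled) auto
          finally show ?thesis .
        qed
        ultimately show ?thesis
          using b_bound[OF \<theta> H(4) H'(3)] d_bound[OF \<theta> H(4) H'(3)] by (simp add: M2_def algebra_simps)
      qed
      moreover have "cmod R3 \<le> M3 * (\<epsilon> * F * e)"
      proof -
        have "cmod R3 \<le> cmod (complex_of_real (1 / \<epsilon>\<^sup>2) * a \<theta> U w) + cmod (b \<theta> U w) + cmod (d \<theta> U w)
            + cmod (d \<theta> (E \<theta> g) w)"
          unfolding R3_def
          by (intro order_trans[OF norm_triangle_ineq4] add_mono order_trans[OF norm_triangle_ineq] order_refl)
        moreover have "cmod (complex_of_real (1 / \<epsilon>\<^sup>2) * a \<theta> U w) \<le> (C1 * CG * CD) * (F * (\<epsilon> * e))"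
        proof -
          have "cmod (complex_of_real (1 / \<epsilon>\<^sup>2) * a \<theta> U w) = 1 / \<epsilon>\<^sup>2 * cmod (a \<theta> (z + N \<theta> z) w)"
            by (simp add: aE[OF H'(5)] norm_mult norm_divide norm_power)
          also have "\<dots> \<le> 1 / \<epsilon>\<^sup>2 * (C1 * (norm \<theta>)\<^sup>2 * n0 z * n0 w)"
            by (intro mult_left_mono C1(2)[OF \<theta> H(3) H'(5)]) simp
          also have "\<dots> = C1 * ((norm \<xi>)\<^sup>2 * n0 z) * n0 w"
            using \<epsilon> by (simp add: n\<theta> power_mult_distrib)
          also have "\<dots> \<le> (C1 * CG * CD) * (F * (\<epsilon> * e))"
            using C1(1) n' CG(1) F0 z1(2) nw by (intro mult_le_scaled) auto
          finally show ?thesis .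
        qed
        moreover have "K\<^sup>2 * n0 U * n0 w \<le> (K\<^sup>2 * (K * CG + CG + cn) * CD) * (F * (\<epsilon> * e))"
          using n' nU CG(1) K0 nn(3) F0 nw by (intro mult_le_scaled) auto
        moreover have "cmod (d \<theta> (E \<theta> g) w) \<le> (K * 1 * CD) * (F * (\<epsilon> * e))"
        proof -
          have "cmod (d \<theta> (E \<theta> g) w) \<le> dn \<theta> (E \<theta> g) * dn \<theta> w" by (rule D.cauchy_schwarz) auto
          also have "\<dots> \<le> F * (K * n0 w)"
            unfolding E_linear(3)[OF \<theta>] F_def[symmetric] using dn_le[OF \<theta> H'(5)] F0 by (rule mult_left_mono)
          also have "\<dots> = K * F * n0 w" by simp
          also have "\<dots> \<le> (K * 1 * CD) * (F * (\<epsilon> * e))"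
            using n' K0 F0 nw by (intro mult_le_scaled) auto
          finally show ?thesis .
        qed
        ultimately show ?thesis
          using b_bound[OF \<theta> U H'(5)] d_bound[OF \<theta> U H'(5)] by (simp add: M3_def algebra_simps)
      qed
      ultimately have "cmod (R1 + R2 + R3) \<le> M * (\<epsilon> * F * e)"
        using norm_triangle_ineq[of "R1 + R2" R3] norm_triangle_ineq[of R1 R2]
        by (simp add: M_def algebra_simps)
      then show "cmod (Lf \<epsilon> \<theta> U u + d \<theta> U u - d \<theta> (E \<theta> g) u) \<le> M * \<epsilon> * F * energy \<epsilon> \<theta> u"
        by (simp only: split e_def[symmetric] mult.assoc)
    qed
    \<comment> \<open>The price for passing from \<open>U\<close> back to E \<theta> (G g).\<close>
    moreover have "dn \<theta> ((z - E \<theta> z) + N \<theta> z) \<le> (Ke * CG + K * cn) * \<epsilon> * F"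
      using D.fnorm_triangle[of "z - E \<theta> z" "N \<theta> z"] Ez mult_left_mono[OF z\<theta> Ke0]
        dn_le[OF \<theta> H(4)] mult_left_mono[OF nN K0] by (simp add: algebra_simps)
    moreover have "T (E \<theta> g) - E \<theta> (G g) = (T (E \<theta> g) - U) + ((z - E \<theta> z) + N \<theta> z)"
      by (simp add: vz(3) E_linear(2)[OF \<theta>] U_def algebra_simps)
    then have "dn \<theta> (T (E \<theta> g) - E \<theta> (G g)) \<le> dn \<theta> (T (E \<theta> g) - U) + dn \<theta> ((z - E \<theta> z) + N \<theta> z)"
      by (simp only: D.fnorm_triangle UNIV_I)
    ultimately show ?thesis by (simp add: F_def algebra_simps)
  qed
  moreover have "0 \<le> M + (Ke * CG + K * cn)" using nn Ke0 CG K0 by simp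
  ultimately show ?thesis by blast
qed

text \<open>For large \<open>\<xi>\<close> the component in \<open>Z\<close> is negligible, and the resolvent is close to that of \<open>b 0\<close> on \<open>Vs\<close>.\<close>

lemma hom_resolvents_far_close:
  assumes \<rho>: "\<rho> > 0"
  shows "\<exists>C\<ge>0. \<forall>\<epsilon> \<xi> \<xi>' G G' g. 0 < \<epsilon> \<longrightarrow> \<epsilon> < 1 \<longrightarrow> \<rho> \<le> \<epsilon> * norm \<xi> \<longrightarrow> \<rho> \<le> \<epsilon> * norm \<xi>' \<longrightarrow>
    form_resolvent s (d 0) (V 0) (S \<xi>) G \<longrightarrow> form_resolvent s (d 0) (V 0) (S \<xi>') G' \<longrightarrow>
    dn 0 (G' g - G g) \<le> C * \<epsilon> * dn 0 g"
proof -
  obtain CG where CG: "CG \<ge> 0" "\<And>\<xi> G f. form_resolvent s (d 0) (V 0) (S \<xi>) G \<Longrightarrow>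
      \<exists>v\<in>Vs. \<exists>z\<in>Z. G f = v + z \<and> n0 v \<le> CG * dn 0 f \<and> (1 + (norm \<xi>)\<^sup>2) * n0 z \<le> CG * dn 0 f"
    using hom_resolvent_bounds by metis
  interpret B: pos_form s H "b 0" using pos_b zero_in_\<Theta> by blast
  interpret D: pos_form s UNIV "d 0" using pos_d zero_in_\<Theta> by blast
  define c where "c = CG / \<rho>\<^sup>2"
  have c: "0 \<le> c" using CG(1) by (simp add: c_def)
  have parts: "\<exists>v\<in>Vs. \<exists>z\<in>Z. G g = v + z \<and> n0 z \<le> c * (\<epsilon> * dn 0 g)"
    if G: "form_resolvent s (d 0) (V 0) (S \<xi>) G" and \<epsilon>: "0 < \<epsilon>" "\<epsilon> < 1" "\<rho> \<le> \<epsilon> * norm \<xi>" for \<xi> G g \<epsilon>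
  proof -
    obtain v z where vz: "v \<in> Vs" "z \<in> Z" "G g = v + z" "(1 + (norm \<xi>)\<^sup>2) * n0 z \<le> CG * dn 0 g"
      using CG(2)[OF G, of g] by blast
    have z0: "0 \<le> n0 z" by (rule n0_ge_0[OF Z_in[OF vz(2)]])
    \<comment> \<open>The decay in \<xi> even gives \<epsilon>^2; a single \<epsilon> is kept, using
      \<epsilon> < 1.\<close>
    have "\<rho>\<^sup>2 * n0 z \<le> (\<epsilon> * norm \<xi>)\<^sup>2 * n0 z"
      using \<rho> \<epsilon> z0 by (intro mult_right_mono power_mono) auto
    also have "\<dots> = \<epsilon>\<^sup>2 * ((norm \<xi>)\<^sup>2 * n0 z)" by (simp add: power_mult_distrib)
    also have "\<dots> \<le> \<epsilon>\<^sup>2 * (CG * dn 0 g)"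
      using vz(4) z0 by (intro mult_left_mono) (auto simp: algebra_simps)
    also have "\<dots> \<le> \<epsilon> * (CG * dn 0 g)"
      using \<epsilon> CG dn_ge_0[OF zero_in_\<Theta>, of g]
      by (intro mult_right_mono) (auto simp: power2_eq_square mult_left_le)
    finally have "n0 z \<le> c * (\<epsilon> * dn 0 g)"
      using \<rho> by (simp add: c_def field_simps)
    then show ?thesis using vz by blast
  qed
  have "dn 0 (G' g - G g) \<le> ((2 * K\<^sup>2 + 1) * (2 * c)) * \<epsilon> * dn 0 g"
    if \<epsilon>: "0 < \<epsilon>" "\<epsilon> < 1" and \<xi>: "\<rho> \<le> \<epsilon> * norm \<xi>" "\<rho> \<le> \<epsilon> * norm \<xi>'"
      and G: "form_resolvent s (d 0) (V 0) (S \<xi>) G" "form_resolvent s (d 0) (V 0) (S \<xi>') G'"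
    for \<epsilon> \<xi> \<xi>' G G' g
  proof -
    obtain v z where vz: "v \<in> Vs" "z \<in> Z" "G g = v + z" "n0 z \<le> c * (\<epsilon> * dn 0 g)"
      using parts[OF G(1) \<epsilon> \<xi>(1)] by blast
    obtain v' z' where vz': "v' \<in> Vs" "z' \<in> Z" "G' g = v' + z'" "n0 z' \<le> c * (\<epsilon> * dn 0 g)"
      using parts[OF G(2) \<epsilon> \<xi>(2)] by blast
    define y where "y = v' - v"
    define w where "w = z' - z"
    have y: "y \<in> Vs" using vz vz' Vs_subspace subspace_diff by (simp add: y_def)
    have H: "v \<in> H" "z \<in> H" "v' \<in> H" "z' \<in> H" "y \<in> H" "w \<in> H"
      using vz vz' y Vs_in Z_in by (auto simp: w_def intro: H_intros)
    \<comment> \<open>Test vectors in \<open>Vs\<close> do not see \<open>ah\<close>, so \<xi>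
      disappears from both equations and they can be subtracted.\<close>
    have "b 0 (v + z) y + d 0 (v + z) y = b 0 (v' + z') y + d 0 (v' + z') y"
      using hom_equation_Vs[OF G(1) vz(3,1,2) y] hom_equation_Vs[OF G(2) vz'(3,1,2) y] by metis
    then have "b 0 y y + d 0 y y = - (b 0 w y + d 0 w y)"
      using H by (simp add: y_def w_def B.form_add_left B.form_diff_left D.form_add_left D.form_diff_left
          H_intros algebra_simps)
    then have "Re (b 0 y y) + Re (d 0 y y) = Re (- (b 0 w y + d 0 w y))" by (simp flip: plus_complex.sel)
    also have "\<dots> \<le> cmod (b 0 w y) + cmod (d 0 w y)"
      using complex_Re_le_cmod[of "- (b 0 w y + d 0 w y)"] norm_triangle_ineq[of "b 0 w y" "d 0 w y"]
      by (simp only: norm_minus_cancel)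
    also have "\<dots> \<le> (2 * K\<^sup>2 * n0 w) * n0 y"
      using b_bound[OF zero_in_\<Theta> H(6,5)] d_bound[OF zero_in_\<Theta> H(6,5)] by simp
    finally have "1 * (n0 y)\<^sup>2 \<le> (2 * K\<^sup>2 * n0 w) * n0 y"
      using n0_sq_V0[OF Vs_sub[OF y]] D.form_self_ge_0[of y] by simp
    then have "1 * n0 y \<le> 2 * K\<^sup>2 * n0 w"
      by (rule mult_square_le_cancel) (use n0_ge_0 H in auto)
    moreover have "G' g - G g = y + w" by (simp add: vz vz' y_def w_def)
    ultimately have "dn 0 (G' g - G g) \<le> (2 * K\<^sup>2 + 1) * n0 w"
      using dn0_le[of "y + w"] n0_triangle[OF H(5,6)] H by (simp add: H_intros algebra_simps)
    also have "\<dots> \<le> (2 * K\<^sup>2 + 1) * (2 * (c * (\<epsilon> * dn 0 g)))"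
      using n0_triangle_diff[OF H(4,2)] vz(4) vz'(4) by (intro mult_left_mono) (auto simp: w_def)
    finally show ?thesis by (simp add: mult.assoc)
  qed
  moreover have "0 \<le> (2 * K\<^sup>2 + 1) * (2 * c)" using c by simp
  ultimately show ?thesis by blast
qed

text \<open>An intermediate \<xi>' = \<theta> / \<epsilon> reduces the claim to the matched estimate
  and to the closeness of two homogenised resolvents far from 0.\<close>

lemma resolvent_estimate_far:
  assumes \<rho>: "\<rho> > 0"
  shows "\<exists>C\<ge>0. \<forall>\<theta>\<in>\<Theta>. \<forall>\<epsilon> \<xi> T G g. \<rho> \<le> norm \<theta> \<longrightarrow> 0 < \<epsilon> \<longrightarrow> \<epsilon> < 1 \<longrightarrow> \<rho> \<le> \<epsilon> * norm \<xi> \<longrightarrow>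
    form_resolvent s (d \<theta>) H (Lf \<epsilon> \<theta>) T \<longrightarrow> form_resolvent s (d 0) (V 0) (S \<xi>) G \<longrightarrow>
    dn \<theta> (T (E \<theta> g) - E \<theta> (G g)) \<le> C * \<epsilon> * dn 0 g"
proof -
  obtain C1 where C1: "C1 \<ge> 0" "\<forall>\<theta>\<in>\<Theta>. \<forall>\<epsilon> \<xi> T G g. 0 < \<epsilon> \<longrightarrow> \<epsilon> < 1 \<longrightarrow> \<theta> = \<epsilon> *\<^sub>R \<xi> \<longrightarrow>
      form_resolvent s (d \<theta>) H (Lf \<epsilon> \<theta>) T \<longrightarrow> form_resolvent s (d 0) (V 0) (S \<xi>) G \<longrightarrow>
      dn \<theta> (T (E \<theta> g) - E \<theta> (G g)) \<le> C1 * \<epsilon> * dn 0 g"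
    using resolvent_estimate_near by blast
  obtain C2 where C2: "C2 \<ge> 0" "\<forall>\<epsilon> \<xi> \<xi>' G G' g. 0 < \<epsilon> \<longrightarrow> \<epsilon> < 1 \<longrightarrow> \<rho> \<le> \<epsilon> * norm \<xi> \<longrightarrow> \<rho> \<le> \<epsilon> * norm \<xi>' \<longrightarrow>
      form_resolvent s (d 0) (V 0) (S \<xi>) G \<longrightarrow> form_resolvent s (d 0) (V 0) (S \<xi>') G' \<longrightarrow>
      dn 0 (G' g - G g) \<le> C2 * \<epsilon> * dn 0 g"
    using hom_resolvents_far_close[OF \<rho>] by blast
  have "dn \<theta> (T (E \<theta> g) - E \<theta> (G g)) \<le> (C1 + C2) * \<epsilon> * dn 0 g"
    if \<theta>: "\<theta> \<in> \<Theta>" "\<rho> \<le> norm \<theta>" and \<epsilon>: "0 < \<epsilon>" "\<epsilon> < 1" and \<xi>: "\<rho> \<le> \<epsilon> * norm \<xi>"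
      and T: "form_resolvent s (d \<theta>) H (Lf \<epsilon> \<theta>) T" and G: "form_resolvent s (d 0) (V 0) (S \<xi>) G"
    for \<theta> \<epsilon> \<xi> T G g
  proof -
    interpret D: pos_form s UNIV "d \<theta>" using pos_d \<theta> by blast
    define \<xi>' where "\<xi>' = (1 / \<epsilon>) *\<^sub>R \<theta>"
    have \<xi>': "\<theta> = \<epsilon> *\<^sub>R \<xi>'" "\<rho> \<le> \<epsilon> * norm \<xi>'" using \<epsilon> \<theta> by (simp_all add: \<xi>'_def)
    obtain G' where G': "form_resolvent s (d 0) (V 0) (S \<xi>') G'" using hom_resolvent_exists by blast
    have "T (E \<theta> g) - E \<theta> (G g) = (T (E \<theta> g) - E \<theta> (G' g)) + E \<theta> (G' g - G g)"
      by (simp add: E_linear(1)[OF \<theta>(1)])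
    then have "dn \<theta> (T (E \<theta> g) - E \<theta> (G g)) \<le> dn \<theta> (T (E \<theta> g) - E \<theta> (G' g)) + dn \<theta> (E \<theta> (G' g - G g))"
      by (simp only: D.fnorm_triangle UNIV_I)
    moreover have "dn \<theta> (T (E \<theta> g) - E \<theta> (G' g)) \<le> C1 * \<epsilon> * dn 0 g"
      using C1(2)[rule_format, OF \<theta>(1) \<epsilon> \<xi>'(1) T G'] .
    moreover have "dn \<theta> (E \<theta> (G' g - G g)) \<le> C2 * \<epsilon> * dn 0 g"
      unfolding E_linear(3)[OF \<theta>(1)] using C2(2)[rule_format, OF \<epsilon> \<xi> \<xi>'(2) G G'] .
    ultimately show ?thesis by (simp add: algebra_simps)
  qed
  then show ?thesis using C1(1) C2(1) by (intro exI[of _ "C1 + C2"]) auto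
qed

end

section \<open>Distances between spectra\<close>

definition resolvent_spectrum :: "real set \<Rightarrow> complex set" where
  "resolvent_spectrum A = (\<lambda>\<tau>. complex_of_real (1 / \<tau> - 1)) ` {\<tau> \<in> A. \<tau> > 0}"

text \<open>Here 1 + |\<mu>| = 1 / \<tau>, so the smallness condition says \<delta> \<le> \<tau> /
  2. This forces \<sigma> \<ge> \<tau> / 2, and then |\<sigma> - \<tau>| / (\<tau> \<sigma>) \<le> 2
  \<delta> / \<tau>^2.\<close>

lemma resolvent_spectrum_close:
  assumes A: "\<And>\<tau>. \<tau> \<in> A \<Longrightarrow> \<tau> \<le> 1"
    and close: "\<And>\<tau>. \<tau> \<in> A \<Longrightarrow> \<exists>\<sigma>\<in>B. \<bar>\<sigma> - \<tau>\<bar> \<le> \<delta>"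
    and \<mu>: "\<mu> \<in> resolvent_spectrum A" and \<delta>: "0 \<le> \<delta>" "\<delta> * (1 + cmod \<mu>) \<le> 1 / 2"
  shows "\<exists>\<nu>\<in>resolvent_spectrum B. cmod (\<mu> - \<nu>) \<le> 2 * \<delta> * (1 + cmod \<mu>)\<^sup>2"
proof -
  obtain \<tau> where \<tau>: "\<tau> \<in> A" "\<tau> > 0" "\<mu> = complex_of_real (1 / \<tau> - 1)"
    using \<mu> unfolding resolvent_spectrum_def by blast
  obtain \<sigma> where \<sigma>: "\<sigma> \<in> B" "\<bar>\<sigma> - \<tau>\<bar> \<le> \<delta>" using close[OF \<tau>(1)] by blast
  have "0 \<le> 1 / \<tau> - 1" using A[OF \<tau>(1)] \<tau>(2) by simp
  then have c: "1 + cmod \<mu> = 1 / \<tau>" unfolding \<tau>(3) norm_of_real by simp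
  have \<sigma>\<tau>: "\<tau> / 2 \<le> \<sigma>" using \<delta>(2) \<sigma>(2) \<tau>(2) unfolding c by (simp add: field_simps)
  then have \<sigma>0: "\<sigma> > 0" using \<tau>(2) by simp
  have "\<mu> - complex_of_real (1 / \<sigma> - 1) = complex_of_real (1 / \<tau> - 1 / \<sigma>)"
    unfolding \<tau>(3) by simp
  then have "cmod (\<mu> - complex_of_real (1 / \<sigma> - 1)) = \<bar>1 / \<tau> - 1 / \<sigma>\<bar>" by (simp only: norm_of_real)
  also have "1 / \<tau> - 1 / \<sigma> = (\<sigma> - \<tau>) / (\<tau> * \<sigma>)" using \<tau>(2) \<sigma>0 by (simp add: field_simps)
  also have "\<bar>\<dots>\<bar> \<le> \<delta> / (\<tau> * (\<tau> / 2))"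
    using \<sigma>(2) \<sigma>\<tau> \<tau>(2) \<sigma>0 by (simp only: abs_divide abs_mult abs_of_pos) (intro frac_le mult_left_mono, auto)
  also have "\<dots> = 2 * \<delta> * (1 + cmod \<mu>)\<^sup>2"
    unfolding c by (simp add: power2_eq_square)
  finally show ?thesis using \<sigma>(1) \<sigma>0 unfolding resolvent_spectrum_def by blast
qed

lemma eventually_at_right_small:
  fixes k \<eta> :: real
  assumes "\<eta> > 0"
  shows "eventually (\<lambda>\<epsilon>. 0 < \<epsilon> \<and> \<epsilon> < 1 \<and> k * \<epsilon> < \<eta>) (at_right 0)"
proof -
  have "k * \<epsilon> < \<eta>" if "0 < \<epsilon>" "\<epsilon> < \<eta> / (\<bar>k\<bar> + 1)" for \<epsilon>
  proof -
    have "k * \<epsilon> \<le> (\<bar>k\<bar> + 1) * \<epsilon>" using that(1) by (intro mult_right_mono) auto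
    also have "\<dots> < \<eta>" using that(2) by (simp add: pos_less_divide_eq mult.commute)
    finally show ?thesis .
  qed
  moreover have "min 1 (\<eta> / (\<bar>k\<bar> + 1)) > 0" using assms by simp
  ultimately show ?thesis
    unfolding eventually_at_right_field by (intro exI[of _ "min 1 (\<eta> / (\<bar>k\<bar> + 1))"]) auto
qed

text \<open>Both sides of the estimate are continuous in x, so it passes to limits.\<close>

lemma infdist_closure_quadratic:
  fixes X Y :: "complex set"
  assumes "\<And>x. x \<in> X \<Longrightarrow> infdist x Y \<le> k * (1 + cmod x)\<^sup>2" and x: "x \<in> closure X" and "Y \<noteq> {}"
  shows "infdist x (closure Y) \<le> k * (1 + cmod x)\<^sup>2"
proof -
  have "closed {x. infdist x Y \<le> k * (1 + cmod x)\<^sup>2}"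
    by (intro closed_Collect_le continuous_intros)
  then have "closure X \<subseteq> {x. infdist x Y \<le> k * (1 + cmod x)\<^sup>2}"
    using assms(1) by (intro closure_minimal) auto
  then have "infdist x Y \<le> k * (1 + cmod x)\<^sup>2" using x by blast
  moreover have "infdist x (closure Y) \<le> infdist x Y"
    by (rule infdist_mono[OF closure_subset assms(3)])
  ultimately show ?thesis by linarith
qed

text \<open>Points with non-negative real part in the interval have modulus at most \<beta>,
  whatever the left end point. This is why the final constant does not depend on \<alpha>.\<close>

lemma semidist_interval_le:
  assumes bd: "\<And>x. x \<in> X \<Longrightarrow> infdist x Y \<le> k * (1 + cmod x)\<^sup>2" and k: "0 \<le> k"
    and nn: "\<And>x. x \<in> X \<Longrightarrow> 0 \<le> Re x"
  shows "semidist (complex_of_real ` {\<alpha>..\<beta>} \<inter> X) Y \<le> ereal (2 * k * (1 + \<beta>\<^sup>2))"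
proof -
  have pos: "0 \<le> 2 * k * (1 + \<beta>\<^sup>2)" using k by simp
  have "infdist x Y \<le> 2 * k * (1 + \<beta>\<^sup>2)" if x: "x \<in> complex_of_real ` {\<alpha>..\<beta>} \<inter> X" for x
  proof -
    obtain t where t: "x = complex_of_real t" "t \<le> \<beta>" using x by auto
    have t0: "0 \<le> t" using nn[of x] x t by simp
    have "(1 + cmod x)\<^sup>2 \<le> (1 + \<beta>)\<^sup>2" using t t0 by (intro power_mono) auto
    also have "\<dots> \<le> 2 * (1 + \<beta>\<^sup>2)"
      using sum_squares_bound[of 1 \<beta>] by (simp add: power2_sum)
    finally have "k * (1 + cmod x)\<^sup>2 \<le> k * (2 * (1 + \<beta>\<^sup>2))" using k by (rule mult_left_mono)
    also have "k * (2 * (1 + \<beta>\<^sup>2)) = 2 * k * (1 + \<beta>\<^sup>2)" by simp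
    finally show ?thesis using order_trans[OF bd[of x]] x by blast
  qed
  then show ?thesis using pos by (auto simp: semidist_def intro!: SUP_least)
qed

text \<open>Convergence need only be tested on the subbase: eventual membership passes to finite
  intersections and to unions.\<close>

lemma limitin_fell_topology:
  assumes "\<And>K. compact K \<Longrightarrow> F \<inter> K = {} \<Longrightarrow> eventually (\<lambda>x. f x \<inter> K = {}) A"
    and "\<And>U. open U \<Longrightarrow> F \<inter> U \<noteq> {} \<Longrightarrow> eventually (\<lambda>x. f x \<inter> U \<noteq> {}) A"
    and "closed F" "\<And>x. closed (f x)"
  shows "limitin fell_topology f F A"
  unfolding limitin_def
proof (intro conjI allI impI)
  show "F \<in> topspace fell_topology"
    unfolding fell_topology_def topology_generated_by_topspace
  proof (rule UnionI)
    show "{F. closed F \<and> F \<inter> {} = {}} \<in> {{F. closed F \<and> F \<inter> K = {}} | K. compact K} \<union>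
        {{F. closed F \<and> F \<inter> U \<noteq> {}} | U. open U}"
      by (intro UnI1 CollectI exI[of _ "{}"]) simp
  qed (use assms(3) in simp)
  fix U assume U: "openin fell_topology U \<and> F \<in> U"
  have "generate_topology_on ({{F. closed F \<and> F \<inter> K = {}} | K. compact K} \<union>
      {{F. closed F \<and> F \<inter> U \<noteq> {}} | U. open U}) U"
    using U by (simp add: fell_topology_def openin_topology_generated_by_iff)
  then have "F \<in> U \<longrightarrow> eventually (\<lambda>x. f x \<in> U) A"
  proof (induction rule: generate_topology_on.induct)
    case (UN \<K>)
    then show ?case by (blast intro: eventually_mono)
  next
    case (Basis B)
    then consider K where "compact K" "B = {F. closed F \<and> F \<inter> K = {}}"
      | V where "open V" "B = {F. closed F \<and> F \<inter> V \<noteq> {}}" by blast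
    then show ?case using assms by cases auto
  qed (auto intro: eventually_conj)
  then show "eventually (\<lambda>x. f x \<in> U) A" using U by blast
qed

text \<open>The closeness conditions carry a smallness condition because closeness in \<tau> = 1 /
  (1 + \<lambda>) says little about large \<lambda>. For those, \<open>reference\<close> provides
  points of modulus bounded uniformly in \<epsilon>.\<close>

locale close_spectra =
  fixes \<Lambda> :: "real \<Rightarrow> complex set" and \<Lambda>0 :: "complex set" and C :: real
  assumes C0: "C \<ge> 0"
    and close: "0 < \<epsilon> \<Longrightarrow> \<epsilon> < 1 \<Longrightarrow> \<mu> \<in> \<Lambda> \<epsilon> \<Longrightarrow> C * \<epsilon> * (1 + cmod \<mu>) \<le> 1 / 2 \<Longrightarrow>
      \<exists>\<nu>\<in>\<Lambda>0. cmod (\<mu> - \<nu>) \<le> 2 * (C * \<epsilon>) * (1 + cmod \<mu>)\<^sup>2"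
    and close0: "0 < \<epsilon> \<Longrightarrow> \<epsilon> < 1 \<Longrightarrow> \<nu> \<in> \<Lambda>0 \<Longrightarrow> C * \<epsilon> * (1 + cmod \<nu>) \<le> 1 / 2 \<Longrightarrow>
      \<exists>\<mu>\<in>\<Lambda> \<epsilon>. cmod (\<nu> - \<mu>) \<le> 2 * (C * \<epsilon>) * (1 + cmod \<nu>)\<^sup>2"
    and nonneg: "0 < \<epsilon> \<Longrightarrow> \<epsilon> < 1 \<Longrightarrow> \<mu> \<in> \<Lambda> \<epsilon> \<Longrightarrow> 0 \<le> Re \<mu>" "\<nu> \<in> \<Lambda>0 \<Longrightarrow> 0 \<le> Re \<nu>"
    and reference: "\<Lambda>0 \<noteq> {} \<Longrightarrow> \<exists>M. \<forall>\<epsilon>. 0 < \<epsilon> \<longrightarrow> \<epsilon> < 1 \<longrightarrow> (\<exists>\<mu>\<in>\<Lambda> \<epsilon>. cmod \<mu> \<le> M)"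
begin

text \<open>Where \<open>C \<epsilon> (1 + |\<mu>|)\<close> is not small, any reference point of the other set is close enough.\<close>

lemma infdist_bound:
  assumes "\<Lambda>0 \<noteq> {}"
  shows "\<exists>k\<ge>0. \<forall>\<epsilon>. 0 < \<epsilon> \<longrightarrow> \<epsilon> < 1 \<longrightarrow> \<Lambda> \<epsilon> \<noteq> {} \<and>
    (\<forall>\<mu>\<in>\<Lambda> \<epsilon>. infdist \<mu> \<Lambda>0 \<le> k * \<epsilon> * (1 + cmod \<mu>)\<^sup>2) \<and>
    (\<forall>\<nu>\<in>\<Lambda>0. infdist \<nu> (\<Lambda> \<epsilon>) \<le> k * \<epsilon> * (1 + cmod \<nu>)\<^sup>2)"
proof -
  obtain \<nu>0 where \<nu>0: "\<nu>0 \<in> \<Lambda>0" using assms by blast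
  obtain M where M: "\<And>\<epsilon>. 0 < \<epsilon> \<Longrightarrow> \<epsilon> < 1 \<Longrightarrow> \<exists>\<mu>\<in>\<Lambda> \<epsilon>. cmod \<mu> \<le> M"
    using reference[OF assms] by blast
  \<comment> \<open>A common bound for the reference points of both sets.\<close>
  define D where "D = max (cmod \<nu>0) M"
  have D0: "0 \<le> D" by (simp add: D_def le_max_iff_disj)
  have est: "infdist x Y \<le> 2 * C * (1 + D) * \<epsilon> * (1 + cmod x)\<^sup>2"
    if y: "y \<in> Y" "cmod y \<le> D" and \<epsilon>: "0 < \<epsilon>"
      and near: "C * \<epsilon> * (1 + cmod x) \<le> 1 / 2 \<Longrightarrow> \<exists>z\<in>Y. cmod (x - z) \<le> 2 * (C * \<epsilon>) * (1 + cmod x)\<^sup>2"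
    for x y :: complex and Y \<epsilon>
  proof (cases "C * \<epsilon> * (1 + cmod x) \<le> 1 / 2")
    case True
    then obtain z where "z \<in> Y" "cmod (x - z) \<le> 2 * (C * \<epsilon>) * (1 + cmod x)\<^sup>2" using near by blast
    then have "infdist x Y \<le> 2 * (C * \<epsilon>) * (1 + cmod x)\<^sup>2"
      using infdist_le[of z Y x] by (simp add: dist_norm)
    also have "\<dots> \<le> (1 + D) * (2 * (C * \<epsilon>) * (1 + cmod x)\<^sup>2)"
      using D0 C0 \<epsilon> mult_right_mono[of 1 "1 + D" "2 * (C * \<epsilon>) * (1 + cmod x)\<^sup>2"] by simp
    finally show ?thesis by (simp add: algebra_simps)
  next
    case False
    have "infdist x Y \<le> cmod (x - y)"
      using infdist_le[OF y(1), of x] by (simp add: dist_norm)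
    also have "\<dots> \<le> cmod x + D" using norm_triangle_ineq4[of x y] y(2) by simp
    also have "\<dots> \<le> (1 + D) * (1 + cmod x)" using D0 by (simp add: algebra_simps)
    \<comment> \<open>Without smallness 2 C \<epsilon> (1 + |x|) is at least 1, and inserting it as
      a factor produces both \<epsilon> and the second power of 1 + |x|.\<close>
    also have "\<dots> \<le> (1 + D) * (1 + cmod x) * (2 * (C * \<epsilon> * (1 + cmod x)))"
      using False D0 mult_left_mono[of 1 "2 * (C * \<epsilon> * (1 + cmod x))" "(1 + D) * (1 + cmod x)"] by simp
    finally show ?thesis by (simp add: power2_eq_square algebra_simps)
  qed
  show ?thesis
  proof (intro exI[of _ "2 * C * (1 + D)"] conjI allI impI ballI)
    show "0 \<le> 2 * C * (1 + D)" using C0 D0 by simp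
    fix \<epsilon> :: real assume \<epsilon>: "0 < \<epsilon>" "\<epsilon> < 1"
    show "\<Lambda> \<epsilon> \<noteq> {}" using M[OF \<epsilon>] by blast
    show "infdist \<mu> \<Lambda>0 \<le> 2 * C * (1 + D) * \<epsilon> * (1 + cmod \<mu>)\<^sup>2" if "\<mu> \<in> \<Lambda> \<epsilon>" for \<mu>
      using \<nu>0 \<epsilon> close that by (intro est[of \<nu>0]) (auto simp: D_def)
    show "infdist \<nu> (\<Lambda> \<epsilon>) \<le> 2 * C * (1 + D) * \<epsilon> * (1 + cmod \<nu>)\<^sup>2" if "\<nu> \<in> \<Lambda>0" for \<nu>
    proof -
      obtain \<mu> where "\<mu> \<in> \<Lambda> \<epsilon>" "cmod \<mu> \<le> M" using M[OF \<epsilon>] by blast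
      then show ?thesis using \<epsilon> close0 that by (intro est[of \<mu>]) (auto simp: D_def)
    qed
  qed
qed

lemma closure_nonneg:
  "0 < \<epsilon> \<Longrightarrow> \<epsilon> < 1 \<Longrightarrow> \<mu> \<in> closure (\<Lambda> \<epsilon>) \<Longrightarrow> 0 \<le> Re \<mu>" "\<nu> \<in> closure \<Lambda>0 \<Longrightarrow> 0 \<le> Re \<nu>"
proof -
  have cl: "closed {x. 0 \<le> Re x}" by (intro closed_Collect_le continuous_intros)
  show "0 < \<epsilon> \<Longrightarrow> \<epsilon> < 1 \<Longrightarrow> \<mu> \<in> closure (\<Lambda> \<epsilon>) \<Longrightarrow> 0 \<le> Re \<mu>"
    using closure_minimal[OF _ cl, of "\<Lambda> \<epsilon>"] nonneg(1) by blast
  show "\<nu> \<in> closure \<Lambda>0 \<Longrightarrow> 0 \<le> Re \<nu>"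
    using closure_minimal[OF _ cl, of \<Lambda>0] nonneg(2) by blast
qed

lemma dist_interval_bound:
  "\<exists>C. \<forall>\<beta>::real. \<exists>C\<^sub>b \<le> C * (1 + \<beta>\<^sup>2). \<forall>\<alpha> \<epsilon>. \<alpha> \<le> \<beta> \<longrightarrow> 0 < \<epsilon> \<longrightarrow> \<epsilon> < 1 \<longrightarrow>
     dist_interval \<alpha> \<beta> (closure (\<Lambda> \<epsilon>)) (closure \<Lambda>0) \<le> ereal (C\<^sub>b * \<epsilon>)"
proof (cases "\<Lambda>0 = {}")
  case True
  \<comment> \<open>With an empty limit set both semidistances are 0 by convention.\<close>
  then show ?thesis by (intro exI[of _ 0]) (auto simp: dist_interval_def semidist_def)
next
  case False
  obtain k where k: "k \<ge> 0" "\<And>\<epsilon>. 0 < \<epsilon> \<Longrightarrow> \<epsilon> < 1 \<Longrightarrow> \<Lambda> \<epsilon> \<noteq> {}"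
    "\<And>\<epsilon> \<mu>. 0 < \<epsilon> \<Longrightarrow> \<epsilon> < 1 \<Longrightarrow> \<mu> \<in> \<Lambda> \<epsilon> \<Longrightarrow> infdist \<mu> \<Lambda>0 \<le> k * \<epsilon> * (1 + cmod \<mu>)\<^sup>2"
    "\<And>\<epsilon> \<nu>. 0 < \<epsilon> \<Longrightarrow> \<epsilon> < 1 \<Longrightarrow> \<nu> \<in> \<Lambda>0 \<Longrightarrow> infdist \<nu> (\<Lambda> \<epsilon>) \<le> k * \<epsilon> * (1 + cmod \<nu>)\<^sup>2"
    using infdist_bound[OF False] by metis
  have "dist_interval \<alpha> \<beta> (closure (\<Lambda> \<epsilon>)) (closure \<Lambda>0) \<le> ereal (2 * k * (1 + \<beta>\<^sup>2) * \<epsilon>)"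
    if \<epsilon>: "0 < \<epsilon>" "\<epsilon> < 1" for \<alpha> \<beta> \<epsilon>
  proof -
    have k\<epsilon>: "0 \<le> k * \<epsilon>" using k(1) \<epsilon> by simp
    have eq: "2 * k * (1 + \<beta>\<^sup>2) * \<epsilon> = 2 * (k * \<epsilon>) * (1 + \<beta>\<^sup>2)" by simp
    show ?thesis
      unfolding dist_interval_def eq
    proof (intro max.boundedI semidist_interval_le k\<epsilon>)
      show "infdist x (closure \<Lambda>0) \<le> k * \<epsilon> * (1 + cmod x)\<^sup>2" if "x \<in> closure (\<Lambda> \<epsilon>)" for x
        using infdist_closure_quadratic[OF k(3)[OF \<epsilon>] that False] .
      show "infdist x (closure (\<Lambda> \<epsilon>)) \<le> k * \<epsilon> * (1 + cmod x)\<^sup>2" if "x \<in> closure \<Lambda>0" for x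
        using infdist_closure_quadratic[OF k(4)[OF \<epsilon>] that k(2)[OF \<epsilon>]] .
    qed (use closure_nonneg \<epsilon> in auto)
  qed
  then show ?thesis by (intro exI[of _ "2 * k"] allI exI[of _ "2 * k * (1 + _\<^sup>2)"]) auto
qed

text \<open>Derived from the pointwise closeness instead of the distance bound, which carries no
  information when the limit set is empty.\<close>

lemma fell_convergence: "limitin fell_topology (\<lambda>\<epsilon>. closure (\<Lambda> \<epsilon>)) (closure \<Lambda>0) (at_right 0)"
proof (rule limitin_fell_topology)
  fix K :: "complex set" assume K: "compact K" "closure \<Lambda>0 \<inter> K = {}"
  obtain B where B: "B > 0" "\<And>x. x \<in> K \<Longrightarrow> cmod x \<le> B"
    using compact_imp_bounded[OF K(1)] by (auto simp: bounded_pos)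
  obtain \<eta> where \<eta>: "\<eta> > 0" "\<And>x y. x \<in> K \<Longrightarrow> y \<in> closure \<Lambda>0 \<Longrightarrow> \<eta> \<le> dist x y"
    using separate_compact_closed[OF K(1) closed_closure, of \<Lambda>0] K(2) by (auto simp: Int_commute)
  \<comment> \<open>2 + B bounds 1 + |\<mu>| for every \<mu> within distance 1 of \<open>K\<close>,
    as needed to replace a point of the closure by one of the set.\<close>
  have "eventually (\<lambda>\<epsilon>. (0 < \<epsilon> \<and> \<epsilon> < 1 \<and> (C * (2 + B)) * \<epsilon> < 1 / 2) \<and>
      (0 < \<epsilon> \<and> \<epsilon> < 1 \<and> (2 * C * (2 + B)\<^sup>2) * \<epsilon> < \<eta> / 2)) (at_right 0)"
    using \<eta>(1) by (intro eventually_conj eventually_at_right_small) auto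
  then show "eventually (\<lambda>\<epsilon>. closure (\<Lambda> \<epsilon>) \<inter> K = {}) (at_right 0)"
  proof (rule eventually_mono)
    fix \<epsilon> assume *: "(0 < \<epsilon> \<and> \<epsilon> < 1 \<and> (C * (2 + B)) * \<epsilon> < 1 / 2) \<and>
      (0 < \<epsilon> \<and> \<epsilon> < 1 \<and> (2 * C * (2 + B)\<^sup>2) * \<epsilon> < \<eta> / 2)"
    then have C\<epsilon>: "0 \<le> C * \<epsilon>" using C0 by simp
    show "closure (\<Lambda> \<epsilon>) \<inter> K = {}"
    proof (rule ccontr)
      assume "closure (\<Lambda> \<epsilon>) \<inter> K \<noteq> {}"
      then obtain x where x: "x \<in> closure (\<Lambda> \<epsilon>)" "x \<in> K" by blast
      have "min 1 (\<eta> / 2) > 0" using \<eta>(1) by simp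
      then obtain \<mu> where \<mu>: "\<mu> \<in> \<Lambda> \<epsilon>" "dist \<mu> x < min 1 (\<eta> / 2)"
        using x(1) unfolding closure_approachable by blast
      have "cmod \<mu> \<le> B + 1"
        using \<mu>(2) B(2)[OF x(2)] norm_triangle_ineq2[of \<mu> x] by (simp add: dist_norm)
      then have m: "1 + cmod \<mu> \<le> 2 + B" by simp
      have "C * \<epsilon> * (1 + cmod \<mu>) \<le> C * \<epsilon> * (2 + B)" using m C\<epsilon> by (rule mult_left_mono)
      also have "\<dots> \<le> 1 / 2" using * by (simp add: mult_ac)
      finally obtain \<nu> where \<nu>: "\<nu> \<in> \<Lambda>0" "cmod (\<mu> - \<nu>) \<le> 2 * (C * \<epsilon>) * (1 + cmod \<mu>)\<^sup>2"
        using close[OF _ _ \<mu>(1)] * by blast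
      note \<nu>(2)
      also have "2 * (C * \<epsilon>) * (1 + cmod \<mu>)\<^sup>2 \<le> 2 * (C * \<epsilon>) * (2 + B)\<^sup>2"
        using m C\<epsilon> by (intro mult_left_mono power_mono) auto
      also have "\<dots> < \<eta> / 2" using * by (simp add: mult_ac)
      finally have "dist \<mu> \<nu> < \<eta> / 2" by (simp add: dist_norm)
      then have "dist x \<nu> < \<eta>"
        using dist_triangle[of x \<nu> \<mu>] \<mu>(2) by (simp add: dist_commute)
      moreover have "\<eta> \<le> dist x \<nu>" using \<eta>(2)[OF x(2)] \<nu>(1) closure_subset by blast
      ultimately show False by simp
    qed
  qed
next
  fix U :: "complex set" assume U: "open U" "closure \<Lambda>0 \<inter> U \<noteq> {}"
  then obtain \<nu> where \<nu>: "\<nu> \<in> \<Lambda>0" "\<nu> \<in> U"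
    using open_Int_closure_eq_empty[OF U(1), of \<Lambda>0] by blast
  obtain \<eta> where \<eta>: "\<eta> > 0" "ball \<nu> \<eta> \<subseteq> U" using U(1) \<nu>(2) by (auto simp: open_contains_ball)
  have "eventually (\<lambda>\<epsilon>. (0 < \<epsilon> \<and> \<epsilon> < 1 \<and> (C * (1 + cmod \<nu>)) * \<epsilon> < 1 / 2) \<and>
      (0 < \<epsilon> \<and> \<epsilon> < 1 \<and> (2 * C * (1 + cmod \<nu>)\<^sup>2) * \<epsilon> < \<eta>)) (at_right 0)"
    using \<eta>(1) by (intro eventually_conj eventually_at_right_small) auto
  then show "eventually (\<lambda>\<epsilon>. closure (\<Lambda> \<epsilon>) \<inter> U \<noteq> {}) (at_right 0)"
  proof (rule eventually_mono)
    fix \<epsilon> assume *: "(0 < \<epsilon> \<and> \<epsilon> < 1 \<and> (C * (1 + cmod \<nu>)) * \<epsilon> < 1 / 2) \<and>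
      (0 < \<epsilon> \<and> \<epsilon> < 1 \<and> (2 * C * (1 + cmod \<nu>)\<^sup>2) * \<epsilon> < \<eta>)"
    have "C * \<epsilon> * (1 + cmod \<nu>) \<le> 1 / 2" using * by (simp add: mult_ac)
    then obtain \<mu> where \<mu>: "\<mu> \<in> \<Lambda> \<epsilon>" "cmod (\<nu> - \<mu>) \<le> 2 * (C * \<epsilon>) * (1 + cmod \<nu>)\<^sup>2"
      using close0[OF _ _ \<nu>(1)] * by blast
    note \<mu>(2)
    also have "2 * (C * \<epsilon>) * (1 + cmod \<nu>)\<^sup>2 < \<eta>" using * by (simp add: mult_ac)
    finally have "\<mu> \<in> U" using \<eta>(2) by (auto simp: dist_norm)
    then show "closure (\<Lambda> \<epsilon>) \<inter> U \<noteq> {}" using \<mu>(1) closure_subset by blast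
  qed
qed auto

end

section \<open>Closeness of the spectra of the two families\<close>

context two_scale begin

lemma spectra_close:
  assumes X: "subspace X" "V 0 \<subseteq> X"
  shows "\<exists>C. close_spectra (\<lambda>\<epsilon>. \<Union>\<theta>\<in>\<Theta>. spectrum s UNIV (d \<theta>) (L_op H a b d \<epsilon> \<theta>))
    (\<Union>\<xi>. spectrum s X (d 0) (form_operator X (d 0) (V 0) (S \<xi>))) C"
proof -
  have "\<forall>\<epsilon> \<theta>. \<exists>T. \<theta> \<in> \<Theta> \<longrightarrow> 0 < \<epsilon> \<longrightarrow> \<epsilon> < 1 \<longrightarrow> form_resolvent s (d \<theta>) H (Lf \<epsilon> \<theta>) T"
    using Lf_resolvent_exists by blast
  then obtain T where T: "\<And>\<epsilon> \<theta>. \<theta> \<in> \<Theta> \<Longrightarrow> 0 < \<epsilon> \<Longrightarrow> \<epsilon> < 1 \<Longrightarrow> form_resolvent s (d \<theta>) H (Lf \<epsilon> \<theta>) (T \<epsilon> \<theta>)"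
    by metis
  obtain G where G: "\<And>\<xi>. form_resolvent s (d 0) (V 0) (S \<xi>) (G \<xi>)"
    using hom_resolvent_exists by metis
  define AT where "AT \<epsilon> \<theta> = approx_spectrum s (d \<theta>) (T \<epsilon> \<theta>)" for \<epsilon> \<theta>
  define AG where "AG \<xi> = approx_spectrum s (d 0) (G \<xi>)" for \<xi>
  have AT1: "\<tau> \<le> 1" if "\<theta> \<in> \<Theta>" "0 < \<epsilon>" "\<epsilon> < 1" "\<tau> \<in> AT \<epsilon> \<theta>" for \<epsilon> \<theta> \<tau>
    using form_resolvent.approx_spectrum_range(2)[OF T] that by (simp add: AT_def)
  have AG1: "\<tau> \<le> 1" if "\<tau> \<in> AG \<xi>" for \<xi> \<tau>
    using form_resolvent.approx_spectrum_range(2)[OF G] that by (simp add: AG_def)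
  have spT: "spectrum s UNIV (d \<theta>) (L_op H a b d \<epsilon> \<theta>) = resolvent_spectrum (AT \<epsilon> \<theta>)"
    if "\<theta> \<in> \<Theta>" "0 < \<epsilon>" "\<epsilon> < 1" for \<epsilon> \<theta>
    using form_resolvent.spectrum_form_operator[OF T[OF that], of UNIV]
    by (simp only: L_op_def resolvent_spectrum_def AT_def subspace_UNIV subset_UNIV)
  have spG: "spectrum s X (d 0) (form_operator X (d 0) (V 0) (S \<xi>)) = resolvent_spectrum (AG \<xi>)" for \<xi>
    unfolding form_resolvent.spectrum_form_operator[OF G X(2,1)] by (simp only: resolvent_spectrum_def AG_def)
  obtain Cn where Cn0: "Cn \<ge> 0" "\<forall>\<theta>\<in>\<Theta>. \<forall>\<epsilon> \<xi> T G g. 0 < \<epsilon> \<longrightarrow> \<epsilon> < 1 \<longrightarrow> \<theta> = \<epsilon> *\<^sub>R \<xi> \<longrightarrow>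
      form_resolvent s (d \<theta>) H (Lf \<epsilon> \<theta>) T \<longrightarrow> form_resolvent s (d 0) (V 0) (S \<xi>) G \<longrightarrow>
      dn \<theta> (T (E \<theta> g) - E \<theta> (G g)) \<le> Cn * \<epsilon> * dn 0 g"
    using resolvent_estimate_near by blast
  have Cn: "dn \<theta> (T \<epsilon> \<theta> (E \<theta> g) - E \<theta> (G \<xi> g)) \<le> Cn * \<epsilon> * dn 0 g"
    if "\<theta> \<in> \<Theta>" "0 < \<epsilon>" "\<epsilon> < 1" "\<theta> = \<epsilon> *\<^sub>R \<xi>" for \<theta> \<epsilon> \<xi> g
    using Cn0(2)[rule_format, OF that T[OF that(1-3)] G] .
  obtain Cf where Cf0: "Cf \<ge> 0" "\<forall>\<theta>\<in>\<Theta>. \<forall>\<epsilon> \<xi> T G g. r \<le> norm \<theta> \<longrightarrow> 0 < \<epsilon> \<longrightarrow> \<epsilon> < 1 \<longrightarrow>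
      r \<le> \<epsilon> * norm \<xi> \<longrightarrow>
      form_resolvent s (d \<theta>) H (Lf \<epsilon> \<theta>) T \<longrightarrow> form_resolvent s (d 0) (V 0) (S \<xi>) G \<longrightarrow>
      dn \<theta> (T (E \<theta> g) - E \<theta> (G g)) \<le> Cf * \<epsilon> * dn 0 g"
    using resolvent_estimate_far[OF r_pos] by blast
  have Cf: "dn \<theta> (T \<epsilon> \<theta> (E \<theta> g) - E \<theta> (G \<xi> g)) \<le> Cf * \<epsilon> * dn 0 g"
    if "\<theta> \<in> \<Theta>" "r \<le> norm \<theta>" "0 < \<epsilon>" "\<epsilon> < 1" "r \<le> \<epsilon> * norm \<xi>" for \<theta> \<epsilon> \<xi> g
    using Cf0(2)[rule_format, OF that T[OF that(1,3,4)] G] .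
  \<comment> \<open>The summand 1 makes the tolerance strictly positive, as the transfer of
    approximate spectra requires.\<close>
  define C where "C = Cn + Cf + 1"
  have C: "C > 0" using Cn0(1) Cf0(1) by (simp add: C_def)
  \<comment> \<open>The pairs to which the near or the far estimate applies; every \<theta> and
    every \<xi> has a partner.\<close>
  define matched where "matched \<epsilon> \<theta> \<xi> \<longleftrightarrow> \<theta> \<in> \<Theta> \<and> (\<theta> = \<epsilon> *\<^sub>R \<xi> \<or> r \<le> norm \<theta> \<and> r \<le> \<epsilon> * norm \<xi>)"
    for \<epsilon> \<theta> \<xi>
  have transfer: "(\<forall>\<sigma>\<in>AG \<xi>. \<exists>\<tau>\<in>AT \<epsilon> \<theta>. \<bar>\<tau> - \<sigma>\<bar> \<le> 2 * (C * \<epsilon>)) \<and>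
      (\<forall>\<tau>\<in>AT \<epsilon> \<theta>. \<exists>\<sigma>\<in>AG \<xi>. \<bar>\<sigma> - \<tau>\<bar> \<le> 2 * (C * \<epsilon>))"
    if m: "matched \<epsilon> \<theta> \<xi>" and \<epsilon>: "0 < \<epsilon>" "\<epsilon> < 1" for \<epsilon> \<theta> \<xi>
  proof -
    have \<theta>: "\<theta> \<in> \<Theta>" using m by (simp add: matched_def)
    interpret T: form_resolvent s "d \<theta>" H "Lf \<epsilon> \<theta>" "T \<epsilon> \<theta>" by (rule T[OF \<theta> \<epsilon>])
    interpret G: form_resolvent s "d 0" "V 0" "S \<xi>" "G \<xi>" by (rule G)
    have near: "dn \<theta> (T \<epsilon> \<theta> (E \<theta> g) - E \<theta> (G \<xi> g)) \<le> (C * \<epsilon>) * dn 0 g" for g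
    proof -
      have "Cn * \<epsilon> * dn 0 g \<le> max Cn Cf * \<epsilon> * dn 0 g" "Cf * \<epsilon> * dn 0 g \<le> max Cn Cf * \<epsilon> * dn 0 g"
        using \<epsilon> dn_ge_0[OF zero_in_\<Theta>, of g] by (auto intro!: mult_right_mono)
      then have "dn \<theta> (T \<epsilon> \<theta> (E \<theta> g) - E \<theta> (G \<xi> g)) \<le> max Cn Cf * \<epsilon> * dn 0 g"
        using m Cn[OF \<theta> \<epsilon>, of \<xi> g] Cf[OF \<theta> _ \<epsilon>, of \<xi> g] unfolding matched_def by fastforce
      also have "\<dots> \<le> C * \<epsilon> * dn 0 g"
        using \<epsilon> Cn0(1) Cf0(1) dn_ge_0[OF zero_in_\<Theta>, of g] by (intro mult_right_mono) (auto simp: C_def)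
      finally show ?thesis .
    qed
    have "C * \<epsilon> > 0" using C \<epsilon> by simp
    then show ?thesis
      using approx_spectrum_transfer[OF G.sym_op_axioms T.sym_op_axioms d_definite[OF \<theta>] E_bij[OF \<theta>] E_d[OF \<theta>] near]
      unfolding AT_def AG_def by blast
  qed
  have match1: "\<exists>\<xi>. matched \<epsilon> \<theta> \<xi>" if "\<theta> \<in> \<Theta>" "0 < \<epsilon>" for \<epsilon> \<theta>
    using that by (intro exI[of _ "(1 / \<epsilon>) *\<^sub>R \<theta>"]) (simp add: matched_def)
  have match2: "\<exists>\<theta>. matched \<epsilon> \<theta> \<xi>" if "0 < \<epsilon>" for \<epsilon> \<xi>
  proof (cases "\<epsilon> *\<^sub>R \<xi> \<in> \<Theta>")
    case True
    then show ?thesis by (auto simp: matched_def)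
  next
    case False
    then have "\<not> norm (\<epsilon> *\<^sub>R \<xi>) \<le> r" using ball_\<Theta> by blast
    then have "r \<le> \<epsilon> * norm \<xi>" using that by simp
    \<comment> \<open>As |\<epsilon> \<xi>| exceeds \<open>r\<close>, any \<theta> of norm
      \<open>r\<close> makes both far from 0.\<close>
    moreover obtain \<theta> :: "real^'n" where "norm \<theta> = r" using r_pos vector_choose_size[of r] by auto
    ultimately show ?thesis using ball_\<Theta>[of \<theta>] by (auto simp: matched_def)
  qed
  \<comment> \<open>The factor 2 is the one lost in \<open>approx_spectrum_transfer\<close>.\<close>
  have "close_spectra (\<lambda>\<epsilon>. \<Union>\<theta>\<in>\<Theta>. spectrum s UNIV (d \<theta>) (L_op H a b d \<epsilon> \<theta>))
    (\<Union>\<xi>. spectrum s X (d 0) (form_operator X (d 0) (V 0) (S \<xi>))) (2 * C)"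
  proof
    show "0 \<le> 2 * C" using C by simp
  next
    fix \<epsilon> \<mu> assume \<epsilon>: "0 < \<epsilon>" "\<epsilon> < (1::real)"
      and "\<mu> \<in> (\<Union>\<theta>\<in>\<Theta>. spectrum s UNIV (d \<theta>) (L_op H a b d \<epsilon> \<theta>))" and small: "2 * C * \<epsilon> * (1 + cmod \<mu>) \<le> 1 / 2"
    then obtain \<theta> where \<theta>: "\<theta> \<in> \<Theta>" "\<mu> \<in> resolvent_spectrum (AT \<epsilon> \<theta>)" using spT by blast
    obtain \<xi> where m: "matched \<epsilon> \<theta> \<xi>" using match1[OF \<theta>(1) \<epsilon>(1)] by blast
    have "\<exists>\<nu>\<in>resolvent_spectrum (AG \<xi>). cmod (\<mu> - \<nu>) \<le> 2 * (2 * C * \<epsilon>) * (1 + cmod \<mu>)\<^sup>2"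
      using AT1[OF \<theta>(1) \<epsilon>] transfer[OF m \<epsilon>] C \<epsilon> small
      by (intro resolvent_spectrum_close[OF _ _ \<theta>(2)]) (auto simp: mult.assoc)
    then show "\<exists>\<nu>\<in>\<Union>\<xi>. spectrum s X (d 0) (form_operator X (d 0) (V 0) (S \<xi>)).
        cmod (\<mu> - \<nu>) \<le> 2 * (2 * C * \<epsilon>) * (1 + cmod \<mu>)\<^sup>2"
      unfolding spG by blast
  next
    fix \<epsilon> \<nu> assume \<epsilon>: "0 < \<epsilon>" "\<epsilon> < (1::real)"
      and "\<nu> \<in> (\<Union>\<xi>. spectrum s X (d 0) (form_operator X (d 0) (V 0) (S \<xi>)))"
      and small: "2 * C * \<epsilon> * (1 + cmod \<nu>) \<le> 1 / 2"
    then obtain \<xi> where \<xi>: "\<nu> \<in> resolvent_spectrum (AG \<xi>)" unfolding spG by blast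
    obtain \<theta> where m: "matched \<epsilon> \<theta> \<xi>" using match2[OF \<epsilon>(1)] by blast
    then have \<theta>: "\<theta> \<in> \<Theta>" by (simp add: matched_def)
    have "\<exists>\<mu>\<in>resolvent_spectrum (AT \<epsilon> \<theta>). cmod (\<nu> - \<mu>) \<le> 2 * (2 * C * \<epsilon>) * (1 + cmod \<nu>)\<^sup>2"
      using AG1[of _ \<xi>] transfer[OF m \<epsilon>] C \<epsilon> small
      by (intro resolvent_spectrum_close[OF _ _ \<xi>]) (auto simp: mult.assoc)
    then show "\<exists>\<mu>\<in>\<Union>\<theta>\<in>\<Theta>. spectrum s UNIV (d \<theta>) (L_op H a b d \<epsilon> \<theta>).
        cmod (\<nu> - \<mu>) \<le> 2 * (2 * C * \<epsilon>) * (1 + cmod \<nu>)\<^sup>2"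
      using spT[OF \<theta> \<epsilon>] \<theta> by blast
  next
    fix \<epsilon> \<mu> assume \<epsilon>: "0 < \<epsilon>" "\<epsilon> < (1::real)"
      and "\<mu> \<in> (\<Union>\<theta>\<in>\<Theta>. spectrum s UNIV (d \<theta>) (L_op H a b d \<epsilon> \<theta>))"
    then obtain \<theta> \<tau> where "\<theta> \<in> \<Theta>" "\<tau> \<in> AT \<epsilon> \<theta>" "\<tau> > 0" "\<mu> = complex_of_real (1 / \<tau> - 1)"
      using spT by (auto simp: resolvent_spectrum_def)
    then show "0 \<le> Re \<mu>" using AT1[OF _ \<epsilon>] by (simp only: Re_complex_of_real) simp
  next
    fix \<nu> assume "\<nu> \<in> (\<Union>\<xi>. spectrum s X (d 0) (form_operator X (d 0) (V 0) (S \<xi>)))"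
    then obtain \<xi> \<tau> where "\<tau> \<in> AG \<xi>" "\<tau> > 0" "\<nu> = complex_of_real (1 / \<tau> - 1)"
      unfolding spG by (auto simp: resolvent_spectrum_def)
    then show "0 \<le> Re \<nu>" using AG1 by (simp only: Re_complex_of_real) simp
  next
    assume "(\<Union>\<xi>. spectrum s X (d 0) (form_operator X (d 0) (V 0) (S \<xi>))) \<noteq> {}"
    then obtain \<xi> \<tau> where \<tau>: "\<tau> \<in> AG \<xi>" "\<tau> > 0"
      unfolding spG by (auto simp: resolvent_spectrum_def)
    interpret G: form_resolvent s "d 0" "V 0" "S \<xi>" "G \<xi>" by (rule G)
    obtain x where x: "dn 0 (G \<xi> x - s (of_real \<tau>) x) < \<tau> * dn 0 x"
      using approx_spectrumD[of \<tau> s "d 0" "G \<xi>" \<tau>] \<tau> unfolding AG_def by blast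
    \<comment> \<open>An approximate eigenvector for a positive value has a nonzero image in
      \<open>V 0\<close>, which then serves as trial vector at \<theta> = 0.\<close>
    define v where "v = G \<xi> x"
    have v: "v \<in> V 0" by (simp add: v_def G.T_dom)
    have "v \<noteq> 0"
    proof
      assume "v = 0"
      then have "dn 0 (G \<xi> x - s (of_real \<tau>) x) = \<tau> * dn 0 x"
        using \<tau>(2) by (simp add: v_def G.fnorm_scale G.fnorm_minus)
      then show False using x by simp
    qed
    then have "dn 0 v \<noteq> 0"
      using d_definite[OF zero_in_\<Theta>, of v] by (auto simp: G.form_self)
    then have nv: "dn 0 v > 0" using dn_ge_0[OF zero_in_\<Theta>, of v] by simp
    define c where "c = 1 - sqrt (1 - Re (d 0 v v) / (Re (b 0 v v) + Re (d 0 v v)))"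
    \<comment> \<open>The Rayleigh quotient of \<open>v\<close> at \<open>\<theta> = 0\<close> does not depend on \<open>\<epsilon>\<close>, as \<open>a 0 v v = 0\<close>.\<close>
    have "c > 0 \<and> (\<exists>\<tau>\<in>AT \<epsilon> 0. c \<le> \<tau>)" if \<epsilon>: "0 < \<epsilon>" "\<epsilon> < 1" for \<epsilon>
    proof -
      have "a 0 v v = 0" using v by (simp add: null_space_def)
      then show ?thesis
        using form_resolvent.approx_spectrum_rayleigh[OF T[OF zero_in_\<Theta> \<epsilon>] V0_in[OF v] nv]
        unfolding AT_def c_def by simp
    qed
    note ray = this
    have "\<exists>\<mu>\<in>\<Union>\<theta>\<in>\<Theta>. spectrum s UNIV (d \<theta>) (L_op H a b d \<epsilon> \<theta>). cmod \<mu> \<le> 1 / c"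
      if \<epsilon>: "0 < \<epsilon>" "\<epsilon> < 1" for \<epsilon>
    proof -
      obtain \<sigma> where \<sigma>: "\<sigma> \<in> AT \<epsilon> 0" "c \<le> \<sigma>" "c > 0" using ray[OF \<epsilon>] by blast
      have "\<sigma> \<le> 1" using AT1[OF zero_in_\<Theta> \<epsilon> \<sigma>(1)] .
      then have "0 \<le> 1 / \<sigma> - 1" using \<sigma> by simp
      then have "cmod (complex_of_real (1 / \<sigma> - 1)) \<le> 1 / \<sigma>" unfolding norm_of_real by simp
      also have "\<dots> \<le> 1 / c" using \<sigma> by (intro divide_left_mono) auto
      finally have "cmod (complex_of_real (1 / \<sigma> - 1)) \<le> 1 / c" .
      moreover have "complex_of_real (1 / \<sigma> - 1) \<in> spectrum s UNIV (d 0) (L_op H a b d \<epsilon> 0)"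
        unfolding spT[OF zero_in_\<Theta> \<epsilon>] resolvent_spectrum_def using \<sigma> by (intro imageI) simp
      ultimately show ?thesis using zero_in_\<Theta> by blast
    qed
    then show "\<exists>M. \<forall>\<epsilon>. 0 < \<epsilon> \<longrightarrow> \<epsilon> < 1 \<longrightarrow>
        (\<exists>\<mu>\<in>\<Union>\<theta>\<in>\<Theta>. spectrum s UNIV (d \<theta>) (L_op H a b d \<epsilon> \<theta>). cmod \<mu> \<le> M)" by blast
  qed
  then show ?thesis by blast
qed

end

section \<open>Fixing the constants and deducing the theorem\<close>

theorem corollary6p6:
  fixes s :: "complex \<Rightarrow> 'h::ab_group_add \<Rightarrow> 'h"
    and H :: "'h set"
    and ip ipA :: "'h \<Rightarrow> 'h \<Rightarrow> complex"
    and \<Theta> :: "(real^'n) set"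
    and a b d :: "real^'n \<Rightarrow> 'h \<Rightarrow> 'h \<Rightarrow> complex"
    and Vs Z :: "'h set"
    and a' :: "'h \<Rightarrow> 'h \<Rightarrow> complex^'n"
    and a'' :: "'h \<Rightarrow> 'h \<Rightarrow> complex^'n^'n"
    and E :: "real^'n \<Rightarrow> 'h \<Rightarrow> 'h"
  assumes "form_family s H ip \<Theta> a b"
    and "spectral_gap H \<Theta> a b"
    and "removable_singularity s H ip \<Theta> a b Vs"
    and "complement_of_V_star s H ip a b Vs Z"
    and "quadratic_degeneracy H \<Theta> a b"
    and "a_regularity s H \<Theta> a b a' a''"
    and "b_regularity H \<Theta> a b"
    and "ambient_space s H ip ipA \<Theta> b d"
    and "unitary_transfer s H \<Theta> a b d Vs Z E"
  shows "(\<exists>C. \<forall>\<beta>::real. \<exists>C\<^sub>b \<le> C * (1 + \<beta>\<^sup>2). \<forall>\<alpha> \<epsilon>. \<alpha> \<le> \<beta> \<longrightarrow> 0 < \<epsilon> \<longrightarrow> \<epsilon> < 1 \<longrightarrow>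
            dist_interval \<alpha> \<beta> (L_spectra s H \<Theta> a b d \<epsilon>) (L_hom_spectra s H ipA a b d a' a'' Vs Z)
              \<le> ereal (C\<^sub>b * \<epsilon>)) \<and>
         limitin fell_topology (L_spectra s H \<Theta> a b d) (L_hom_spectra s H ipA a b d a' a'' Vs Z)
           (at_right 0)"
proof -
  interpret vector_space s using assms(1) by (simp add: form_family_def hilbert_space_on_def)
  have H: "hilbert_space_on s H ip" and \<Theta>: "compact \<Theta>" "0 \<in> interior \<Theta>"
    and forms: "\<And>\<theta>. \<theta> \<in> \<Theta> \<Longrightarrow> nonneg_form_on s H (a \<theta>) \<and> nonneg_form_on s H (b \<theta>) \<and>
        inner_product_on s H (norm_form a b \<theta>) \<and> equivalent_norms_on H (norm_form a b \<theta>) ip"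
    using assms(1) unfolding form_family_def by blast+
  have \<Theta>0: "0 \<in> \<Theta>" using \<Theta>(2) interior_subset by blast
  obtain K where K: "\<And>u \<theta>\<^sub>1 \<theta>\<^sub>2. u \<in> H \<Longrightarrow> \<theta>\<^sub>1 \<in> \<Theta> \<Longrightarrow> \<theta>\<^sub>2 \<in> \<Theta> \<Longrightarrow>
      form_norm (norm_form a b \<theta>\<^sub>1) u \<le> K * form_norm (norm_form a b \<theta>\<^sub>2) u"
    using assms(1) unfolding form_family_def by blast
  obtain L where L: "L > 0" "\<And>u v \<theta>\<^sub>1 \<theta>\<^sub>2. u \<in> H \<Longrightarrow> v \<in> H \<Longrightarrow> \<theta>\<^sub>1 \<in> \<Theta> \<Longrightarrow> \<theta>\<^sub>2 \<in> \<Theta> \<Longrightarrow>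
      cmod (a \<theta>\<^sub>1 u v - a \<theta>\<^sub>2 u v)
        \<le> L * norm (\<theta>\<^sub>1 - \<theta>\<^sub>2) * form_norm (norm_form a b \<theta>\<^sub>1) u * form_norm (norm_form a b \<theta>\<^sub>1) v"
    using assms(1) unfolding form_family_def by blast
  obtain \<nu> where \<nu>: "\<nu> > 0" "\<And>w. w \<in> null_complement H a b 0 \<Longrightarrow>
      \<nu> * (form_norm (norm_form a b 0) w)\<^sup>2 \<le> Re (a 0 w w)"
    using assms(2) \<Theta>0 unfolding spectral_gap_def by blast
  have Vs: "subspace Vs" using assms(3) by (simp add: removable_singularity_def closed_subspace_def)
  obtain Ls where Ls: "Ls \<ge> 0" "\<And>\<theta>\<^sub>1 \<theta>\<^sub>2 v\<^sub>1. \<theta>\<^sub>1 \<in> \<Theta> \<Longrightarrow> \<theta>\<^sub>2 \<in> \<Theta> \<Longrightarrow> v\<^sub>1 \<in> V_star H a Vs \<theta>\<^sub>1 \<Longrightarrow>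
      (INF v\<^sub>2\<in>V_star H a Vs \<theta>\<^sub>2. form_norm (norm_form a b \<theta>\<^sub>2) (v\<^sub>1 - v\<^sub>2))
        \<le> Ls * norm (\<theta>\<^sub>1 - \<theta>\<^sub>2) * form_norm (norm_form a b \<theta>\<^sub>1) v\<^sub>1"
    using assms(3) unfolding removable_singularity_def by blast
  have Z: "subspace Z" "direct_sum (null_space H a 0) Vs Z"
    using assms(4) by (simp_all add: complement_of_V_star_def closed_subspace_def)
  obtain KZ where KZ: "0 \<le> KZ" "KZ < 1" "\<And>v z. v \<in> Vs \<Longrightarrow> z \<in> Z \<Longrightarrow> cmod (norm_form a b 0 v z)
      \<le> KZ * form_norm (norm_form a b 0) v * form_norm (norm_form a b 0) z"
    using assms(4) unfolding complement_of_V_star_def by blast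
  obtain \<gamma> where \<gamma>: "\<gamma> > 0" "\<And>\<theta> w. \<theta> \<in> \<Theta> \<Longrightarrow> w \<in> null_complement H a b \<theta> \<Longrightarrow>
      \<gamma> * (norm \<theta>)\<^sup>2 * (form_norm (norm_form a b \<theta>) w)\<^sup>2 \<le> Re (a \<theta> w w)"
    using assms(5) unfolding quadratic_degeneracy_def by blast
  have a': "\<And>i. sesquilinear_on s (null_space H a 0) H (\<lambda>v u. a' v u $ i)"
    "\<And>i j. sesquilinear_on s (null_space H a 0) (null_space H a 0) (\<lambda>v u. a'' v u $ i $ j)"
    using assms(6) unfolding a_regularity_def by blast+
  obtain Ka where Ka: "Ka \<ge> 0" "\<And>v u \<theta>. v \<in> null_space H a 0 \<Longrightarrow> u \<in> H \<Longrightarrow> \<theta> \<in> \<Theta> \<Longrightarrow>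
      cmod (a \<theta> v u - cdot (a' v u) \<theta>)
        \<le> Ka * (norm \<theta>)\<^sup>2 * form_norm (norm_form a b 0) v * form_norm (norm_form a b 0) u"
    using assms(6) unfolding a_regularity_def by blast
  obtain Ka2 where Ka2: "Ka2 \<ge> 0" "\<And>v u \<theta>. v \<in> null_space H a 0 \<Longrightarrow> u \<in> null_space H a 0 \<Longrightarrow> \<theta> \<in> \<Theta> \<Longrightarrow>
      cmod (a \<theta> v u - cdot (a'' v u *v cvec \<theta>) \<theta>)
        \<le> Ka2 * norm \<theta> ^ 3 * form_norm (norm_form a b 0) v * form_norm (norm_form a b 0) u"
    using assms(6) unfolding a_regularity_def by blast
  obtain Lb where Lb: "Lb \<ge> 0" "\<And>v u \<theta>. v \<in> null_space H a 0 \<Longrightarrow> u \<in> null_space H a 0 \<Longrightarrow> \<theta> \<in> \<Theta> \<Longrightarrow>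
      cmod (b \<theta> v u - b 0 v u)
        \<le> Lb * norm \<theta> * form_norm (norm_form a b 0) v * form_norm (norm_form a b \<theta>) u"
    using assms(7) unfolding b_regularity_def by blast
  have A: "hilbert_space_on s UNIV ipA"
    and d: "\<And>\<theta>. \<theta> \<in> \<Theta> \<Longrightarrow> inner_product_on s UNIV (d \<theta>) \<and> equivalent_norms_on UNIV (d \<theta>) ipA"
    and db: "\<And>u \<theta>. u \<in> H \<Longrightarrow> \<theta> \<in> \<Theta> \<Longrightarrow> Re (d \<theta> u u) \<le> Re (b \<theta> u u)"
    using assms(8) unfolding ambient_space_def by blast+
  have E: "\<And>\<theta>. \<theta> \<in> \<Theta> \<Longrightarrow> bij_betw (E \<theta>) Vs (V_star H a Vs \<theta>) \<and>
      (\<forall>v\<in>Vs. \<forall>w\<in>Vs. b \<theta> (E \<theta> v) (E \<theta> w) = b 0 v w) \<and> bij (E \<theta>) \<and>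
      (\<forall>u w. d \<theta> (E \<theta> u) (E \<theta> w) = d 0 u w)"
    and E0: "E 0 = id"
    using assms(9) unfolding unitary_transfer_def by blast+
  obtain Kb where Kb: "Kb \<ge> 0" "\<And>\<theta> v z. \<theta> \<in> \<Theta> \<Longrightarrow> v \<in> Vs \<Longrightarrow> z \<in> Z \<Longrightarrow>
      cmod (b \<theta> (E \<theta> v) z - b 0 v z)
        \<le> Kb * norm \<theta> * form_norm (norm_form a b 0) v * form_norm (norm_form a b 0) z"
    using assms(9)[unfolded unitary_transfer_def, THEN conjunct2, THEN conjunct2, THEN conjunct1] by blast
  obtain Ke where Ke: "Ke \<ge> 0" "\<And>\<theta>\<^sub>1 \<theta>\<^sub>2 u. \<theta>\<^sub>1 \<in> \<Theta> \<Longrightarrow> \<theta>\<^sub>2 \<in> \<Theta> \<Longrightarrow>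
      form_norm (d \<theta>\<^sub>1) (E \<theta>\<^sub>1 u - E \<theta>\<^sub>2 u) \<le> Ke * norm (\<theta>\<^sub>1 - \<theta>\<^sub>2) * form_norm (d 0) u"
    using assms(9)[unfolded unitary_transfer_def, THEN conjunct2, THEN conjunct2, THEN conjunct2] by blast
  have E_near: "form_norm (d \<theta>) (E \<theta> u - u) \<le> Ke * norm \<theta> * form_norm (d 0) u" if "\<theta> \<in> \<Theta>" for \<theta> u
    using Ke(2)[OF that \<Theta>0, of u] by (simp add: E0)
  obtain r where r: "r > 0" "cball 0 r \<subseteq> \<Theta>" using \<Theta>(2) by (auto simp: mem_interior_cball)
  obtain R where R: "\<And>\<theta>. \<theta> \<in> \<Theta> \<Longrightarrow> norm \<theta> \<le> R"
    using compact_imp_bounded[OF \<Theta>(1)] by (auto simp: bounded_iff)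
  have H_sub: "subspace H" using H by (simp add: hilbert_space_on_def)
  have n: "pos_form s H (norm_form a b \<theta>)" if "\<theta> \<in> \<Theta>" for \<theta>
    using forms[OF that] by (intro pos_formI vector_space_axioms H_sub) (simp add: inner_product_on_def)
  have definite: "u = 0" if "\<theta> \<in> \<Theta>" "u \<in> H" "norm_form a b \<theta> u u = 0" for \<theta> u
    using forms[OF that(1)] that by (simp add: inner_product_on_def)
  \<comment> \<open>Guarantees that the infimum in the removability condition is taken over a
    nonempty set.\<close>
  have zero_star: "0 \<in> V_star H a Vs \<theta>" if "\<theta> \<in> \<Theta>" for \<theta>
    using forms[OF that] subspace_0[OF Vs] subspace_0[OF H_sub]
      pos_form.form_zero_left[OF pos_formI[OF vector_space_axioms H_sub], of "a \<theta>" 0]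
    by (simp add: V_star_def null_space_def)
  \<comment> \<open>The infimum need not be attained, which costs an increase of the constant.\<close>
  have near: "\<exists>v2\<in>V_star H a Vs \<theta>2. form_norm (norm_form a b \<theta>2) (v1 - v2)
      \<le> (Ls + 1) * norm (\<theta>1 - \<theta>2) * form_norm (norm_form a b \<theta>1) v1"
    if \<theta>: "\<theta>1 \<in> \<Theta>" "\<theta>2 \<in> \<Theta>" and v1: "v1 \<in> V_star H a Vs \<theta>1" for \<theta>1 \<theta>2 v1
  proof -
    interpret N1: pos_form s H "norm_form a b \<theta>1" by (rule n[OF \<theta>(1)])
    interpret N2: pos_form s H "norm_form a b \<theta>2" by (rule n[OF \<theta>(2)])
    have v1H: "v1 \<in> H"
      using v1 Z(2) subspace_0[OF Z(1)] by (force simp: V_star_def null_space_def direct_sum_def split: if_splits)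
    \<comment> \<open>In the first two cases the bound is 0, so no slack is available and the
      approximant is given explicitly.\<close>
    consider "\<theta>1 = \<theta>2" | "form_norm (norm_form a b \<theta>1) v1 = 0"
      | "\<theta>1 \<noteq> \<theta>2" "form_norm (norm_form a b \<theta>1) v1 > 0"
      using N1.fnorm_ge_0[OF v1H] by fastforce
    then show ?thesis
    proof cases
      case 1
      then show ?thesis using v1 by (intro bexI[of _ v1]) (simp_all add: N2.fnorm_zero)
    next
      case 2
      then have "v1 = 0" using definite[OF \<theta>(1) v1H] N1.form_self[OF v1H] by simp
      then show ?thesis using zero_star[OF \<theta>(2)] by (intro bexI[of _ 0]) (simp_all add: N2.fnorm_zero N1.fnorm_zero)
    next
      case 3
      then have "(INF v2\<in>V_star H a Vs \<theta>2. form_norm (norm_form a b \<theta>2) (v1 - v2))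
          < (Ls + 1) * norm (\<theta>1 - \<theta>2) * form_norm (norm_form a b \<theta>1) v1"
        using Ls(2)[OF \<theta> v1] by (intro le_less_trans[OF Ls(2)[OF \<theta> v1]] mult_strict_right_mono) auto
      then show ?thesis
        using cInf_lessD[of "(\<lambda>v2. form_norm (norm_form a b \<theta>2) (v1 - v2)) ` V_star H a Vs \<theta>2"]
          zero_star[OF \<theta>(2)] by (blast intro: less_imp_le)
    qed
  qed
  interpret two_scale s H \<Theta> a b d Vs Z a' a'' E r R "max K 1" L "Ls + 1" KZ \<gamma> \<nu> Ka Ka2 Lb Kb Ke
  proof (unfold_locales, goal_cases)
    case (3 \<theta>)
    then show ?case using r(2) by auto
  next
    case (8 \<theta>)
    then show ?case using norm_complete_equivalent_norms[OF H] forms by blast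
  next
    case (10 \<theta>1 \<theta>2 u)
    have "K * form_norm (norm_form a b \<theta>2) u \<le> max K 1 * form_norm (norm_form a b \<theta>2) u"
      using pos_form.fnorm_ge_0[OF n[OF 10(2)] 10(3)] by (intro mult_right_mono) auto
    then show ?case using K[OF 10(3,1,2)] by linarith
  next
    case (12 \<theta> u v)
    \<comment> \<open>The Lipschitz condition measures with the norm of its first parameter, which
      is therefore taken to be 0.\<close>
    have "cmod (a \<theta> u v - a 0 u v) = cmod (a 0 u v - a \<theta> u v)" by (rule norm_minus_commute)
    then show ?case using L(2)[OF 12(2,3) \<Theta>0 12(1)] by simp
  qed (use H_sub r R forms definite L \<nu> Vs Z Ls near KZ \<gamma> a' Ka Ka2 Lb d db E Kb Ke(1) E_near in
      \<open>auto simp: bij_betw_imp_surj_on qdot_def norm_complete_equivalent_norms[OF A]\<close>)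
  \<comment> \<open>The form domain of the homogenised operator is the null space at 0, the form in
    which \<open>spectra_close\<close> expects it.\<close>
  have V0: "{v + z | v z. v \<in> Vs \<and> z \<in> Z} = null_space H a 0"
    using Z(2) by (simp add: direct_sum_def)
  define X where "X = H_zero ipA Vs Z"
  have X: "subspace X" "null_space H a 0 \<subseteq> X"
    unfolding X_def H_zero_def V0
    using subspace_closure_of[OF A V_subspace[OF \<Theta>0]] by auto
  obtain C where "close_spectra (\<lambda>\<epsilon>. \<Union>\<theta>\<in>\<Theta>. spectrum s UNIV (d \<theta>) (L_op H a b d \<epsilon> \<theta>))
      (\<Union>\<xi>. spectrum s X (d 0) (L_hom_op H ipA a b d a' a'' Vs Z \<xi>)) C"
    using spectra_close[OF X] unfolding L_hom_op_def V0 X_def by blast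
  then interpret close_spectra "\<lambda>\<epsilon>. \<Union>\<theta>\<in>\<Theta>. spectrum s UNIV (d \<theta>) (L_op H a b d \<epsilon> \<theta>)"
      "\<Union>\<xi>. spectrum s X (d 0) (L_hom_op H ipA a b d a' a'' Vs Z \<xi>)" C .
  have "L_spectra s H \<Theta> a b d = (\<lambda>\<epsilon>. closure (\<Union>\<theta>\<in>\<Theta>. spectrum s UNIV (d \<theta>) (L_op H a b d \<epsilon> \<theta>)))"
    "L_hom_spectra s H ipA a b d a' a'' Vs Z = closure (\<Union>\<xi>. spectrum s X (d 0) (L_hom_op H ipA a b d a' a'' Vs Z \<xi>))"
    by (simp_all add: L_spectra_def[abs_def] L_hom_spectra_def X_def)
  then show ?thesis
    using dist_interval_bound fell_convergence by simp
qed

end
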